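(* Let $p$ be prime and $n\ge2$. Let $S$ be a free profinite group, $N$ a closed normal subgroup of $S$ contained in $S^{(n,p)}$, and $G=S/N$. Then: (a) $\bigcap_{s=1}^n T^{\bar{\mathbb{U}}_{n,s}}(G)=G^{(n,p)}$; (b) $\bigcap_{s=1}^n T^{\mathbb{U}_{n,s}}(G)=G^{(n+1,p)}$ if and only if the kernel of $\inf\colon H^2(G/G^{(n,p)})\to H^2(G)$ is generated by the $n$-unitriangular elements lying in it.
   Context: For profinite groups $\mathbb{U}$ and $G$, $T^{\mathbb{U}}(G)$ denotes the intersection of the kernels of all continuous homomorphisms $G\to\mathbb{U}$. For a commutative ring $R$, $\mathbb{U}_s(R)$ is the group of unipotent upper-triangular $(s+1)\times(s+1)$ matrices over $R$. For $1\le s\le n$ put $\mathbb{U}_{n,s}=\mathbb{U}_s(\mathbb{Z}/p^{n-s+1})$, and let $\bar{\mathbb{U}}_{n,s}$ be the quotient of $\mathbb{U}_{n,s}$ by the central subgroup of order $p$ generated by $I+p^{n-s}E_{1,s+1}$; this gives central extensions $\omega_{n,s}\colon 0\to\mathbb{Z}/p\to\mathbb{U}_{n,s}\to\bar{\mathbb{U}}_{n,s}\to1$ with classes $\alpha_{n,s}\in H^2(\bar{\mathbb{U}}_{n,s},\mathbb{Z}/p)$. Cohomology is $H^i(\cdot)=H^i(\cdot,\mathbb{Z}/p)$ with trivial action. The $n$-unitriangular elements of $H^2(G/G^{(n,p)})$ are the pullbacks $\bar\rho^*(\alpha_{n,s})$, $1\le s\le n$, along continuous $\bar\rho\colon G/G^{(n,p)}\to\bar{\mathbb{U}}_{n,s}$.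 The lower $p$-central filtration is $G^{(1,p)}=G$, $G^{(k+1,p)}=(G^{(k,p)})^p[G,G^{(k,p)}]$ (closed subgroups generated). *)

theory Defs
  imports "HOL-Analysis.Analysis" "HOL-Algebra.Coset" "HOL-Algebra.Generated_Groups"
begin

definition topological_group :: "('g,'x) monoid_scheme \<Rightarrow> 'g topology \<Rightarrow> bool" where
  "topological_group G T \<longleftrightarrow> group G \<and> topspace T = carrier G
     \<and> continuous_map (prod_topology T T) T (\<lambda>(x,y). x \<otimes>\<^bsub>G\<^esub> y)
     \<and> continuous_map T T (\<lambda>x. inv\<^bsub>G\<^esub> x)"

definition totally_disconnected_space :: "'g topology \<Rightarrow> bool" where
  "totally_disconnected_space T \<longleftrightarrow>
     (\<forall>C. connectedin T C \<longrightarrow> C = {} \<or> (\<exists>x. C = {x}))"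

definition profinite_group :: "('g,'x) monoid_scheme \<Rightarrow> 'g topology \<Rightarrow> bool" where
  "profinite_group G T \<longleftrightarrow> topological_group G T \<and> compact_space T \<and> Hausdorff_space T
     \<and> totally_disconnected_space T"

definition closed_subgroup_gen :: "('g,'x) monoid_scheme \<Rightarrow> 'g topology \<Rightarrow> 'g set \<Rightarrow> 'g set" where
  "closed_subgroup_gen G T A = \<Inter>{H. subgroup H G \<and> closedin T H \<and> A \<subseteq> H}"

definition cont_hom_fin :: "('g,'x) monoid_scheme \<Rightarrow> 'g topology \<Rightarrow> ('h,'y) monoid_scheme \<Rightarrow> ('g \<Rightarrow> 'h) set" where
  "cont_hom_fin G T P = {h. h \<in> hom G P \<and> continuous_map T (discrete_topology (carrier P)) h}"

text \<open>Free profinite group on a set converging to 1 (Fried--Jarden, 17.4): there is a subset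
  X converging to 1 which generates S topologically and such that every map from X into a finite
  group, sending almost all elements of X to 1, extends to a continuous homomorphism.
  Finite groups are taken up to isomorphism as groups with carrier a finite set of naturals.\<close>
definition free_profinite_group :: "('g,'x) monoid_scheme \<Rightarrow> 'g topology \<Rightarrow> bool" where
  "free_profinite_group S T \<longleftrightarrow> profinite_group S T \<and>
     (\<exists>Bs. Bs \<subseteq> carrier S \<and>
        (\<forall>V. openin T V \<and> \<one>\<^bsub>S\<^esub> \<in> V \<longrightarrow> finite (Bs - V))
      \<and> closed_subgroup_gen S T Bs = carrier S
      \<and> (\<forall>P f. group (P :: nat monoid) \<and> finite (carrier P) \<and> f \<in> (Bs \<rightarrow> carrier P)
            \<and> finite {x \<in> Bs. f x \<noteq> \<one>\<^bsub>P\<^esub>}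
            \<longrightarrow> (\<exists>h \<in> cont_hom_fin S T P. \<forall>x\<in>Bs. h x = f x)))"

definition quot_top :: "('g,'x) monoid_scheme \<Rightarrow> 'g topology \<Rightarrow> 'g set \<Rightarrow> 'g set topology" where
  "quot_top G T N = topology (\<lambda>U. U \<subseteq> carrier (G Mod N) \<and> openin T (\<Union>U))"

definition gcomm :: "('g,'x) monoid_scheme \<Rightarrow> 'g \<Rightarrow> 'g \<Rightarrow> 'g" where
  "gcomm G x y = x \<otimes>\<^bsub>G\<^esub> y \<otimes>\<^bsub>G\<^esub> inv\<^bsub>G\<^esub> x \<otimes>\<^bsub>G\<^esub> inv\<^bsub>G\<^esub> y"

text \<open>lpc G T p k is G^(k,p); G^(1,p) = G (and by convention also index 0 gives G).\<close>
fun lpc :: "('g,'x) monoid_scheme \<Rightarrow> 'g topology \<Rightarrow> nat \<Rightarrow> nat \<Rightarrow> 'g set" where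
  "lpc G T p 0 = carrier G"
| "lpc G T p (Suc 0) = carrier G"
| "lpc G T p (Suc (Suc k)) = closed_subgroup_gen G T
     ({x [^]\<^bsub>G\<^esub> p | x. x \<in> lpc G T p (Suc k)}
      \<union> {gcomm G x y | x y. x \<in> carrier G \<and> y \<in> lpc G T p (Suc k)})"

definition TU :: "('g,'x) monoid_scheme \<Rightarrow> 'g topology \<Rightarrow> ('h,'y) monoid_scheme \<Rightarrow> 'g set" where
  "TU G T U = {g \<in> carrier G. \<forall>h \<in> cont_hom_fin G T U. h g = \<one>\<^bsub>U\<^esub>}"

type_synonym mat = "nat \<Rightarrow> nat \<Rightarrow> int"

text \<open>U_s(Z/m): unipotent upper-triangular (s+1)x(s+1) matrices over Z/m, indices 0..s,
  entries represented by residues in {0..<m}.\<close>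
definition unitri :: "nat \<Rightarrow> nat \<Rightarrow> mat monoid" where
  "unitri s m = \<lparr> carrier = {A. \<forall>i j. if i \<le> s \<and> j \<le> s \<and> i < j then A i j \<in> {0..<int m}
                                   else A i j = (if i = j \<and> i \<le> s then 1 else 0)},
                 mult = (\<lambda>A B i j. if i \<le> s \<and> j \<le> s then (\<Sum>k\<le>s. A i k * B k j) mod int m else 0),
                 one = (\<lambda>i j. if i = j \<and> i \<le> s then 1 else 0) \<rparr>"

definition Unm :: "nat \<Rightarrow> nat \<Rightarrow> nat \<Rightarrow> mat monoid" where
  "Unm p n s = unitri s (p ^ (n - s + 1))"

text \<open>The central element I + p^(n-s) E_{1,s+1} (0-based: entry (0,s)).\<close>
definition zel :: "nat \<Rightarrow> nat \<Rightarrow> nat \<Rightarrow> mat" where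
  "zel p n s = (\<lambda>i j. if i = j \<and> i \<le> s then 1 else if i = 0 \<and> j = s then int (p ^ (n - s)) else 0)"

definition Ubar :: "nat \<Rightarrow> nat \<Rightarrow> nat \<Rightarrow> mat set monoid" where
  "Ubar p n s = Unm p n s Mod generate (Unm p n s) {zel p n s}"

definition cochain1 :: "('g,'x) monoid_scheme \<Rightarrow> 'g topology \<Rightarrow> nat \<Rightarrow> ('g \<Rightarrow> int) set" where
  "cochain1 G T p = {f. continuous_map T (discrete_topology {0..<int p}) f
                        \<and> (\<forall>x. x \<notin> carrier G \<longrightarrow> f x = 0)}"

definition cochain2 :: "('g,'x) monoid_scheme \<Rightarrow> 'g topology \<Rightarrow> nat \<Rightarrow> ('g \<Rightarrow> 'g \<Rightarrow> int) set" where
  "cochain2 G T p = {c. continuous_map (prod_topology T T) (discrete_topology {0..<int p}) (\<lambda>(x,y). c x y)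
                        \<and> (\<forall>x y. (x,y) \<notin> carrier G \<times> carrier G \<longrightarrow> c x y = 0)}"

definition Z2 :: "('g,'x) monoid_scheme \<Rightarrow> 'g topology \<Rightarrow> nat \<Rightarrow> ('g \<Rightarrow> 'g \<Rightarrow> int) set" where
  "Z2 G T p = {c \<in> cochain2 G T p. \<forall>x\<in>carrier G. \<forall>y\<in>carrier G. \<forall>z\<in>carrier G.
      (c y z - c (x \<otimes>\<^bsub>G\<^esub> y) z + c x (y \<otimes>\<^bsub>G\<^esub> z) - c x y) mod int p = 0}"

definition coboundary :: "('g,'x) monoid_scheme \<Rightarrow> nat \<Rightarrow> ('g \<Rightarrow> int) \<Rightarrow> 'g \<Rightarrow> 'g \<Rightarrow> int" where
  "coboundary G p f = (\<lambda>x y. if x \<in> carrier G \<and> y \<in> carrier G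
                               then (f y - f (x \<otimes>\<^bsub>G\<^esub> y) + f x) mod int p else 0)"

definition B2 :: "('g,'x) monoid_scheme \<Rightarrow> 'g topology \<Rightarrow> nat \<Rightarrow> ('g \<Rightarrow> 'g \<Rightarrow> int) set" where
  "B2 G T p = coboundary G p ` cochain1 G T p"

definition h2cls :: "('g,'x) monoid_scheme \<Rightarrow> 'g topology \<Rightarrow> nat \<Rightarrow> ('g \<Rightarrow> 'g \<Rightarrow> int) \<Rightarrow> ('g \<Rightarrow> 'g \<Rightarrow> int) set" where
  "h2cls G T p c = {d \<in> Z2 G T p. (\<lambda>x y. (d x y - c x y) mod int p) \<in> B2 G T p}"

definition H2 :: "('g,'x) monoid_scheme \<Rightarrow> 'g topology \<Rightarrow> nat \<Rightarrow> ('g \<Rightarrow> 'g \<Rightarrow> int) set monoid" where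
  "H2 G T p = \<lparr> carrier = h2cls G T p ` Z2 G T p,
                mult = (\<lambda>A B. h2cls G T p (\<lambda>x y. ((SOME a. a \<in> A) x y + (SOME b. b \<in> B) x y) mod int p)),
                one = B2 G T p \<rparr>"

definition h2_pull :: "('g,'x) monoid_scheme \<Rightarrow> 'g topology \<Rightarrow> nat \<Rightarrow> ('g \<Rightarrow> 'q)
                        \<Rightarrow> ('q \<Rightarrow> 'q \<Rightarrow> int) set \<Rightarrow> ('g \<Rightarrow> 'g \<Rightarrow> int) set" where
  "h2_pull G T p \<rho> A = h2cls G T p (\<lambda>x y. if x \<in> carrier G \<and> y \<in> carrier G
                                            then (SOME c. c \<in> A) (\<rho> x) (\<rho> y) else 0)"

definition inflation :: "('g,'x) monoid_scheme \<Rightarrow> 'g topology \<Rightarrow> nat \<Rightarrow> 'g set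
                          \<Rightarrow> ('g set \<Rightarrow> 'g set \<Rightarrow> int) set \<Rightarrow> ('g \<Rightarrow> 'g \<Rightarrow> int) set" where
  "inflation G T p K A = h2_pull G T p (\<lambda>x. K #>\<^bsub>G\<^esub> x) A"

text \<open>Class alpha_{n,s} of the central extension 0 -> Z/p -> U_{n,s} -> Ubar_{n,s} -> 1,
  with Z/p identified with the subgroup generated by zel via 1 |-> zel; cocycle
  c(x,y) defined by sigma(x) sigma(y) = zel^c(x,y) sigma(xy) for a set-theoretic section sigma.\<close>
definition ext_cocycle :: "nat \<Rightarrow> nat \<Rightarrow> nat \<Rightarrow> mat set \<Rightarrow> mat set \<Rightarrow> int" where
  "ext_cocycle p n s = (\<lambda>q1 q2. if q1 \<in> carrier (Ubar p n s) \<and> q2 \<in> carrier (Ubar p n s)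
      then int (THE k. k < p \<and> (SOME x. x \<in> q1) \<otimes>\<^bsub>Unm p n s\<^esub> (SOME x. x \<in> q2)
               = (zel p n s [^]\<^bsub>Unm p n s\<^esub> k) \<otimes>\<^bsub>Unm p n s\<^esub> (SOME x. x \<in> q1 \<otimes>\<^bsub>Ubar p n s\<^esub> q2))
      else 0)"

definition alpha :: "nat \<Rightarrow> nat \<Rightarrow> nat \<Rightarrow> (mat set \<Rightarrow> mat set \<Rightarrow> int) set" where
  "alpha p n s = h2cls (Ubar p n s) (discrete_topology (carrier (Ubar p n s))) p (ext_cocycle p n s)"

definition unitriangular_elems :: "('q,'x) monoid_scheme \<Rightarrow> 'q topology \<Rightarrow> nat \<Rightarrow> nat
                                   \<Rightarrow> ('q \<Rightarrow> 'q \<Rightarrow> int) set set" where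
  "unitriangular_elems Q TQ p n =
     {h2_pull Q TQ p \<rho> (alpha p n s) | \<rho> s. s \<in> {1..n} \<and> \<rho> \<in> cont_hom_fin Q TQ (Ubar p n s)}"

end

theory Submission
  imports Defs
begin

text \<open>
  The kernel of inflation is the group of additive functions on \<open>K = G^(n,p)\<close> that are
  invariant under \<open>G\<close>: a cochain \<open>f\<close> on \<open>G\<close> cobounding an inflated class restricts to
  such a function, and conversely. Under this identification a unitriangular class in the kernel
  is the restriction to \<open>K\<close> of a homomorphism \<open>G \<rightarrow> U_{n,s}\<close>, since such homomorphisms are
  the lifts of the given map into the quotient of \<open>U_{n,s}\<close>. By duality for the elementary
  abelian group \<open>K / G^(n+1,p)\<close>, these restrictions generate everything if and only if their
  common kernel is \<open>G^(n+1,p)\<close>. Neither step uses that \<open>S\<close> is free.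

  Freeness enters through the fact that elements of \<open>S\<close> killed by all homomorphisms to the groups
  \<open>U_s(\<int>/p^(n-s))\<close>, \<open>s < n\<close>, lie in \<open>S^(n,p)\<close>. By density it suffices to treat positive words \<open>f\<close>
  in the basis, whose images under the representation attached to a word \<open>w\<close> have the number of
  embeddings of \<open>w\<close> in \<open>f\<close> as their corner entry. The word is then rewritten by Lazard elimination.
\<close>

section \<open>Binomial coefficients of words and Lazard elimination\<close>

text \<open>The modulus of \<open>Unm p n (s + 1)\<close> is \<open>p ^ (n - s)\<close>, so
  U_s(Z/p^(n-s)) sits in its upper left block, away from the corner generated by \<open>zel\<close>.
  A homomorphism into that block kills the n-th term of the filtration, hence descends to G, and its
  entries remain visible modulo \<open>zel\<close>. One family of homomorphisms therefore gives both
  (a) and the inclusion in G^(n,p) on which (b) rests. The same moduli are what elimination demands: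
  a letter of weight d occurring a multiple of p^(n-d) times contributes a power in the n-th term,
  and counting embeddings of positive words keeps every step an identity of natural numbers. In the
  cohomological half, the bound on n makes the passage from functions on K to classes injective: a
  homomorphism from G to Z/p is trivial on G^(2,p), which contains K. A function on K is carried by
  a cochain on all of G that is additive against K, so that its coboundary directly yields a cocycle
  on the quotient. The dual of K/G^(n+1,p) can be infinite; compactness of K reduces membership of
  one function in a span to finitely many others.\<close>

fun binom :: "'a list \<Rightarrow> 'a list \<Rightarrow> nat" where
  "binom f [] = 1"
| "binom [] (c # w) = 0"
| "binom (b # f) (c # w) = binom f (c # w) + (if b = c then binom f w else 0)"

lemma binom_map_inj:
  assumes "inj e"
  shows "binom (map e f) (map e w) = binom f w"
  by (induction f w rule: binom.induct) (auto simp: inj_eq[OF assms])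

definition wt :: "('a \<Rightarrow> nat) \<Rightarrow> 'a list \<Rightarrow> nat" where
  "wt \<omega> w = sum_list (map \<omega> w)"

lemma wt_simps [simp]: "wt \<omega> [] = 0" "wt \<omega> (c # w) = \<omega> c + wt \<omega> w"
  by (auto simp: wt_def)

text \<open>Natural number combinations of coefficients of weight at most \<open>k\<close>, with
  multiplicity given by repetition in the list. The constant term must be \<open>\<phi> []\<close>,
  since a nonempty word has coefficient zero in \<open>[]\<close>; it carries no weight bound and
  disappears for functions vanishing at \<open>[]\<close>.\<close>

definition binom_span :: "'a set \<Rightarrow> ('a \<Rightarrow> nat) \<Rightarrow> nat \<Rightarrow> ('a list \<Rightarrow> nat) \<Rightarrow> bool" where
  "binom_span X \<omega> k \<phi> \<longleftrightarrow> (\<exists>L. (\<forall>w\<in>set L. set w \<subseteq> X \<and> w \<noteq> [] \<and> wt \<omega> w \<le> k) \<and>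
     (\<forall>f. set f \<subseteq> X \<longrightarrow> \<phi> f = \<phi> [] + (\<Sum>w\<leftarrow>L. binom f w)))"

lemma binom_span_const: "binom_span X \<omega> k (\<lambda>f. c)"
  unfolding binom_span_def by (rule exI[of _ "[]"]) auto

lemma binom_span_add:
  assumes "binom_span X \<omega> k \<phi>" "binom_span X \<omega> k \<psi>"
  shows "binom_span X \<omega> k (\<lambda>f. \<phi> f + \<psi> f)"
proof -
  obtain L M where *: "\<forall>w\<in>set L. set w \<subseteq> X \<and> w \<noteq> [] \<and> wt \<omega> w \<le> k"
    "\<forall>w\<in>set M. set w \<subseteq> X \<and> w \<noteq> [] \<and> wt \<omega> w \<le> k"
    "\<And>f. set f \<subseteq> X \<longrightarrow> \<phi> f = \<phi> [] + (\<Sum>w\<leftarrow>L. binom f w)"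
    "\<And>f. set f \<subseteq> X \<longrightarrow> \<psi> f = \<psi> [] + (\<Sum>w\<leftarrow>M. binom f w)"
    using assms unfolding binom_span_def by blast
  have eq: "\<phi> f + \<psi> f = \<phi> [] + \<psi> [] + (\<Sum>w\<leftarrow>L @ M. binom f w)" if "set f \<subseteq> X" for f
    using *(3)[of f] *(4)[of f] that by simp
  show ?thesis
    unfolding binom_span_def
  proof (intro exI[of _ "L @ M"] conjI allI impI)
    show "\<forall>w\<in>set (L @ M). set w \<subseteq> X \<and> w \<noteq> [] \<and> wt \<omega> w \<le> k" using *(1,2) by auto
  qed (rule eq)
qed

lemma binom_span_sum_list:
  "(\<And>u. u \<in> set L \<Longrightarrow> binom_span X \<omega> k (\<phi> u)) \<Longrightarrow> binom_span X \<omega> k (\<lambda>f. \<Sum>u\<leftarrow>L. \<phi> u f)"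
  by (induction L) (auto intro: binom_span_const binom_span_add)

text \<open>Discrete integration: the finite difference of \<open>binom _ (c # w)\<close> in direction \<open>c\<close> is \<open>binom _ w\<close>.\<close>

lemma binom_span_integrate:
  assumes "finite X"
    and "\<And>c. c \<in> X \<Longrightarrow> \<omega> c \<le> k \<Longrightarrow> binom_span X \<omega> (k - \<omega> c) (d c)"
    and "\<And>c f. c \<in> X \<Longrightarrow> set f \<subseteq> X \<Longrightarrow> \<phi> (c # f) = \<phi> f + d c f"
    and "\<And>c f. c \<in> X \<Longrightarrow> \<not> \<omega> c \<le> k \<Longrightarrow> set f \<subseteq> X \<Longrightarrow> d c f = 0"
  shows "binom_span X \<omega> k \<phi>"
proof -
  have "\<forall>c\<in>X. \<exists>L. (\<forall>w\<in>set L. set w \<subseteq> X \<and> \<omega> c + wt \<omega> w \<le> k) \<and>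
     (\<forall>f. set f \<subseteq> X \<longrightarrow> d c f = (\<Sum>w\<leftarrow>L. binom f w))"
  proof
    fix c assume c: "c \<in> X"
    show "\<exists>L. (\<forall>w\<in>set L. set w \<subseteq> X \<and> \<omega> c + wt \<omega> w \<le> k) \<and>
     (\<forall>f. set f \<subseteq> X \<longrightarrow> d c f = (\<Sum>w\<leftarrow>L. binom f w))"
    proof (cases "\<omega> c \<le> k")
      case True
      then obtain L where L: "\<forall>w\<in>set L. set w \<subseteq> X \<and> w \<noteq> [] \<and> wt \<omega> w \<le> k - \<omega> c"
        "\<forall>f. set f \<subseteq> X \<longrightarrow> d c f = d c [] + (\<Sum>w\<leftarrow>L. binom f w)"
        using assms(2)[OF c True] unfolding binom_span_def by blast
      \<comment> \<open>The constant of \<open>d c\<close> is written as copies of the empty word,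
        because \<open>c\<close> will be prepended: these copies turn into \<open>[c]\<close>, whose
        weight is at most \<open>k\<close> in this case.\<close>
      have "(\<Sum>w\<leftarrow>replicate (d c []) [] @ L. binom f w) = d c [] + (\<Sum>w\<leftarrow>L. binom f w)" for f
        by (simp add: map_replicate_const sum_list_replicate)
      then have "\<forall>f. set f \<subseteq> X \<longrightarrow> d c f = (\<Sum>w\<leftarrow>replicate (d c []) [] @ L. binom f w)"
        using L(2) by metis
      moreover have "\<forall>w\<in>set (replicate (d c []) [] @ L). set w \<subseteq> X \<and> \<omega> c + wt \<omega> w \<le> k"
        using L(1) True by fastforce
      ultimately show ?thesis by blast
    next
      case False
      have "d c f = (\<Sum>w\<leftarrow>[]. binom f w)" if "set f \<subseteq> X" for f
        using assms(4)[OF c False that] by simp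
      then show ?thesis by (intro exI[of _ "[]"]) simp
    qed
  qed
  then obtain L where L: "\<And>c w. c \<in> X \<Longrightarrow> w \<in> set (L c) \<Longrightarrow> set w \<subseteq> X \<and> \<omega> c + wt \<omega> w \<le> k"
     "\<And>c f. c \<in> X \<Longrightarrow> set f \<subseteq> X \<Longrightarrow> d c f = (\<Sum>w\<leftarrow>L c. binom f w)"
    by metis
  obtain xs where xs: "set xs = X" "distinct xs" using assms(1) finite_distinct_list by blast
  \<comment> \<open>The antiderivative: all terms of all differences, with their direction
    \<open>c\<close> prepended.\<close>
  define M where "M = concat (map (\<lambda>c. map ((#) c) (L c)) xs)"
  have M: "(\<Sum>w\<leftarrow>M. binom f w) = (\<Sum>c\<in>X. \<Sum>w\<leftarrow>L c. binom f (c # w))" for f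
  proof -
    have "(\<Sum>w\<leftarrow>concat (map (\<lambda>c. map ((#) c) (L c)) ys). binom f w)
        = (\<Sum>c\<leftarrow>ys. \<Sum>w\<leftarrow>L c. binom f (c # w))" for ys
      by (induction ys) (auto simp: o_def)
    then show ?thesis
      unfolding M_def by (simp add: sum_list_distinct_conv_sum_set xs)
  qed
  have "\<phi> f = \<phi> [] + (\<Sum>w\<leftarrow>M. binom f w)" if "set f \<subseteq> X" for f
    using that
  proof (induction f)
    case Nil
    then show ?case by (simp add: M)
  next
    case (Cons b f)
    then have b: "b \<in> X" "set f \<subseteq> X" by auto
    have s: "(\<Sum>w\<leftarrow>L c. binom (b # f) (c # w))
        = (\<Sum>w\<leftarrow>L c. binom f (c # w)) + (if b = c then \<Sum>w\<leftarrow>L c. binom f w else 0)" for c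
      by (simp add: sum_list_addf)
    have "(\<Sum>w\<leftarrow>M. binom (b # f) w) = (\<Sum>w\<leftarrow>M. binom f w) + d b f"
      unfolding M s by (simp add: sum.distrib assms(1) b L(2))
    then show ?case using Cons b assms(3) by simp
  qed
  moreover have "\<forall>w\<in>set M. set w \<subseteq> X \<and> w \<noteq> [] \<and> wt \<omega> w \<le> k"
    unfolding M_def using xs L(1) by fastforce
  ultimately show ?thesis unfolding binom_span_def by blast
qed

section \<open>Elimination of one letter from a word\<close>

fun shift :: "('a \<times> nat) list \<Rightarrow> ('a \<times> nat) list" where
  "shift [] = []"
| "shift ((y, i) # f) = (y, Suc i) # (y, i) # shift f"

text \<open>Rewriting a word as a word in the iterated commutators \<open>(y, i) = [x, \<dots>, [x, y]]\<close> (with \<open>i\<close>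
  copies of \<open>x\<close>) times a power of \<open>x\<close>, using \<open>x (y, i) = (y, i + 1) (y, i) x\<close>.\<close>

fun elim :: "'a \<Rightarrow> 'a list \<Rightarrow> ('a \<times> nat) list" where
  "elim x [] = []"
| "elim x (c # f) = (if c = x then shift (elim x f) else (c, 0) # elim x f)"

text \<open>The adjoint of \<open>shift\<close> without its leading term. Each letter of
  \<open>f\<close> becomes a block of two letters, and an embedded word uses none, one or both of
  them; \<open>unshift\<close> records the embeddings that use the first letter of some block. A
  letter \<open>(y, Suc i)\<close> may be the second letter of its own block, the first letter of
  the block of \<open>(y, i)\<close>, or the start of such a block used entirely. Once a first
  letter has been used, the rest of the word may stay as it is or be unshifted too.\<close>

fun unshift :: "('a \<times> nat) list \<Rightarrow> ('a \<times> nat) list list" where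
  "unshift [] = []"
| "unshift ((y, 0) # w) = map ((#) (y, 0)) (unshift w)"
| "unshift ((y, Suc i) # w) = map ((#) (y, Suc i)) (unshift w)
     @ map ((#) (y, i)) (w # unshift w)
     @ (case w of [] \<Rightarrow> [] | c # v \<Rightarrow> if c = (y, i) then map ((#) (y, i)) (v # unshift v) else [])"

lemma binom_shift:
  "binom (shift f) w = binom f w + (\<Sum>u\<leftarrow>unshift w. binom f u)"
proof (induction f arbitrary: w)
  case Nil
  show ?case
    by (induction w rule: unshift.induct) (auto simp: o_def split: list.splits)
next
  case (Cons b f)
  obtain y i where b: "b = (y, i)" by (cases b)
  define T where "T w = binom f w + (\<Sum>u\<leftarrow>unshift w. binom f u)" for w
  have T: "binom (shift f) w = T w" for w unfolding T_def by (rule Cons)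
  have T0: "T [] = 1" by (simp add: T_def)
  \<comment> \<open>An embedding meets the block of \<open>b\<close> in no letter, in its second, in
    its first, or in both.\<close>
  have step: "binom (shift (b # f)) w = T w
     + (case w of [] \<Rightarrow> 0 | c # v \<Rightarrow> (if c = (y, i) then T v else 0) + (if c = (y, Suc i) then T v else 0)
         + (case v of [] \<Rightarrow> 0 | c' # v' \<Rightarrow> if c = (y, Suc i) \<and> c' = (y, i) then T v' else 0))"
  proof (cases w)
    case w: (Cons c v)
    show ?thesis by (cases v) (simp_all add: b T T0 w)
  qed (simp add: b T T0)
  have hd: "(\<Sum>u\<leftarrow>map ((#) c) L. binom (b # f) u)
        = (\<Sum>u\<leftarrow>map ((#) c) L. binom f u) + (if b = c then \<Sum>u\<leftarrow>L. binom f u else 0)" for c L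
    by (simp add: o_def sum_list_addf)
  show ?case
  proof (cases w rule: unshift.cases)
    case 1
    then show ?thesis unfolding step by (simp add: T_def)
  next
    case (2 z v)
    then show ?thesis unfolding step
      by (cases v) (simp_all only: unshift.simps binom.simps list.case hd, simp_all add: T_def b)
  next
    case (3 z j v)
    \<comment> \<open>The remainders left when \<open>w\<close> starts with a block that is used
      entirely.\<close>
    define R where "R = (case v of [] \<Rightarrow> [] | c # v' \<Rightarrow> if c = (z, j) then v' # unshift v' else [])"
    have u: "unshift w = map ((#) (z, Suc j)) (unshift v) @ map ((#) (z, j)) (v # unshift v) @ map ((#) (z, j)) R"
      unfolding 3 R_def by (cases v) (simp_all split: if_splits)
    have "(\<Sum>u\<leftarrow>unshift w. binom (b # f) u) = (\<Sum>u\<leftarrow>unshift w. binom f u)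
        + (if b = (z, Suc j) then \<Sum>u\<leftarrow>unshift v. binom f u else 0)
        + (if b = (z, j) then T v + (\<Sum>u\<leftarrow>R. binom f u) else 0)"
      unfolding u map_append sum_list.append hd by (simp add: T_def)
    moreover have "(\<Sum>u\<leftarrow>R. binom f u) = (case v of [] \<Rightarrow> 0 | c' # v' \<Rightarrow> if c' = (z, j) then T v' else 0)"
      unfolding R_def by (cases v) (simp_all add: T_def)
    moreover have "T v = binom f v + (\<Sum>u\<leftarrow>unshift v. binom f u)" "T w = binom f w + (\<Sum>u\<leftarrow>unshift w. binom f u)"
      by (simp_all only: T_def)
    moreover have "binom (b # f) w = binom f w + (if b = (z, Suc j) then binom f v else 0)"
      by (simp add: 3)
    ultimately show ?thesis
      unfolding step by (cases v) (auto simp: 3 b)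
  qed
qed

text \<open>The weight of the commutator \<open>[x, ..., [x, y]]\<close> with \<open>i\<close>
  copies of a letter \<open>x\<close> of weight \<open>r\<close>.\<close>

definition elim_wt :: "nat \<Rightarrow> ('a \<Rightarrow> nat) \<Rightarrow> 'a \<times> nat \<Rightarrow> nat" where
  "elim_wt r \<omega> = (\<lambda>(y, i). \<omega> y + i * r)"

text \<open>Each word of the list involves at least one replacement of \<open>(y, Suc i)\<close> by
  \<open>(y, i)\<close>, which loses \<open>r\<close>, or one collapse of a whole block to
  \<open>(y, i)\<close>, which loses at least as much.\<close>

lemma wt_unshift: "u \<in> set (unshift w) \<Longrightarrow> wt (elim_wt r \<omega>) u + r \<le> wt (elim_wt r \<omega>) w"
proof (induction w arbitrary: u rule: unshift.induct)
  case (3 y i w)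
  from 3(4) consider v where "u = (y, Suc i) # v" "v \<in> set (unshift w)"
    | v where "u = (y, i) # v" "v = w \<or> v \<in> set (unshift w)"
    | v v' where "w = (y, i) # v'" "u = (y, i) # v" "v = v' \<or> v \<in> set (unshift v')"
    by (auto split: list.splits if_splits)
  then show ?case
  proof cases
    case 1
    with 3(1)[of v] show ?thesis by simp
  next
    case 2
    with 3(2)[of v] show ?thesis by (auto simp: elim_wt_def)
  next
    case third: (3 v v')
    have "wt (elim_wt r \<omega>) v \<le> wt (elim_wt r \<omega>) v'"
      using third(3) 3(3)[OF third(1) refl] by fastforce
    with third show ?thesis by (simp add: elim_wt_def)
  qed
qed (auto simp: elim_wt_def)

text \<open>Prepending \<open>x\<close> to \<open>f\<close> shifts the rewritten word, so the
  difference is the sum over \<open>unshift w\<close>, whose words are lighter by the weight of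
  \<open>x\<close>. Prepending another letter \<open>c\<close> puts \<open>(c, 0)\<close> in front,
  so the difference removes a first letter of \<open>w\<close>. Both differences are covered by
  induction on the weight and are then integrated.\<close>

lemma binom_span_elim:
  assumes "finite X" "x \<in> X" "\<And>c. \<omega> c > 0"
  shows "binom_span X \<omega> (wt (elim_wt (\<omega> x) \<omega>) w) (\<lambda>f. binom (elim x f) w)"
proof (induction "wt (elim_wt (\<omega> x) \<omega>) w" arbitrary: w rule: less_induct)
  case less
  let ?W = "wt (elim_wt (\<omega> x) \<omega>)"
  define d where "d = (\<lambda>c f. if c = x then \<Sum>u\<leftarrow>unshift w. binom (elim x f) u
      else case w of [] \<Rightarrow> 0 | c' # v \<Rightarrow> if c' = (c, 0) then binom (elim x f) v else 0)"
  have mono: "binom_span X \<omega> k' \<phi>" if "binom_span X \<omega> k \<phi>" "k \<le> k'" for k k' \<phi>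
    using that unfolding binom_span_def by (meson le_trans)
  show ?case
  proof (rule binom_span_integrate[of X \<omega> _ d])
    show "binom_span X \<omega> (?W w - \<omega> c) (d c)" if "c \<in> X" "\<omega> c \<le> ?W w" for c
    proof (cases "c = x")
      case True
      have "binom_span X \<omega> (?W w - \<omega> x) (\<lambda>f. \<Sum>u\<leftarrow>unshift w. binom (elim x f) u)"
      proof (rule binom_span_sum_list)
        fix u assume u: "u \<in> set (unshift w)"
        from wt_unshift[OF u, of "\<omega> x" \<omega>] assms(3)[of x] have "?W u < ?W w" "?W u \<le> ?W w - \<omega> x" by auto
        then show "binom_span X \<omega> (?W w - \<omega> x) (\<lambda>f. binom (elim x f) u)"
          using less mono by blast
      qed
      then show ?thesis unfolding d_def using True by simp
    next
      case False
      show ?thesis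
      proof (cases "\<exists>v. w = (c, 0) # v")
        case True
        then obtain v where v: "w = (c, 0) # v" by blast
        then have *: "?W w - \<omega> c = ?W v" "?W v < ?W w" using assms(3)[of c] by (auto simp: elim_wt_def)
        have "d c = (\<lambda>f. binom (elim x f) v)" unfolding d_def using v False by simp
        with less[OF *(2)] show ?thesis unfolding *(1) by (simp only:)
      next
        case False2: False
        then have "d c = (\<lambda>f. 0)" unfolding d_def using False by (auto split: list.splits)
        then show ?thesis by (simp add: binom_span_const)
      qed
    qed
    show "binom (elim x (c # f)) w = binom (elim x f) w + d c f" for c f
      unfolding d_def by (cases w) (auto simp: binom_shift)
    show "d c f = 0" if "\<not> \<omega> c \<le> ?W w" for c f
    proof (cases "c = x")
      case True
      \<comment> \<open>A word in this list would force the weight of \<open>x\<close> to be at most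
        that of \<open>w\<close>.\<close>
      have "unshift w = []"
        using wt_unshift[of _ w "\<omega> x" \<omega>] that True by (metis add_leD2 list.set_intros(1) neq_Nil_conv)
      with True show ?thesis by (simp add: d_def)
    next
      case False
      then show ?thesis using that by (auto simp: d_def elim_wt_def split: list.splits)
    qed
  qed (use assms in auto)
qed

text \<open>The words in the expansion are no heavier than \<open>w\<close>, so their coefficients
  are divisible by at least the required power of \<open>p\<close>; the constant term is zero
  because \<open>elim x []\<close> is empty. This lets the divisibility hypothesis pass through each
  elimination.\<close>

lemma elim_dvd:
  assumes "finite X" "x \<in> X" "\<And>c. \<omega> c > 0" "set f \<subseteq> X"
    and "\<And>w. set w \<subseteq> X \<Longrightarrow> w \<noteq> [] \<Longrightarrow> wt \<omega> w \<le> m \<Longrightarrow> (p::nat) ^ (m + 1 - wt \<omega> w) dvd binom f w"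
    and "w \<noteq> []" "wt (elim_wt (\<omega> x) \<omega>) w \<le> m"
  shows "p ^ (m + 1 - wt (elim_wt (\<omega> x) \<omega>) w) dvd binom (elim x f) w"
proof -
  let ?k = "wt (elim_wt (\<omega> x) \<omega>) w"
  from binom_span_elim[where w = w and \<omega> = \<omega>, OF assms(1-3)]
  obtain L where L: "\<forall>w\<in>set L. set w \<subseteq> X \<and> w \<noteq> [] \<and> wt \<omega> w \<le> ?k"
     "\<forall>f. set f \<subseteq> X \<longrightarrow> binom (elim x f) w = binom (elim x []) w + (\<Sum>w\<leftarrow>L. binom f w)"
    unfolding binom_span_def by blast
  have "p ^ (m + 1 - ?k) dvd (\<Sum>w\<leftarrow>L. binom f w)"
    using L(1)
  proof (induction L)
    case (Cons v L)
    then have "p ^ (m + 1 - wt \<omega> v) dvd binom f v" using assms(5)[of v] assms(7) by auto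
    moreover have "p ^ (m + 1 - ?k) dvd p ^ (m + 1 - wt \<omega> v)"
      using Cons(2) by (intro le_imp_power_dvd) auto
    ultimately have "p ^ (m + 1 - ?k) dvd binom f v" using dvd_trans by blast
    with Cons show ?case by simp
  qed simp
  moreover have "binom (elim x []) w = 0" using assms(6) by (cases w) auto
  ultimately show ?thesis using L(2) assms(4) by simp
qed

text \<open>Keeps the new alphabet finite: reading one more letter of \<open>f\<close> raises an
  index by at most one.\<close>

lemma set_elim: "set (elim x f) \<subseteq> (set f - {x}) \<times> {..length f}"
proof -
  have shift: "\<exists>i. (y, i) \<in> set g \<and> j \<le> Suc i" if "(y, j) \<in> set (shift g)" for g :: "('a \<times> nat) list" and y j
    using that by (induction g rule: shift.induct) auto
  have "y \<in> set f - {x} \<and> i \<le> length f" if "(y, i) \<in> set (elim x f)" for y i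
    using that
  proof (induction f arbitrary: i)
    case (Cons c f)
    then show ?case
      by (fastforce split: if_splits dest!: shift)
  qed simp
  then show ?thesis by auto
qed

section \<open>Filtered groups\<close>

lemma (in group) inv_mult_cancel:
  assumes "x \<in> carrier G" "y \<in> carrier G"
  shows "inv x \<otimes> (x \<otimes> y) = y" "x \<otimes> (inv x \<otimes> y) = y"
  using assms by (simp_all flip: m_assoc)

lemma (in group) nat_pow_in_subgroup: "subgroup H G \<Longrightarrow> x \<in> H \<Longrightarrow> x [^] (k::nat) \<in> H"
  by (induction k) (auto intro: subgroup.m_closed subgroup.one_closed)

context monoid
begin

definition eval_word :: "('c \<Rightarrow> 'a) \<Rightarrow> 'c list \<Rightarrow> 'a" where
  "eval_word g f = foldr (\<lambda>c a. g c \<otimes> a) f \<one>"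

lemma eval_word_simps [simp]:
  "eval_word g [] = \<one>" "eval_word g (c # f) = g c \<otimes> eval_word g f"
  by (auto simp: eval_word_def)

lemma eval_word_cong: "(\<And>c. c \<in> set f \<Longrightarrow> g c = h c) \<Longrightarrow> eval_word g f = eval_word h f"
  by (induction f) auto

lemma eval_word_map: "eval_word g (map e f) = eval_word (g \<circ> e) f"
  by (induction f) auto

end

lemma (in group) eval_word_closed: "subgroup H G \<Longrightarrow> (\<And>c. c \<in> set f \<Longrightarrow> g c \<in> H) \<Longrightarrow> eval_word g f \<in> H"
  by (induction f) (auto intro: subgroup.m_closed subgroup.one_closed)

lemma (in group_hom) hom_eval_word:
  "(\<And>c. c \<in> set f \<Longrightarrow> g c \<in> carrier G) \<Longrightarrow> h (G.eval_word g f) = H.eval_word (h \<circ> g) f"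
proof (induction f)
  case (Cons c f)
  then have "G.eval_word g f \<in> carrier G" by (intro G.eval_word_closed[OF G.subgroup_self]) auto
  with Cons show ?case by simp
qed simp

text \<open>All that elimination uses about the group: commutators add weights, and p-th powers
  raise the weight by one.\<close>

locale filtered_group = group G for G (structure) +
  fixes D :: "nat \<Rightarrow> 'a set" and p :: nat
  assumes subgroup_D: "subgroup (D i) G"
    and D_Suc: "D (Suc i) \<subseteq> D i"
    and gcomm_D: "0 < i \<Longrightarrow> 0 < j \<Longrightarrow> x \<in> D i \<Longrightarrow> y \<in> D j \<Longrightarrow> gcomm G x y \<in> D (i + j)"
    and pow_D: "0 < i \<Longrightarrow> x \<in> D i \<Longrightarrow> x [^] p \<in> D (Suc i)"
begin

lemma D_carrier: "x \<in> D i \<Longrightarrow> x \<in> carrier G"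
  by (rule subgroup.mem_carrier[OF subgroup_D])

lemma D_mono: "i \<le> j \<Longrightarrow> D j \<subseteq> D i"
  by (rule lift_Suc_antimono_le[where f = D, OF D_Suc])

lemma pow_pow_D: "0 < i \<Longrightarrow> x \<in> D i \<Longrightarrow> x [^] (p ^ j) \<in> D (i + j)"
proof (induction j)
  case 0
  then show ?case using D_carrier by simp
next
  case (Suc j)
  then have "(x [^] (p ^ j)) [^] p \<in> D (Suc (i + j))" by (intro pow_D) auto
  then show ?case using Suc.prems D_carrier by (simp add: nat_pow_pow mult.commute)
qed

fun iter_gcomm :: "'a \<Rightarrow> ('c \<Rightarrow> 'a) \<Rightarrow> 'c \<times> nat \<Rightarrow> 'a" where
  "iter_gcomm a g (y, 0) = g y"
| "iter_gcomm a g (y, Suc i) = gcomm G a (iter_gcomm a g (y, i))"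

lemma iter_gcomm_closed:
  assumes "a \<in> carrier G" "\<And>c. g c \<in> carrier G"
  shows "iter_gcomm a g c \<in> carrier G"
proof -
  have "iter_gcomm a g (y, i) \<in> carrier G" for y i
    using assms by (induction i) (auto simp: gcomm_def)
  then show ?thesis by (cases c) auto
qed

lemma iter_gcomm_D:
  assumes "a \<in> D r" "0 < r" "0 < k" "g y \<in> D k"
  shows "iter_gcomm a g (y, i) \<in> D (k + i * r)"
proof (induction i)
  case (Suc i)
  then have "gcomm G a (iter_gcomm a g (y, i)) \<in> D (r + (k + i * r))"
    using assms by (intro gcomm_D) auto
  then show ?case by (simp add: add_ac)
qed (use assms in simp)

lemma eval_word_shift:
  assumes "a \<in> carrier G" "\<And>c. g c \<in> carrier G"
  shows "a \<otimes> eval_word (iter_gcomm a g) f = eval_word (iter_gcomm a g) (shift f) \<otimes> a"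
proof (induction f rule: shift.induct)
  case 1
  show ?case using assms by simp
next
  case (2 y i f)
  let ?e = "eval_word (iter_gcomm a g)" and ?c = "iter_gcomm a g (y, i)"
  have cl: "?e w \<in> carrier G" "?c \<in> carrier G" for w
    by (intro eval_word_closed[OF subgroup_self] iter_gcomm_closed assms)+
  have "a \<otimes> (?c \<otimes> ?e f) = gcomm G a ?c \<otimes> (?c \<otimes> (a \<otimes> ?e f))"
    using assms(1) cl by (simp add: gcomm_def m_assoc inv_mult_cancel)
  also have "\<dots> = gcomm G a ?c \<otimes> (?c \<otimes> (?e (shift f) \<otimes> a))"
    by (simp only: 2)
  finally show ?case using assms(1) cl by (simp add: gcomm_def m_assoc)
qed

text \<open>Every \<open>x\<close> is moved to the right end past the rewritten tail by
  \<open>eval_word_shift\<close>; \<open>binom f [x]\<close> counts the copies collected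
  there.\<close>

lemma eval_word_elim:
  assumes "\<And>c. g c \<in> carrier G"
  shows "eval_word g f = eval_word (iter_gcomm (g x) g) (elim x f) \<otimes> g x [^] binom f [x]"
proof (induction f)
  case (Cons c f)
  have cl: "eval_word (iter_gcomm (g x) g) w \<in> carrier G" for w
    by (intro eval_word_closed[OF subgroup_self] iter_gcomm_closed assms)
  show ?case
  proof (cases "c = x")
    case True
    have "eval_word g (c # f) = (g x \<otimes> eval_word (iter_gcomm (g x) g) (elim x f)) \<otimes> g x [^] binom f [x]"
      unfolding eval_word_simps Cons True using assms cl by (simp add: m_assoc)
    also have "\<dots> = eval_word (iter_gcomm (g x) g) (elim x (c # f)) \<otimes> (g x \<otimes> g x [^] binom f [x])"
      using assms cl True by (simp add: eval_word_shift m_assoc)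
    finally show ?thesis using True assms by (simp flip: nat_pow_Suc2)
  next
    case False
    then show ?thesis using Cons assms cl by (simp add: m_assoc)
  qed
qed simp

text \<open>Lazard elimination removes a letter of least weight at the cost of letters of
  bigger weight, and letters of weight above \<open>m\<close> do not matter.\<close>

lemma eval_word_in_D_aux:
  assumes "finite (X :: nat set)" "\<And>c. \<omega> c > 0" "\<And>c. g c \<in> D (\<omega> c)" "set f \<subseteq> X"
    and "\<And>c. c \<in> X \<Longrightarrow> m + 1 - q \<le> \<omega> c"
    and "\<And>w. set w \<subseteq> X \<Longrightarrow> w \<noteq> [] \<Longrightarrow> wt \<omega> w \<le> m \<Longrightarrow> p ^ (m + 1 - wt \<omega> w) dvd binom f w"
  shows "eval_word g f \<in> D (m + 1)"
  using assms
proof (induction q arbitrary: X \<omega> g f)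
  case 0
  then have "g c \<in> D (m + 1)" if "c \<in> set f" for c
    using that D_mono[of "m + 1" "\<omega> c"] by auto
  then show ?case by (intro eval_word_closed subgroup_D)
next
  case (Suc q)
  show ?case
    using Suc.prems
  \<comment> \<open>The outer induction raises the least weight towards \<open>m + 1\<close>; the
    inner one removes the letters of least weight \<open>m - q\<close> one at a time.\<close>
  proof (induction "card {c \<in> X. \<omega> c = m - q}" arbitrary: X \<omega> g f rule: less_induct)
    case less
    show ?case
    proof (cases "\<exists>x\<in>X. \<omega> x = m - q")
      case False
      have "m + 1 - q \<le> \<omega> c" if "c \<in> X" for c
        using less.prems(5)[OF that] False that by (cases "\<omega> c = m - q") auto
      then show ?thesis using less.prems Suc.IH[of X \<omega> g f] by blast
    next
      case True
      then obtain x where x: "x \<in> X" "\<omega> x = m - q" by blast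
      define r where "r = \<omega> x"
      have r: "0 < r" "g x \<in> D r" using less.prems unfolding r_def by auto
      have gc: "g c \<in> carrier G" for c using less.prems(3) D_carrier by blast
      \<comment> \<open>Pairs are coded as naturals again, so that the induction hypothesis applies
        at the same type.\<close>
      define X' where "X' = prod_encode ` ((X - {x}) \<times> {..length f})"
      define \<omega>' where "\<omega>' = elim_wt r \<omega> \<circ> prod_decode"
      define g' where "g' = iter_gcomm (g x) g \<circ> prod_decode"
      define f' where "f' = map prod_encode (elim x f)"
      have \<omega>': "\<omega>' (prod_encode (y, i)) = \<omega> y + i * r" for y i by (simp add: \<omega>'_def elim_wt_def)
      have wt': "wt \<omega>' (map prod_encode w) = wt (elim_wt r \<omega>) w" for w
        by (simp add: wt_def \<omega>'_def o_def)
      have pos': "\<omega>' c > 0" for c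
        using less.prems(2) by (cases "prod_decode c") (simp add: \<omega>'_def elim_wt_def)
      have "eval_word g' f' \<in> D (m + 1)"
      proof (rule less.hyps[of X' \<omega>'])
        \<comment> \<open>An index \<open>i > 0\<close> adds \<open>i * r\<close> with
          \<open>r > 0\<close>, so only letters \<open>(y, 0)\<close> with \<open>y\<close>
          different from \<open>x\<close> can still have the least weight.\<close>
        have sub: "{c \<in> X'. \<omega>' c = m - q} \<subseteq> (\<lambda>c. prod_encode (c, 0)) ` ({c \<in> X. \<omega> c = m - q} - {x})"
        proof
          fix c assume "c \<in> {c \<in> X'. \<omega>' c = m - q}"
          then obtain y i where c: "c = prod_encode (y, i)" "y \<in> X" "y \<noteq> x" "\<omega>' c = m - q"
            unfolding X'_def by auto
          have "m - q \<le> \<omega> y" using less.prems(5)[OF c(2)] by simp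
          moreover have "\<omega> y + i * r = m - q" using c(1,4) \<omega>' by simp
          ultimately have "i * r = 0" "\<omega> y = m - q" by linarith+
          with r(1) c show "c \<in> (\<lambda>c. prod_encode (c, 0)) ` ({c \<in> X. \<omega> c = m - q} - {x})" by auto
        qed
        have fin: "finite {c \<in> X. \<omega> c = m - q}" using less.prems(1) by simp
        have "card {c \<in> X'. \<omega>' c = m - q} \<le> card ({c \<in> X. \<omega> c = m - q} - {x})"
          using sub fin by (meson finite_Diff surj_card_le)
        also have "\<dots> < card {c \<in> X. \<omega> c = m - q}"
          using fin x by (intro psubset_card_mono) auto
        finally show "card {c \<in> X'. \<omega>' c = m - q} < card {c \<in> X. \<omega> c = m - q}" .
        show "finite X'" unfolding X'_def using less.prems(1) by auto
        show "\<omega>' c > 0" for c by (rule pos')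
        show "g' c \<in> D (\<omega>' c)" for c
        proof (cases "prod_decode c")
          case (Pair y i)
          then show ?thesis
            using iter_gcomm_D[where g = g and y = y and k = "\<omega> y", OF r(2,1) less.prems(2) less.prems(3)] by (simp add: g'_def \<omega>'_def elim_wt_def)
        qed
        show "set f' \<subseteq> X'" unfolding f'_def X'_def using set_elim[of x f] less.prems(4) by fastforce
        show "m + 1 - Suc q \<le> \<omega>' c" if c': "c \<in> X'" for c
        proof -
          obtain y i where c: "c = prod_encode (y, i)" "y \<in> X"
            using c' unfolding X'_def by auto
          then show ?thesis using less.prems(5)[OF c(2)] \<omega>' by auto
        qed
        show "p ^ (m + 1 - wt \<omega>' w) dvd binom f' w" if w: "set w \<subseteq> X'" "w \<noteq> []" "wt \<omega>' w \<le> m" for w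
        proof -
          define v where "v = map prod_decode w"
          have v: "w = map prod_encode v" unfolding v_def by (simp add: o_def)
          have "p ^ (m + 1 - wt (elim_wt (\<omega> x) \<omega>) v) dvd binom (elim x f) v"
            using less.prems w x unfolding v wt' r_def by (intro elim_dvd[of X]) auto
          then show ?thesis
            unfolding v f'_def wt' r_def by (simp add: binom_map_inj inj_prod_encode)
        qed
      qed
      moreover have "eval_word g' f' = eval_word (iter_gcomm (g x) g) (elim x f)"
        unfolding f'_def g'_def eval_word_map by (simp add: o_def)
      \<comment> \<open>The collected power: as long as \<open>r\<close> is at most
        \<open>m\<close>, the exponent is divisible by \<open>p ^ (m + 1 - r)\<close>, and each
        factor \<open>p\<close> raises the weight of \<open>g x\<close> by one.\<close>
      moreover have "g x [^] binom f [x] \<in> D (m + 1)"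
      proof (cases "r \<le> m")
        case True
        then have "p ^ (m + 1 - r) dvd binom f [x]"
          using less.prems(6)[of "[x]"] x unfolding r_def by simp
        then obtain k where k: "binom f [x] = p ^ (m + 1 - r) * k" by blast
        have "g x [^] (p ^ (m + 1 - r)) \<in> D (m + 1)"
          using pow_pow_D[OF r, of "m + 1 - r"] True by simp
        then have "(g x [^] (p ^ (m + 1 - r))) [^] k \<in> D (m + 1)"

          by (rule nat_pow_in_subgroup[OF subgroup_D])
        then show ?thesis using gc k by (simp add: nat_pow_pow)
      next
        case False
        then have "g x \<in> D (m + 1)" using D_mono[of "m + 1" r] r by auto
        then show ?thesis

          by (rule nat_pow_in_subgroup[OF subgroup_D])
      qed
      ultimately show ?thesis
        unfolding eval_word_elim[where f = f and x = x, OF gc] using subgroup.m_closed[OF subgroup_D] by auto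
    qed
  qed
qed

text \<open>The weighted version with every letter of weight one, after coding a finite alphabet by
  naturals.\<close>

theorem eval_word_in_D:
  assumes "finite (X :: 'c set)" "\<And>c. c \<in> X \<Longrightarrow> g c \<in> D 1" "set f \<subseteq> X"
    and "\<And>w. set w \<subseteq> X \<Longrightarrow> w \<noteq> [] \<Longrightarrow> length w \<le> m \<Longrightarrow> p ^ (m + 1 - length w) dvd binom f w"
  shows "eval_word g f \<in> D (m + 1)"
proof -
  obtain e :: "'c \<Rightarrow> nat" where e: "inj_on e X"
    using assms(1) finite_imp_inj_to_nat_seg by metis
  \<comment> \<open>Naturals outside the code are sent to the neutral element, since the weighted
    version wants a value in the filtration at every letter.\<close>
  define g' where "g' c = (if c \<in> e ` X then g (the_inv_into X e c) else \<one>)" for c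
  have binom_e: "binom (map e u) (map e w) = binom u w" if "set u \<subseteq> X" "set w \<subseteq> X" for u w
    using that by (induction u w rule: binom.induct) (auto simp: inj_on_eq_iff[OF e])
  have g'e: "g' (e c) = g c" if "c \<in> X" for c
    using that e by (simp add: g'_def the_inv_into_f_f)
  have "eval_word g' (map e f) \<in> D (m + 1)"
  proof (rule eval_word_in_D_aux[of "e ` X" "\<lambda>_. 1" _ _ _ m])
    show "g' c \<in> D 1" for c
      using assms(2) g'e subgroup.one_closed[OF subgroup_D] by (cases "c \<in> e ` X") (auto simp: g'_def)
    show "p ^ (m + 1 - wt (\<lambda>_. 1) w) dvd binom (map e f) w"
      if w: "set w \<subseteq> e ` X" "w \<noteq> []" "wt (\<lambda>_. 1) w \<le> m" for w
    proof -
      define v where "v = map (the_inv_into X e) w"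
      have v: "w = map e v" unfolding v_def using w(1) e
        by (auto simp: f_the_inv_into_f intro!: map_idI[symmetric])
      have vX: "set v \<subseteq> X" unfolding v_def using w(1) e by (auto simp: the_inv_into_f_f)
      have "wt (\<lambda>_. 1) w = length v" by (simp add: wt_def v sum_list_triv)
      then show ?thesis using assms(3,4) vX w unfolding v by (simp add: binom_e)
    qed
  qed (use assms in auto)
  moreover have "eval_word g' (map e f) = eval_word g f"
    unfolding eval_word_map using assms(3) g'e by (intro eval_word_cong) auto
  ultimately show ?thesis by simp
qed

end

section \<open>The lower p-central filtration of a topological group\<close>

lemma (in group) inv_commute:
  assumes "x \<in> carrier G" "y \<in> carrier G" "x \<otimes> y = y \<otimes> x"
  shows "inv x \<otimes> y = y \<otimes> inv x"
proof -
  have "inv x \<otimes> y = inv x \<otimes> (y \<otimes> x) \<otimes> inv x"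
    using assms(1,2) by (simp add: m_assoc)
  also have "\<dots> = y \<otimes> inv x"
    unfolding assms(3)[symmetric] using assms(1,2) by (simp add: inv_mult_cancel)
  finally show ?thesis .
qed

lemma (in group) mult_commute_closed:
  assumes "x \<in> carrier G" "y \<in> carrier G" "b \<in> carrier G" "x \<otimes> b = b \<otimes> x" "y \<otimes> b = b \<otimes> y"
  shows "(x \<otimes> y) \<otimes> b = b \<otimes> (x \<otimes> y)"
proof -
  have "(x \<otimes> y) \<otimes> b = x \<otimes> (b \<otimes> y)"
    using assms(1-3) by (simp add: m_assoc flip: assms(5))
  also have "\<dots> = b \<otimes> (x \<otimes> y)"
    using assms(1-3) by (simp add: assms(4) flip: m_assoc)
  finally show ?thesis .
qed

lemma (in normal) gcomm_in_iff:
  assumes "x \<in> carrier G" "y \<in> carrier G"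
  shows "gcomm G x y \<in> H \<longleftrightarrow> H #> (x \<otimes> y) = H #> (y \<otimes> x)"
proof -
  have "gcomm G x y = (x \<otimes> y) \<otimes> inv (y \<otimes> x)"
    using assms by (simp add: gcomm_def inv_mult_group m_assoc)
  then show ?thesis
    using assms rcos_module[OF is_group, of "y \<otimes> x" "x \<otimes> y"] repr_independence[of "x \<otimes> y" H "y \<otimes> x"]
      rcos_self[of "x \<otimes> y" H] is_subgroup by (metis m_closed)
qed

lemma (in normal) gcomm_in_sym:
  assumes "x \<in> carrier G" "y \<in> carrier G"
  shows "gcomm G x y \<in> H \<longleftrightarrow> gcomm G y x \<in> H"
  using gcomm_in_iff assms by auto

lemma (in normal) rcos_eq_iff:
  assumes "x \<in> carrier G" "y \<in> carrier G"
  shows "H #> x = H #> y \<longleftrightarrow> x \<otimes> inv y \<in> H"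
  using assms rcos_module[OF is_group, of y x] repr_independence[of x H y] rcos_self[of x H] is_subgroup
  by metis

text \<open>This is the preimage of a centraliser in the quotient. Being a subgroup, it reduces a
  commutator inclusion to a check on generators.\<close>

lemma (in normal) subgroup_centralizer_mod:
  assumes "B \<subseteq> carrier G"
  shows "subgroup {a \<in> carrier G. \<forall>b\<in>B. gcomm G a b \<in> H} G"
proof (rule subgroupI)
  interpret Q: group "G Mod H" by (rule factorgroup_is_group)
  have iff: "gcomm G a b \<in> H \<longleftrightarrow> (H #> a) <#> (H #> b) = (H #> b) <#> (H #> a)"
    if "a \<in> carrier G" "b \<in> carrier G" for a b
    using that gcomm_in_iff rcos_sum by auto
  have cl: "H #> a \<in> carrier (G Mod H)" if "a \<in> carrier G" for a
    using that by (auto simp: carrier_FactGroup)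
  have "\<one> \<in> {a \<in> carrier G. \<forall>b\<in>B. gcomm G a b \<in> H}"
    using assms by (auto simp: gcomm_in_iff)
  then show "{a \<in> carrier G. \<forall>b\<in>B. gcomm G a b \<in> H} \<noteq> {}" by blast
  fix a assume a: "a \<in> {a \<in> carrier G. \<forall>b\<in>B. gcomm G a b \<in> H}"
  have "H #> (inv a \<otimes> b) = H #> (b \<otimes> inv a)" if "b \<in> B" for b
  proof -
    have bc: "b \<in> carrier G" using assms that by blast
    moreover have "(H #> a) <#> (H #> b) = (H #> b) <#> (H #> a)" using that a iff[OF _ bc] by blast
    ultimately have b: "b \<in> carrier G" "(H #> a) <#> (H #> b) = (H #> b) <#> (H #> a)" by blast+
    have ia: "inv\<^bsub>G Mod H\<^esub> (H #> a) = H #> inv a"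
      using a by (simp add: rcos_inv inv_FactGroup cl)
    have "(H #> inv a) <#> (H #> b) = (H #> b) <#> (H #> inv a)"
      using Q.inv_commute[of "H #> a" "H #> b"] b cl[of a] cl[of b] a ia by simp
    then show ?thesis using a b by (simp add: rcos_sum)
  qed
  then show "inv a \<in> {a \<in> carrier G. \<forall>b\<in>B. gcomm G a b \<in> H}"
    using a assms by (auto simp: gcomm_in_iff)
  fix a' assume a': "a' \<in> {a \<in> carrier G. \<forall>b\<in>B. gcomm G a b \<in> H}"
  have "H #> (a \<otimes> a' \<otimes> b) = H #> (b \<otimes> (a \<otimes> a'))" if "b \<in> B" for b
  proof -
    have b: "b \<in> carrier G" using assms that by blast
    moreover have "(H #> a) <#> (H #> b) = (H #> b) <#> (H #> a)" "(H #> a') <#> (H #> b) = (H #> b) <#> (H #> a')"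
      using that a a' iff[OF _ b] by blast+
    ultimately
    have "((H #> a) <#> (H #> a')) <#> (H #> b) = (H #> b) <#> ((H #> a) <#> (H #> a'))"
      using Q.mult_commute_closed[of "H #> a" "H #> a'" "H #> b"] cl a a' by simp
    with a a' b show ?thesis by (simp add: rcos_sum)
  qed
  then show "a \<otimes> a' \<in> {a \<in> carrier G. \<forall>b\<in>B. gcomm G a b \<in> H}"
    using a a' assms by (auto simp: gcomm_in_iff)
qed auto

text \<open>The Hall-Witt argument: \<open>[a, b']\<close> is central and \<open>a\<close> commutes with \<open>[x, b']\<close>, where
  \<open>b' = x\<inverse> b x\<close>; hence \<open>[x, a]\<close> commutes with \<open>b\<close>.\<close>

lemma (in group) hall_witt:
  assumes cl: "x \<in> carrier G" "a \<in> carrier G" "b \<in> carrier G" "b' \<in> carrier G"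
      "z \<in> carrier G" "w \<in> carrier G" "c \<in> carrier G"
    and z: "a \<otimes> b' = z \<otimes> (b' \<otimes> a)" "\<And>y. y \<in> carrier G \<Longrightarrow> z \<otimes> y = y \<otimes> z"
    and w: "x \<otimes> b' = w \<otimes> (b' \<otimes> x)" "a \<otimes> w = w \<otimes> a" "w \<otimes> b' = b"
    and c: "x \<otimes> a = c \<otimes> (a \<otimes> x)"
  shows "c \<otimes> b = b \<otimes> c"
proof -
  note assoc = m_assoc cl m_closed
  have "z \<otimes> (b \<otimes> c) \<otimes> (a \<otimes> x) = z \<otimes> (b \<otimes> (c \<otimes> (a \<otimes> x)))" by (simp add: assoc)
  also have "\<dots> = z \<otimes> (w \<otimes> b' \<otimes> (x \<otimes> a))" by (simp only: w(3) c)
  also have "\<dots> = z \<otimes> ((w \<otimes> (b' \<otimes> x)) \<otimes> a)" by (simp add: assoc)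
  also have "\<dots> = z \<otimes> ((x \<otimes> b') \<otimes> a)" by (simp only: w(1))
  also have "\<dots> = (z \<otimes> x) \<otimes> (b' \<otimes> a)" by (simp add: assoc)
  also have "\<dots> = (x \<otimes> z) \<otimes> (b' \<otimes> a)" by (simp only: z(2)[OF cl(1)])
  also have "\<dots> = x \<otimes> (z \<otimes> (b' \<otimes> a))" by (simp add: assoc)
  also have "\<dots> = x \<otimes> (a \<otimes> b')" by (simp only: z(1))
  also have "\<dots> = (x \<otimes> a) \<otimes> b'" by (simp add: assoc)
  also have "\<dots> = (c \<otimes> (a \<otimes> x)) \<otimes> b'" by (simp only: c)
  also have "\<dots> = c \<otimes> (a \<otimes> (x \<otimes> b'))" by (simp add: assoc)
  also have "\<dots> = c \<otimes> (a \<otimes> (w \<otimes> (b' \<otimes> x)))" by (simp only: w(1))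
  also have "\<dots> = c \<otimes> ((a \<otimes> w) \<otimes> (b' \<otimes> x))" by (simp add: assoc)
  also have "\<dots> = c \<otimes> ((w \<otimes> a) \<otimes> (b' \<otimes> x))" by (simp only: w(2))
  also have "\<dots> = c \<otimes> (w \<otimes> ((a \<otimes> b') \<otimes> x))" by (simp add: assoc)
  also have "\<dots> = c \<otimes> (w \<otimes> ((z \<otimes> (b' \<otimes> a)) \<otimes> x))" by (simp only: z(1))
  also have "\<dots> = c \<otimes> ((w \<otimes> z) \<otimes> (b' \<otimes> a \<otimes> x))" by (simp add: assoc)
  also have "\<dots> = c \<otimes> ((z \<otimes> w) \<otimes> (b' \<otimes> a \<otimes> x))" by (simp only: z(2)[OF cl(6)])
  also have "\<dots> = (c \<otimes> z) \<otimes> (w \<otimes> (b' \<otimes> a \<otimes> x))" by (simp add: assoc)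
  also have "\<dots> = (z \<otimes> c) \<otimes> (w \<otimes> (b' \<otimes> a \<otimes> x))" by (simp only: z(2)[OF cl(7)])
  also have "\<dots> = z \<otimes> (c \<otimes> (w \<otimes> b')) \<otimes> (a \<otimes> x)" by (simp add: assoc)
  finally have "z \<otimes> (b \<otimes> c) \<otimes> (a \<otimes> x) = z \<otimes> (c \<otimes> b) \<otimes> (a \<otimes> x)" unfolding w(3) .
  then show ?thesis using cl by simp
qed

section \<open>Topological groups and their lower p-central filtration\<close>

locale top_group = group G for G (structure) +
  fixes T :: "'a topology"
  assumes tg: "topological_group G T"
begin

lemma topspace [simp]: "topspace T = carrier G"
  using tg unfolding topological_group_def by blast

lemma closedin_carrier [simp]: "closedin T (carrier G)"
  by (metis closedin_topspace topspace)

lemma continuous_map_mult: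
  assumes "continuous_map X T f" "continuous_map X T g"
  shows "continuous_map X T (\<lambda>x. f x \<otimes> g x)"
proof -
  have "continuous_map X T ((\<lambda>(x,y). x \<otimes> y) \<circ> (\<lambda>x. (f x, g x)))"
    using assms tg unfolding topological_group_def
    by (intro continuous_map_compose[of X "prod_topology T T"]) (auto intro: continuous_map_pairedI)
  then show ?thesis by (simp add: o_def)
qed

lemma continuous_map_inv:
  assumes "continuous_map X T f"
  shows "continuous_map X T (\<lambda>x. inv (f x))"
  using continuous_map_compose[OF assms, of T "\<lambda>x. inv x"] tg
  unfolding topological_group_def by (simp add: o_def)

lemma continuous_map_gcomm:
  assumes "continuous_map X T f" "continuous_map X T g"
  shows "continuous_map X T (\<lambda>x. gcomm G (f x) (g x))"
  unfolding gcomm_def by (intro continuous_map_mult continuous_map_inv assms)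

lemma continuous_map_ident: "continuous_map T T (\<lambda>x. x)"
  using continuous_map_id[of T] by (simp add: id_def)

lemma closedin_preimage: "continuous_map T T f \<Longrightarrow> closedin T C \<Longrightarrow> closedin T {x \<in> carrier G. f x \<in> C}"
  using closedin_continuous_map_preimage[of T T f C] by simp

lemma openin_preimage: "continuous_map T T f \<Longrightarrow> openin T C \<Longrightarrow> openin T {x \<in> carrier G. f x \<in> C}"
  using openin_continuous_map_preimage[of T T f C] by simp

lemma closed_subgroup_gen_subgroup:
  assumes "A \<subseteq> carrier G"
  shows "subgroup (closed_subgroup_gen G T A) G"
  unfolding closed_subgroup_gen_def
  using assms subgroup_self by (intro subgroups_Inter) (auto intro!: exI[of _ "carrier G"])

lemma closed_subgroup_gen_closed:
  assumes "A \<subseteq> carrier G"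
  shows "closedin T (closed_subgroup_gen G T A)"
  unfolding closed_subgroup_gen_def
  using assms subgroup_self by (intro closedin_Inter) (auto intro!: exI[of _ "carrier G"])

lemma closed_subgroup_gen_superset: "A \<subseteq> closed_subgroup_gen G T A"
  unfolding closed_subgroup_gen_def by auto

lemma closed_subgroup_gen_le:
  "subgroup H G \<Longrightarrow> closedin T H \<Longrightarrow> A \<subseteq> H \<Longrightarrow> closed_subgroup_gen G T A \<subseteq> H"
  unfolding closed_subgroup_gen_def by auto

lemma gcomm_closed [simp]: "x \<in> carrier G \<Longrightarrow> y \<in> carrier G \<Longrightarrow> gcomm G x y \<in> carrier G"
  by (simp add: gcomm_def)

abbreviation lpc_gens :: "nat \<Rightarrow> nat \<Rightarrow> 'a set" where
  "lpc_gens p k \<equiv> {x [^] p | x. x \<in> lpc G T p (Suc k)} \<union> {gcomm G x y | x y. x \<in> carrier G \<and> y \<in> lpc G T p (Suc k)}"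

lemma lpc_closed_subgroup: "subgroup (lpc G T p k) G \<and> closedin T (lpc G T p k)"
proof (induction k rule: induct_nat_012)
  case (ge2 k)
  then have "lpc G T p (Suc k) \<subseteq> carrier G" using subgroup.subset by blast
  then have "lpc_gens p k \<subseteq> carrier G" by auto
  then show ?case by (simp add: closed_subgroup_gen_subgroup closed_subgroup_gen_closed)
qed (simp_all add: subgroup_self)

lemmas lpc_subgroup = conjunct1[OF lpc_closed_subgroup]
  and lpc_closed = conjunct2[OF lpc_closed_subgroup]

lemma lpc_carrier: "x \<in> lpc G T p k \<Longrightarrow> x \<in> carrier G"
  by (rule subgroup.mem_carrier[OF lpc_subgroup])

lemma lpc_pow: "0 < k \<Longrightarrow> x \<in> lpc G T p k \<Longrightarrow> x [^] p \<in> lpc G T p (Suc k)"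
  using closed_subgroup_gen_superset[of "lpc_gens p (k - 1)"] by (cases k) auto

lemma lpc_gcomm: "0 < k \<Longrightarrow> x \<in> carrier G \<Longrightarrow> y \<in> lpc G T p k \<Longrightarrow> gcomm G x y \<in> lpc G T p (Suc k)"
  using closed_subgroup_gen_superset[of "lpc_gens p (k - 1)"] by (cases k) auto

lemma conj_eq_gcomm: "x \<in> carrier G \<Longrightarrow> y \<in> carrier G \<Longrightarrow> x \<otimes> y \<otimes> inv x = gcomm G x y \<otimes> y"
  by (simp add: gcomm_def m_assoc)

text \<open>A joint induction: descent puts \<open>h\<close> into the previous term, so
  \<open>gcomm G x h\<close> lies in the present one, and the conjugate of \<open>h\<close> is their
  product; normality then puts the generators of the next term into the present one.\<close>

lemma lpc_normal_Suc: "lpc G T p k \<lhd> G \<and> lpc G T p (Suc k) \<subseteq> lpc G T p k"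
proof (induction k)
  case 0
  show ?case by (simp add: normal_inv_iff subgroup_self)
next
  case (Suc k)
  let ?L = "lpc G T p"
  have *: "x \<otimes> h \<otimes> inv x \<in> ?L (Suc k)" if "x \<in> carrier G" "h \<in> ?L (Suc k)" for x h
  proof (cases k)
    case 0
    with that show ?thesis by simp
  next
    case (Suc k')
    have "h \<in> ?L k" "0 < k" using that Suc.IH Suc by blast+
    then have "gcomm G x h \<in> ?L (Suc k)" using that lpc_gcomm by blast
    then show ?thesis
      using that conj_eq_gcomm lpc_carrier subgroup.m_closed[OF lpc_subgroup] by metis
  qed
  have "lpc_gens p k \<subseteq> ?L (Suc k)"
  proof -
    have "x [^] p \<in> ?L (Suc k)" if "x \<in> ?L (Suc k)" for x
      using that lpc_subgroup by (simp add: nat_pow_in_subgroup)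
    moreover have "gcomm G x y \<in> ?L (Suc k)" if "x \<in> carrier G" "y \<in> ?L (Suc k)" for x y
      unfolding gcomm_def using that * lpc_subgroup subgroup.m_closed subgroup.m_inv_closed by metis
    ultimately show ?thesis by blast
  qed
  then have "?L (Suc (Suc k)) \<subseteq> ?L (Suc k)"
    using closed_subgroup_gen_le[OF lpc_subgroup lpc_closed] by simp
  with * show ?case using normal_inv_iff lpc_subgroup by blast
qed

lemmas lpc_normal = conjunct1[OF lpc_normal_Suc]
  and lpc_Suc_subset = conjunct2[OF lpc_normal_Suc]

text \<open>Induction on \<open>i\<close> with \<open>j\<close> left free. The elements commuting
  modulo \<open>M\<close> with all of \<open>lpc G T p j\<close> form a closed subgroup
  \<open>H\<close>, so only the two kinds of generators have to be tested; a varying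
  \<open>j\<close> is needed for the commutators, where the hypothesis is used at
  \<open>Suc j\<close>.\<close>

lemma lpc_gcomm_add:
  "0 < i \<Longrightarrow> 0 < j \<Longrightarrow> a \<in> lpc G T p i \<Longrightarrow> b \<in> lpc G T p j \<Longrightarrow> gcomm G a b \<in> lpc G T p (i + j)"
proof (induction i arbitrary: a b j)
  case (Suc i)
  let ?L = "lpc G T p"
  show ?case
  proof (cases i)
    case 0
    with Suc.prems lpc_gcomm lpc_carrier show ?thesis by simp
  next
    case (Suc i')
    then have i: "0 < i" by simp
    define M where "M = ?L (Suc i + j)"
    define H where "H = {a \<in> carrier G. \<forall>b\<in>?L j. gcomm G a b \<in> M}"
    interpret N: normal M G unfolding M_def by (rule lpc_normal)
    interpret Q: group "G Mod M" by (rule N.factorgroup_is_group)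
    let ?\<pi> = "\<lambda>x. M #> x"
    have cl: "?\<pi> a \<in> carrier (G Mod M)" if "a \<in> carrier G" for a
      using that by (auto simp: carrier_FactGroup)
    have m: "?\<pi> (x \<otimes> y) = ?\<pi> x \<otimes>\<^bsub>G Mod M\<^esub> ?\<pi> y" if "x \<in> carrier G" "y \<in> carrier G" for x y
      using that by (simp add: N.rcos_sum)
    have comm: "gcomm G x y \<in> M \<longleftrightarrow>
        ?\<pi> x \<otimes>\<^bsub>G Mod M\<^esub> ?\<pi> y = ?\<pi> y \<otimes>\<^bsub>G Mod M\<^esub> ?\<pi> x"
      if "x \<in> carrier G" "y \<in> carrier G" for x y
      using N.gcomm_in_iff that m by metis
    have "subgroup H G" unfolding H_def using lpc_carrier by (intro N.subgroup_centralizer_mod) auto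
    moreover have "closedin T H"
    proof -
      have "H = (\<Inter>b\<in>?L j. {a \<in> carrier G. gcomm G a b \<in> M})"
        unfolding H_def using subgroup.one_closed[OF lpc_subgroup] by blast
      moreover have "closedin T {a \<in> carrier G. gcomm G a b \<in> M}" if "b \<in> ?L j" for b
        using that lpc_closed lpc_carrier unfolding M_def
        by (intro closedin_preimage continuous_map_gcomm continuous_map_ident) auto
      moreover have "?L j \<noteq> {}" using subgroup.one_closed[OF lpc_subgroup] by auto
      ultimately show ?thesis by auto
    qed
    moreover have "lpc_gens p i' \<subseteq> H"
    proof -
      have "x [^] p \<in> H" if x: "x \<in> ?L i" for x
      proof -
        have xc: "x \<in> carrier G" using x lpc_carrier by auto
        have "gcomm G (x [^] p) b \<in> M" if b: "b \<in> ?L j" for b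
        proof -
          have bc: "b \<in> carrier G" using b lpc_carrier by auto
          define z where "z = gcomm G x b"
          have z: "z \<in> ?L (i + j)" unfolding z_def using Suc.IH[OF i] Suc.prems x b by blast
          then have zc: "z \<in> carrier G" using lpc_carrier by auto
          have zx: "gcomm G z x \<in> M"
            using M_def lpc_gcomm[of "i + j" x z] z i xc zc N.gcomm_in_sym by simp
          have xb: "x \<otimes> b = z \<otimes> (b \<otimes> x)"
            unfolding z_def gcomm_def using xc bc by (simp add: m_assoc inv_mult_cancel)
          \<comment> \<open>Modulo \<open>M\<close> the commutator \<open>z\<close> commutes with
            \<open>x\<close>, so moving \<open>b\<close> past \<open>k\<close> copies of
            \<open>x\<close> costs exactly \<open>z [^] k\<close>. For \<open>k = p\<close> this
            factor lies in \<open>M\<close>.\<close>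
          have "?\<pi> (x [^] k \<otimes> b) = ?\<pi> (z [^] k \<otimes> b \<otimes> x [^] k)" for k :: nat
          proof (induction k)
            case (Suc k)
            have "subgroup {a \<in> carrier G. \<forall>b\<in>{x}. gcomm G a b \<in> M} G"
              using xc by (intro N.subgroup_centralizer_mod) auto
            then have zk: "gcomm G (z [^] k) x \<in> M"
              using nat_pow_in_subgroup[of _ z k] zx zc by auto
            have "x [^] Suc k \<otimes> b = x \<otimes> (x [^] k \<otimes> b)"
              unfolding nat_pow_Suc2[OF xc] using xc bc by (simp add: m_assoc)
            then have "?\<pi> (x [^] Suc k \<otimes> b) = ?\<pi> (x \<otimes> (z [^] k \<otimes> b \<otimes> x [^] k))"
              using Suc xc bc zc m by simp
            also have "\<dots> = ?\<pi> ((x \<otimes> z [^] k) \<otimes> (b \<otimes> x [^] k))"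
              using xc bc zc by (simp add: m_assoc)
            also have "\<dots> = ?\<pi> ((z [^] k \<otimes> x) \<otimes> (b \<otimes> x [^] k))"
              using zk comm xc zc bc m by simp
            also have "(z [^] k \<otimes> x) \<otimes> (b \<otimes> x [^] k) = z [^] k \<otimes> ((x \<otimes> b) \<otimes> x [^] k)"
              using xc bc zc by (simp add: m_assoc)
            also have "\<dots> = z [^] Suc k \<otimes> b \<otimes> x [^] Suc k"
              unfolding xb nat_pow_Suc2[OF xc] nat_pow_Suc[of z] using xc bc zc by (simp add: m_assoc)
            finally show ?case .
          qed (use bc in simp)
          from this[of p] have "?\<pi> (x [^] p \<otimes> b) = ?\<pi> (z [^] p \<otimes> (b \<otimes> x [^] p))"
            using xc bc zc by (simp add: m_assoc)
          also have "\<dots> = ?\<pi> (b \<otimes> x [^] p)"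
          proof -
            have "z [^] p \<in> M" using M_def lpc_pow[of "i + j" z] z i by simp
            then have "?\<pi> (z [^] p) = \<one>\<^bsub>G Mod M\<^esub>"
              using N.rcos_const is_group by simp
            then show ?thesis
              using m[of "z [^] p" "b \<otimes> x [^] p"] Q.l_one[OF cl[of "b \<otimes> x [^] p"]] xc bc zc by simp
          qed
          finally show ?thesis using N.gcomm_in_iff xc bc by simp
        qed
        then show ?thesis unfolding H_def using xc by simp
      qed
      moreover have "gcomm G x a \<in> H" if x: "x \<in> carrier G" and a: "a \<in> ?L i" for x a
      proof -
        have ac: "a \<in> carrier G" using a lpc_carrier by auto
        have "gcomm G (gcomm G x a) b \<in> M" if b: "b \<in> ?L j" for b
        proof -
          have bc: "b \<in> carrier G" using b lpc_carrier by auto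
          \<comment> \<open>With \<open>b\<close> conjugated beforehand,
            \<open>w \<otimes> b'\<close> is \<open>b\<close>, the shape \<open>hall_witt\<close>
            asks for; normality keeps \<open>b'\<close> in the same term.\<close>
          define b' where "b' = inv x \<otimes> b \<otimes> x"
          have b': "b' \<in> ?L j" "b' \<in> carrier G"
            unfolding b'_def using normal.inv_op_closed1[OF lpc_normal x b] lpc_carrier by auto
          define z w c where "z = gcomm G a b'" and "w = gcomm G x b'" and "c = gcomm G x a"
          have zL: "z \<in> ?L (i + j)" unfolding z_def using Suc.IH[OF i] Suc.prems a b' by blast
          have wL: "w \<in> ?L (Suc j)" unfolding w_def using lpc_gcomm x b' Suc.prems by blast
          have cc: "z \<in> carrier G" "w \<in> carrier G" "c \<in> carrier G"
            unfolding z_def w_def c_def using x ac b' by auto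
          have eqs: "a \<otimes> b' = z \<otimes> (b' \<otimes> a)" "x \<otimes> b' = w \<otimes> (b' \<otimes> x)" "x \<otimes> a = c \<otimes> (a \<otimes> x)" "w \<otimes> b' = b"
            unfolding z_def w_def c_def gcomm_def using x ac b' bc
            by (simp_all add: m_assoc inv_mult_cancel, simp add: b'_def m_assoc inv_mult_cancel)
          have zy: "?\<pi> z \<otimes>\<^bsub>G Mod M\<^esub> y = y \<otimes>\<^bsub>G Mod M\<^esub> ?\<pi> z"
            if y: "y \<in> carrier (G Mod M)" for y
          proof -
            obtain y' where y': "y' \<in> carrier G" "y = ?\<pi> y'" using y by (auto simp: carrier_FactGroup)
            have "gcomm G y' z \<in> M" using M_def lpc_gcomm[of "i + j" y' z] y' zL i by simp
            then show ?thesis using comm[of y' z] y' cc by simp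
          qed
          have aw: "?\<pi> a \<otimes>\<^bsub>G Mod M\<^esub> ?\<pi> w = ?\<pi> w \<otimes>\<^bsub>G Mod M\<^esub> ?\<pi> a"
            using M_def Suc.IH[OF i, of "Suc j" a w] a wL comm[of a w] ac cc by simp
          have "?\<pi> c \<otimes>\<^bsub>G Mod M\<^esub> ?\<pi> b = ?\<pi> b \<otimes>\<^bsub>G Mod M\<^esub> ?\<pi> c"
          proof (rule Q.hall_witt[of "?\<pi> x" "?\<pi> a" _ "?\<pi> b'" "?\<pi> z" "?\<pi> w"])
            show "?\<pi> a \<otimes>\<^bsub>G Mod M\<^esub> ?\<pi> b' = ?\<pi> z \<otimes>\<^bsub>G Mod M\<^esub> (?\<pi> b' \<otimes>\<^bsub>G Mod M\<^esub> ?\<pi> a)"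
              using eqs(1) m ac b' cc by (metis m_closed)
            show "?\<pi> x \<otimes>\<^bsub>G Mod M\<^esub> ?\<pi> b' = ?\<pi> w \<otimes>\<^bsub>G Mod M\<^esub> (?\<pi> b' \<otimes>\<^bsub>G Mod M\<^esub> ?\<pi> x)"
              using eqs(2) m x b' cc by (metis m_closed)
            show "?\<pi> x \<otimes>\<^bsub>G Mod M\<^esub> ?\<pi> a = ?\<pi> c \<otimes>\<^bsub>G Mod M\<^esub> (?\<pi> a \<otimes>\<^bsub>G Mod M\<^esub> ?\<pi> x)"
              using eqs(3) m x ac cc by (metis m_closed)
            show "?\<pi> w \<otimes>\<^bsub>G Mod M\<^esub> ?\<pi> b' = ?\<pi> b"
              using eqs(4) m b' cc by metis
          qed (use cl x ac b' bc cc zy aw in auto)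
          then show ?thesis using comm[of c b] cc bc c_def by simp
        qed
        then show ?thesis unfolding H_def using x ac by simp
      qed
      ultimately show ?thesis using Suc by auto
    qed
    ultimately have "?L (Suc i) \<subseteq> H" using closed_subgroup_gen_le Suc by simp
    then show ?thesis using Suc.prems unfolding H_def M_def by auto
  qed
qed simp

sublocale lpc: filtered_group G "lpc G T p" p for p
  by (rule filtered_group.intro[OF is_group filtered_group_axioms.intro])
     (rule lpc_subgroup lpc_Suc_subset lpc_gcomm_add lpc_pow; assumption?)+

text \<open>The filtration is generated by the two operations, so any filtration of the target by
  closed subgroups that is stable under them absorbs the image. It serves for the weight filtration
  of matrices, for its image in a quotient, and for the filtration of a quotient group.\<close>

lemma lpc_image_subset:
  assumes h: "h \<in> hom G P" "continuous_map T TP h" and P: "group P"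
    and F: "\<And>k. 0 < k \<Longrightarrow> subgroup (F k) P" "\<And>k. 0 < k \<Longrightarrow> closedin TP (F k)" "h ` carrier G \<subseteq> F 1"
    and "\<And>k x y. 0 < k \<Longrightarrow> x \<in> carrier P \<Longrightarrow> y \<in> F k \<Longrightarrow> gcomm P x y \<in> F (Suc k)"
    and "\<And>k x. 0 < k \<Longrightarrow> x \<in> F k \<Longrightarrow> x [^]\<^bsub>P\<^esub> p \<in> F (Suc k)"
    and "0 < k"
  shows "h ` lpc G T p k \<subseteq> F k"
  using \<open>0 < k\<close>
proof (induction k)
  case (Suc k)
  interpret h: group_hom G P h
    by (intro group_hom.intro group_hom_axioms.intro is_group P h(1))
  show ?case
  proof (cases k)
    case 0
    with F show ?thesis by simp
  next
    case (Suc k')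
    have IH: "h ` lpc G T p k \<subseteq> F k" using Suc.IH Suc by simp
    have "subgroup {x \<in> carrier G. h x \<in> F (Suc k)} G"
    proof (rule subgroupI)
      show "{x \<in> carrier G. h x \<in> F (Suc k)} \<noteq> {}"
        using subgroup.one_closed[OF F(1)] by (auto intro!: exI[of _ "\<one>"])
    qed (use subgroup.m_inv_closed[OF F(1)] subgroup.m_closed[OF F(1)] in auto)
    moreover have "closedin T {x \<in> carrier G. h x \<in> F (Suc k)}"
      using closedin_continuous_map_preimage[OF h(2) F(2), of "Suc k"] by simp
    moreover have "lpc_gens p k' \<subseteq> {x \<in> carrier G. h x \<in> F (Suc k)}"
    proof -
      have "h (x [^] p) \<in> F (Suc k)" if "x \<in> lpc G T p k" for x
        using that IH assms(8)[of k "h x"] lpc_carrier Suc by (auto simp: h.hom_nat_pow)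
      moreover have "h (gcomm G x y) \<in> F (Suc k)" if "x \<in> carrier G" "y \<in> lpc G T p k" for x y
        using that IH assms(7)[of k "h x" "h y"] lpc_carrier Suc by (auto simp: gcomm_def)
      ultimately show ?thesis using lpc_carrier Suc by auto
    qed
    ultimately have "lpc G T p (Suc k) \<subseteq> {x \<in> carrier G. h x \<in> F (Suc k)}"
      using closed_subgroup_gen_le Suc by simp
    then show ?thesis by blast
  qed
qed simp

end

section \<open>Open subgroups and quotients of profinite groups\<close>

lemma continuous_map_discrete_iff:
  "continuous_map X (discrete_topology D) f \<longleftrightarrow>
     f ` topspace X \<subseteq> D \<and> (\<forall>d. openin X {x \<in> topspace X. f x = d})"
proof
  assume f: "continuous_map X (discrete_topology D) f"
  have "openin X {x \<in> topspace X. f x = d}" for d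
  proof (cases "d \<in> D")
    case True
    then show ?thesis
      using openin_continuous_map_preimage[OF f, of "{d}"] by simp
  next
    case False
    then have "{x \<in> topspace X. f x = d} = {}" using f by (auto simp: continuous_map_def Pi_iff)
    then show ?thesis by (simp only: openin_empty)
  qed
  with f show "f ` topspace X \<subseteq> D \<and> (\<forall>d. openin X {x \<in> topspace X. f x = d})"
    by (auto simp: continuous_map_def Pi_iff)
next
  assume f: "f ` topspace X \<subseteq> D \<and> (\<forall>d. openin X {x \<in> topspace X. f x = d})"
  have "openin X {x \<in> topspace X. f x \<in> U}" for U
  proof -
    have "{x \<in> topspace X. f x \<in> U} = (\<Union>d\<in>U. {x \<in> topspace X. f x = d})" by auto
    with f show ?thesis by auto
  qed
  with f show "continuous_map X (discrete_topology D) f"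
    by (auto simp: continuous_map_def Pi_iff)
qed

lemma continuous_map_from_discrete:
  "f ` D \<subseteq> topspace Y \<Longrightarrow> continuous_map (discrete_topology D) Y f"
  by (auto simp: continuous_map_def Pi_iff)

text \<open>A product of quotient maps need not be a quotient map; openness survives products, which
  is what makes functions of two variables descend.\<close>

lemma open_map_prod_self:
  assumes "open_map X Y f"
  shows "open_map (prod_topology X X) (prod_topology Y Y) (\<lambda>(x,y). (f x, f y))"
  unfolding open_map_def openin_prod_topology_alt
proof (intro allI impI)
  fix S u v
  assume S: "\<forall>x y. (x, y) \<in> S \<longrightarrow> (\<exists>U V. openin X U \<and> openin X V \<and> x \<in> U \<and> y \<in> V \<and> U \<times> V \<subseteq> S)"
    and "(u, v) \<in> (\<lambda>(x,y). (f x, f y)) ` S"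
  then obtain x y where xy: "(x, y) \<in> S" "u = f x" "v = f y" by auto
  with S obtain U V where UV: "openin X U" "openin X V" "x \<in> U" "y \<in> V" "U \<times> V \<subseteq> S" by metis
  show "\<exists>U V. openin Y U \<and> openin Y V \<and> u \<in> U \<and> v \<in> V \<and> U \<times> V \<subseteq> (\<lambda>(x,y). (f x, f y)) ` S"
    using UV xy assms unfolding open_map_def
    by (intro exI[of _ "f ` U"] exI[of _ "f ` V"]) (auto simp: image_iff Bex_def)
qed

context top_group
begin

lemma openin_rcoset:
  assumes "openin T U" "x \<in> carrier G"
  shows "openin T (U #> x)"
proof -
  have "U \<subseteq> carrier G" using openin_subset[OF assms(1)] by simp
  then have "U #> x = {y \<in> carrier G. y \<otimes> inv x \<in> U}"
    using assms(2) by (force simp: r_coset_def m_assoc)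
  moreover have "openin T {y \<in> carrier G. y \<otimes> inv x \<in> U}"
    using assms by (intro openin_preimage continuous_map_mult continuous_map_ident) auto
  ultimately show ?thesis by simp
qed

lemma openin_lcoset:
  assumes "openin T U" "x \<in> carrier G"
  shows "openin T (x <# U)"
proof -
  have "U \<subseteq> carrier G" using openin_subset[OF assms(1)] by simp
  then have "x <# U = {y \<in> carrier G. inv x \<otimes> y \<in> U}"
    using assms(2) by (force simp: l_coset_def inv_mult_cancel)
  moreover have "openin T {y \<in> carrier G. inv x \<otimes> y \<in> U}"
    using assms by (intro openin_preimage continuous_map_mult continuous_map_ident) auto
  ultimately show ?thesis by simp
qed

lemma openin_left_invariant:
  assumes "subgroup H G" "openin T H" "U \<subseteq> carrier G" "\<And>h x. h \<in> H \<Longrightarrow> x \<in> U \<Longrightarrow> h \<otimes> x \<in> U"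
  shows "openin T U"
proof -
  have "U = (\<Union>x\<in>U. H #> x)"
  proof (intro equalityI subsetI)
    show "x \<in> (\<Union>x\<in>U. H #> x)" if "x \<in> U" for x
      using that assms(3) rcos_self[OF _ assms(1)] by blast
    show "x \<in> U" if "x \<in> (\<Union>x\<in>U. H #> x)" for x
      using that assms(4) unfolding r_coset_def by blast
  qed
  moreover have "openin T (\<Union>x\<in>U. H #> x)"
    using assms openin_rcoset by (intro openin_Union) auto
  ultimately show ?thesis by simp
qed

lemma continuous_map_locally_constant:
  assumes "subgroup H G" "openin T H" "\<And>h x. h \<in> H \<Longrightarrow> x \<in> carrier G \<Longrightarrow> f (h \<otimes> x) = f x"
    and "f ` carrier G \<subseteq> D"
  shows "continuous_map T (discrete_topology D) f"
  unfolding continuous_map_discrete_iff topspace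
proof (intro conjI allI)
  show "openin T {x \<in> carrier G. f x = d}" for d
    using assms(3) subgroup.mem_carrier[OF assms(1)]
    by (intro openin_left_invariant[OF assms(1,2)]) auto
qed fact

end

text \<open>Profiniteness in the form in which it is used: compactness makes quotients by open
  subgroups finite, and a base of open subgroups passes to quotient groups by taking images.\<close>

locale pro_group = top_group +
  assumes compact: "compact_space T"
    and open_subgroup_base: "openin T U \<Longrightarrow> \<one> \<in> U \<Longrightarrow> \<exists>H. subgroup H G \<and> openin T H \<and> H \<subseteq> U"
begin

lemma finite_rcosets:
  assumes "subgroup H G" "openin T H"
  shows "finite (rcosets H)"
proof -
  have un: "\<Union>(rcosets H) = carrier G" by (rule rcosets_part_G[OF assms(1)])
  have "openin T C" if "C \<in> rcosets H" for C
    using that assms openin_rcoset by (auto simp: RCOSETS_def)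
  then obtain F where F: "finite F" "F \<subseteq> rcosets H" "carrier G \<subseteq> \<Union>F"
    using compactinD[of T "carrier G" "rcosets H"] compact un unfolding compact_space_def by auto
  have "rcosets H \<subseteq> F"
  proof
    fix C assume C: "C \<in> rcosets H"
    then obtain x where x: "x \<in> carrier G" "C = H #> x" by (auto simp: RCOSETS_def)
    then have "x \<in> C" using rcos_self assms(1) by simp
    moreover obtain C' where C': "C' \<in> F" "x \<in> C'" using F x by auto
    ultimately have "C = C'"
      using C F(2) rcos_disjoint[OF assms(1)] unfolding pairwise_def disjnt_def by blast
    then show "C \<in> F" using C' by simp
  qed
  then show ?thesis using F finite_subset by blast
qed

text \<open>The normal core of an open subgroup \<open>H\<close>. Whether a conjugate of
  \<open>x\<close> lies in \<open>H\<close> depends only on the coset \<open>H #> g\<close> of the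
  conjugating element, so finitely many open conditions define the core.\<close>

lemma open_normal_base:
  assumes "openin T U" "\<one> \<in> U"
  shows "\<exists>W. W \<lhd> G \<and> openin T W \<and> W \<subseteq> U"
proof -
  obtain H where H: "subgroup H G" "openin T H" "H \<subseteq> U"
    using open_subgroup_base[OF assms] by blast
  have Hc: "h \<in> carrier G" if "h \<in> H" for h using that subgroup.mem_carrier[OF H(1)] by blast
  define W where "W = {x \<in> carrier G. \<forall>g\<in>carrier G. g \<otimes> x \<otimes> inv g \<in> H}"
  have "subgroup W G"
  proof (rule subgroupI)
    show "W \<noteq> {}" unfolding W_def using subgroup.one_closed[OF H(1)] by (auto intro!: exI[of _ \<one>])
    show "inv a \<in> W" if "a \<in> W" for a
    proof -
      have "g \<otimes> inv a \<otimes> inv g = inv (g \<otimes> a \<otimes> inv g)" if "g \<in> carrier G" for g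
        using that \<open>a \<in> W\<close> unfolding W_def by (simp add: inv_mult_group m_assoc)
      then show ?thesis using that subgroup.m_inv_closed[OF H(1)] unfolding W_def by auto
    qed
    show "a \<otimes> b \<in> W" if "a \<in> W" "b \<in> W" for a b
    proof -
      have "g \<otimes> (a \<otimes> b) \<otimes> inv g = (g \<otimes> a \<otimes> inv g) \<otimes> (g \<otimes> b \<otimes> inv g)" if "g \<in> carrier G" for g
        using that \<open>a \<in> W\<close> \<open>b \<in> W\<close> unfolding W_def by (simp add: m_assoc inv_mult_cancel)
      then show ?thesis using that subgroup.m_closed[OF H(1)] unfolding W_def by auto
    qed
  qed (auto simp: W_def)
  moreover have "g \<otimes> x \<otimes> inv g \<in> W" if "g \<in> carrier G" "x \<in> W" for g x
  proof -
    have "g' \<otimes> (g \<otimes> x \<otimes> inv g) \<otimes> inv g' \<in> H" if "g' \<in> carrier G" for g'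
    proof -
      have "(g' \<otimes> g) \<otimes> x \<otimes> inv (g' \<otimes> g) \<in> H"
        using that \<open>g \<in> carrier G\<close> \<open>x \<in> W\<close> unfolding W_def by blast
      then show ?thesis
        using that \<open>g \<in> carrier G\<close> \<open>x \<in> W\<close> unfolding W_def by (simp add: m_assoc inv_mult_group)
    qed
    then show ?thesis using that unfolding W_def by auto
  qed
  ultimately have "W \<lhd> G" using normal_inv_iff by blast
  moreover have "openin T W"
  proof -
    have "W = carrier G \<inter> (\<Inter>C\<in>rcosets H. {x \<in> carrier G. \<forall>g\<in>C. g \<otimes> x \<otimes> inv g \<in> H})"
      unfolding W_def using rcosets_part_G[OF H(1)] by blast
    moreover have "openin T {x \<in> carrier G. \<forall>g\<in>C. g \<otimes> x \<otimes> inv g \<in> H}" if C: "C \<in> rcosets H" for C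
    proof -
      obtain r where r: "r \<in> carrier G" "C = H #> r" using C by (auto simp: RCOSETS_def)
      have "h \<otimes> r \<otimes> x \<otimes> inv (h \<otimes> r) \<in> H" if "h \<in> H" "r \<otimes> x \<otimes> inv r \<in> H" "x \<in> carrier G" for h x
      proof -
        have "h \<otimes> r \<otimes> x \<otimes> inv (h \<otimes> r) = h \<otimes> (r \<otimes> x \<otimes> inv r) \<otimes> inv h"
          using that r Hc by (simp add: m_assoc inv_mult_group)
        then show ?thesis
          using that subgroup.m_closed[OF H(1)] subgroup.m_inv_closed[OF H(1)] by metis
      qed
      moreover have "r \<in> C" using r rcos_self H(1) by simp
      ultimately have "{x \<in> carrier G. \<forall>g\<in>C. g \<otimes> x \<otimes> inv g \<in> H} = {x \<in> carrier G. r \<otimes> x \<otimes> inv r \<in> H}"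
        using r(2) unfolding r_coset_def by blast
      moreover have "openin T {x \<in> carrier G. r \<otimes> x \<otimes> inv r \<in> H}"
        using r H by (intro openin_preimage continuous_map_mult continuous_map_ident) auto
      ultimately show ?thesis by simp
    qed
    moreover have "openin T (carrier G)" by (metis openin_topspace topspace)
    ultimately show ?thesis
      using finite_rcosets[OF H(1,2)] by (cases "rcosets H = {}") (auto intro!: openin_Inter openin_Int)
  qed
  moreover have "W \<subseteq> H" unfolding W_def by (auto dest!: bspec[of _ _ \<one>])
  ultimately show ?thesis using H(3) by blast
qed

text \<open>Turns questions about a closed set into questions in a finite quotient: \<open>g\<close>
  stays outside the image of \<open>C\<close> modulo \<open>W\<close>.\<close>

lemma closed_separation:
  assumes "closedin T C" "g \<in> carrier G" "g \<notin> C"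
  shows "\<exists>W. W \<lhd> G \<and> openin T W \<and> (\<forall>w\<in>W. w \<otimes> g \<notin> C)"
proof -
  have "openin T (carrier G - C)" using assms(1) by (simp add: closedin_def)
  then have "openin T {x \<in> carrier G. x \<otimes> g \<in> carrier G - C}"
    using assms(2) by (intro openin_preimage continuous_map_mult continuous_map_ident) auto
  from open_normal_base[OF this] assms show ?thesis by auto
qed

end

text \<open>In a compact Hausdorff space components are quasi-components, so a clopen set
  \<open>V\<close> fits between the neutral element and \<open>U\<close>. Its stabiliser under right
  translation is the open subgroup.\<close>

lemma profinite_imp_pro_group:
  assumes "profinite_group G T"
  shows "pro_group G T"
proof -
  interpret top_group G T
    using assms unfolding profinite_group_def topological_group_def top_group_def top_group_axioms_def by blast
  have cpt: "compact_space T" and hd: "Hausdorff_space T" and td: "totally_disconnected_space T"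
    using assms unfolding profinite_group_def by auto
  show ?thesis
  proof unfold_locales
    fix U assume U: "openin T U" "\<one>\<^bsub>G\<^esub> \<in> U"
    have Uc: "U \<subseteq> carrier G" using openin_subset[OF U(1)] by simp
    have q: "quasi_component_of_set T \<one>\<^bsub>G\<^esub> = {\<one>\<^bsub>G\<^esub>}"
    proof -
      have "connectedin T (quasi_component_of_set T \<one>\<^bsub>G\<^esub>)"
        using quasi_eq_connected_component_of[of T "\<one>\<^bsub>G\<^esub>"] quasi_eq_connected_component_of_eq[of T "\<one>\<^bsub>G\<^esub>"] cpt hd
        by blast
      moreover have "\<one>\<^bsub>G\<^esub> \<in> quasi_component_of_set T \<one>\<^bsub>G\<^esub>" by simp
      ultimately show ?thesis using td unfolding totally_disconnected_space_def by (metis empty_iff singletonD)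
    qed
    have "{\<one>\<^bsub>G\<^esub>} \<in> quasi_components_of T"
      unfolding quasi_components_of_def using q by (auto intro!: image_eqI[of _ _ "\<one>\<^bsub>G\<^esub>"])
    moreover have "compactin T (carrier G - U)"
      using U(1) cpt by (intro closedin_compact_space) (auto intro!: closedin_diff)
    ultimately have "separated_between T {\<one>\<^bsub>G\<^esub>} (carrier G - U)"
      using separated_between_quasi_component_compact U(2) by (auto simp: disjnt_def)
    then obtain V V' where V: "openin T V" "openin T V'" "V \<union> V' = carrier G" "disjnt V V'"
      "\<one>\<^bsub>G\<^esub> \<in> V" "carrier G - U \<subseteq> V'"
      unfolding separated_between_def by auto
    have Vc: "V \<subseteq> carrier G" "closedin T V" "closedin T (carrier G - V)"
    proof -
      show "V \<subseteq> carrier G" using V(3) by auto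
      have "V' = carrier G - V" using V(3,4) by (auto simp: disjnt_iff)
      then show "closedin T V" "closedin T (carrier G - V)"
        unfolding closedin_def using V(1,2) \<open>V \<subseteq> carrier G\<close> by (auto simp: double_diff)
    qed
    define H where "H = {x \<in> carrier G. \<forall>v\<in>carrier G. v \<otimes>\<^bsub>G\<^esub> x \<in> V \<longleftrightarrow> v \<in> V}"
    have "subgroup H G"
    proof (rule subgroupI)
      show "H \<noteq> {}" unfolding H_def by (auto intro!: exI[of _ "\<one>\<^bsub>G\<^esub>"])
      show "inv\<^bsub>G\<^esub> a \<in> H" if "a \<in> H" for a
      proof -
        have "v \<otimes>\<^bsub>G\<^esub> inv\<^bsub>G\<^esub> a \<in> V \<longleftrightarrow> v \<in> V" if "v \<in> carrier G" for v
        proof -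
          have "v \<otimes>\<^bsub>G\<^esub> inv\<^bsub>G\<^esub> a \<otimes>\<^bsub>G\<^esub> a \<in> V \<longleftrightarrow> v \<otimes>\<^bsub>G\<^esub> inv\<^bsub>G\<^esub> a \<in> V"
            using that \<open>a \<in> H\<close> unfolding H_def by auto
          then show ?thesis using that \<open>a \<in> H\<close> unfolding H_def by (simp add: m_assoc)
        qed
        then show ?thesis using that unfolding H_def by auto
      qed
      show "a \<otimes>\<^bsub>G\<^esub> b \<in> H" if "a \<in> H" "b \<in> H" for a b
        using that unfolding H_def by (auto simp flip: m_assoc)
    qed (auto simp: H_def)
    moreover have "openin T H"
    proof -
      define f where "f = (\<lambda>(v, x). v \<otimes>\<^bsub>G\<^esub> x)"
      have f: "continuous_map (prod_topology T T) T f"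
        using tg unfolding topological_group_def f_def by simp
      define V1 where "V1 = carrier G - V"
      \<comment> \<open>The pairs for which translation by the second entry moves the first into or
        out of \<open>V\<close>. The set is closed, and so is its projection along the compact first
        factor; the stabiliser is the complement.\<close>
      define K where "K = {z \<in> carrier G \<times> carrier G. fst z \<in> V} \<inter> {z \<in> carrier G \<times> carrier G. f z \<in> V1}
        \<union> {z \<in> carrier G \<times> carrier G. fst z \<in> V1} \<inter> {z \<in> carrier G \<times> carrier G. f z \<in> V}"
      have "closedin (prod_topology T T) K"
        unfolding K_def using Vc(2) Vc(3)[folded V1_def] closedin_continuous_map_preimage[OF f] closedin_continuous_map_preimage[OF continuous_map_fst, of T V T]
          closedin_continuous_map_preimage[OF continuous_map_fst, of T V1 T]
        by (intro closedin_Un closedin_Int) auto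
      then have "closedin T (snd ` K)"
        using closed_map_snd[OF cpt] unfolding closed_map_def by blast
      moreover have "H = carrier G - snd ` K"
      proof -
        have "(v, x) \<in> K \<longleftrightarrow> v \<in> carrier G \<and> x \<in> carrier G \<and> (v \<otimes>\<^bsub>G\<^esub> x \<in> V) \<noteq> (v \<in> V)" for v x
          unfolding K_def V1_def f_def by auto
        moreover have "snd ` K = {x. \<exists>v. (v, x) \<in> K}" by force
        ultimately show ?thesis unfolding H_def by auto
      qed
      ultimately show ?thesis by (simp add: closedin_def)
    qed
    moreover have "H \<subseteq> V"
      unfolding H_def using V(5) by (auto dest!: bspec[of _ _ "\<one>\<^bsub>G\<^esub>"])
    moreover have "V \<subseteq> U" using V Uc by (auto simp: disjnt_iff)
    ultimately show "\<exists>H. subgroup H G \<and> openin T H \<and> H \<subseteq> U" by blast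
  qed (rule cpt)
qed

section \<open>Quotient groups with the quotient topology\<close>

locale top_group_mod = top_group + normal N G for N
begin

abbreviation "\<pi> \<equiv> \<lambda>x. N #> x"

lemma Union_FactGroup_subset: "U \<subseteq> carrier (G Mod N) \<Longrightarrow> \<Union>U \<subseteq> carrier G"
  using rcosets_carrier[OF is_group] by (auto simp: FactGroup_def)

text \<open>Shows that \<open>quot_top\<close>, given by unions of cosets, is the quotient topology
  of the projection.\<close>

lemma rcoset_preimage:
  assumes U: "U \<subseteq> carrier (G Mod N)"
  shows "{x \<in> carrier G. \<pi> x \<in> U} = \<Union>U"
proof (intro equalityI subsetI)
  fix x
  show "x \<in> \<Union>U" if "x \<in> {x \<in> carrier G. \<pi> x \<in> U}"
    using that rcos_self[OF _ is_subgroup] by blast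
  show "x \<in> {x \<in> carrier G. \<pi> x \<in> U}" if x: "x \<in> \<Union>U"
  proof -
    obtain C where C: "x \<in> C" "C \<in> U" using x by auto
    then obtain y where y: "y \<in> carrier G" "C = \<pi> y" using U by (auto simp: carrier_FactGroup)
    then have "\<pi> x = C" using C(1) repr_independence[of x N y] is_subgroup by simp
    then show ?thesis using C U x Union_FactGroup_subset[OF U] by auto
  qed
qed

lemma istopology_quot: "istopology (\<lambda>U. U \<subseteq> carrier (G Mod N) \<and> openin T (\<Union>U))"
  unfolding istopology_def
proof (intro conjI allI impI)
  fix U V assume *: "U \<subseteq> carrier (G Mod N) \<and> openin T (\<Union>U)" "V \<subseteq> carrier (G Mod N) \<and> openin T (\<Union>V)"
  then have "U \<inter> V \<subseteq> carrier (G Mod N)" by blast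
  then have "\<Union>(U \<inter> V) = \<Union>U \<inter> \<Union>V" using * rcoset_preimage[of U] rcoset_preimage[of V] rcoset_preimage[of "U \<inter> V"] by blast
  then show "openin T (\<Union>(U \<inter> V))" using * by auto
next
  fix \<K> assume \<K>: "\<forall>U\<in>\<K>. U \<subseteq> carrier (G Mod N) \<and> openin T (\<Union>U)"
  have "\<Union>(\<Union>\<K>) = (\<Union>U\<in>\<K>. \<Union>U)" by auto
  then show "openin T (\<Union>(\<Union>\<K>))" using \<K> by auto
qed auto

lemma openin_quot: "openin (quot_top G T N) U \<longleftrightarrow> U \<subseteq> carrier (G Mod N) \<and> openin T (\<Union>U)"
  unfolding quot_top_def using istopology_quot by (simp add: topology_inverse')

lemma Union_FactGroup: "\<Union>(carrier (G Mod N)) = carrier G"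
  using rcosets_part_G[OF is_subgroup] by (simp add: FactGroup_def)

lemma topspace_quot [simp]: "topspace (quot_top G T N) = carrier (G Mod N)"
proof -
  have "openin (quot_top G T N) (carrier (G Mod N))"
    unfolding openin_quot Union_FactGroup by (metis openin_topspace order_refl topspace)
  then show ?thesis
    by (metis openin_quot openin_subset openin_topspace subset_antisym)
qed

lemma continuous_map_proj: "continuous_map T (quot_top G T N) \<pi>"
  by (auto simp: continuous_map_def openin_quot rcoset_preimage carrier_FactGroup)

lemma open_map_proj: "open_map T (quot_top G T N) \<pi>"
  unfolding open_map_def openin_quot
proof (intro allI impI conjI)
  fix V assume V: "openin T V"
  then have Vc: "V \<subseteq> carrier G" using openin_subset by force
  then show "\<pi> ` V \<subseteq> carrier (G Mod N)" by (auto simp: carrier_FactGroup)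
  have "\<Union>(\<pi> ` V) = (\<Union>n\<in>N. n <# V)" by (auto simp: r_coset_def l_coset_def)
  then show "openin T (\<Union>(\<pi> ` V))" using V openin_lcoset subset by auto
qed

lemma quotient_map_proj: "quotient_map T (quot_top G T N) \<pi>"
  by (rule continuous_open_imp_quotient_map[OF continuous_map_proj open_map_proj]) (simp add: carrier_FactGroup)

lemma quotient_map_proj_prod:
  "quotient_map (prod_topology T T) (prod_topology (quot_top G T N) (quot_top G T N)) (\<lambda>(x,y). (\<pi> x, \<pi> y))"
proof (rule continuous_open_imp_quotient_map[OF _ open_map_prod_self[OF open_map_proj]])
  have "continuous_map (prod_topology T T) (quot_top G T N) (\<pi> \<circ> fst)"
       "continuous_map (prod_topology T T) (quot_top G T N) (\<pi> \<circ> snd)"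
    by (rule continuous_map_compose[OF _ continuous_map_proj] continuous_map_fst continuous_map_snd)+
  then show "continuous_map (prod_topology T T) (prod_topology (quot_top G T N) (quot_top G T N)) (\<lambda>(x,y). (\<pi> x, \<pi> y))"
    by (simp add: continuous_map_pairwise o_def case_prod_beta)
  show "(\<lambda>(x,y). (\<pi> x, \<pi> y)) ` topspace (prod_topology T T) = topspace (prod_topology (quot_top G T N) (quot_top G T N))"
    by (auto simp: carrier_FactGroup)
qed

lemma continuous_map_descend:
  assumes "continuous_map T Y f" "\<And>x. x \<in> carrier G \<Longrightarrow> g (\<pi> x) = f x"
  shows "continuous_map (quot_top G T N) Y g"
  using assms by (intro continuous_compose_quotient_map[OF quotient_map_proj])
    (auto intro: continuous_map_eq)

lemma continuous_map_descend_prod: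
  assumes "continuous_map (prod_topology T T) Y f"
    and "\<And>x y. x \<in> carrier G \<Longrightarrow> y \<in> carrier G \<Longrightarrow> g (\<pi> x, \<pi> y) = f (x, y)"
  shows "continuous_map (prod_topology (quot_top G T N) (quot_top G T N)) Y g"
  using assms by (intro continuous_compose_quotient_map[OF quotient_map_proj_prod])
    (auto intro: continuous_map_eq)

lemma top_group_quot: "top_group (G Mod N) (quot_top G T N)"
proof -
  interpret Q: group "G Mod N" by (rule factorgroup_is_group)
  have "continuous_map (prod_topology T T) (quot_top G T N) (\<pi> \<circ> (\<lambda>(x,y). x \<otimes> y))"
    using tg unfolding topological_group_def by (intro continuous_map_compose[OF _ continuous_map_proj]) auto
  then have "continuous_map (prod_topology (quot_top G T N) (quot_top G T N)) (quot_top G T N) (\<lambda>(x,y). x \<otimes>\<^bsub>G Mod N\<^esub> y)"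
    by (rule continuous_map_descend_prod) (simp add: rcos_sum)
  moreover have "continuous_map T (quot_top G T N) (\<pi> \<circ> (\<lambda>x. inv x))"
    using tg unfolding topological_group_def by (intro continuous_map_compose[OF _ continuous_map_proj]) auto
  then have "continuous_map (quot_top G T N) (quot_top G T N) (\<lambda>x. inv\<^bsub>G Mod N\<^esub> x)"
    by (rule continuous_map_descend) (simp add: inv_FactGroup rcos_inv carrier_FactGroup)
  ultimately have "topological_group (G Mod N) (quot_top G T N)"
    unfolding topological_group_def using Q.is_group by simp
  then show ?thesis by (intro top_group.intro top_group_axioms.intro Q.is_group)
qed

end

lemma pro_group_quot:
  fixes G (structure)
  assumes "pro_group G T" "N \<lhd> G"
  shows "pro_group (G Mod N) (quot_top G T N)"
proof -
  interpret pro_group G T by (rule assms)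
  interpret normal N G by (rule assms)
  interpret top_group_mod G T N by unfold_locales
  interpret Q: top_group "G Mod N" "quot_top G T N" by (rule top_group_quot)
  show ?thesis
  proof (intro pro_group.intro Q.top_group_axioms pro_group_axioms.intro)
    have "compactin (quot_top G T N) (\<pi> ` carrier G)"
      using compact by (intro image_compactin[OF _ continuous_map_proj]) (simp add: compact_space_def)
    then show "compact_space (quot_top G T N)" by (simp add: compact_space_def carrier_FactGroup)
  next
    fix U assume U: "openin (quot_top G T N) U" "\<one>\<^bsub>G Mod N\<^esub> \<in> U"
    then have "openin T (\<Union>U)" "\<one> \<in> \<Union>U"
      by (auto simp: openin_quot intro!: bexI[of _ N])
    then obtain H where H: "subgroup H G" "openin T H" "H \<subseteq> \<Union>U" using open_subgroup_base by blast
    interpret \<pi>: group_hom G "G Mod N" \<pi>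
      by (intro group_hom.intro group_hom_axioms.intro is_group Q.is_group r_coset_hom_Mod)
    have "subgroup (\<pi> ` H) (G Mod N)" by (rule \<pi>.subgroup_img_is_subgroup[OF H(1)])
    moreover have "openin (quot_top G T N) (\<pi> ` H)" using open_map_proj H(2) unfolding open_map_def by blast
    moreover have "\<pi> ` H \<subseteq> U"
      using H(3) U(1) rcoset_preimage[of U] by (auto simp: openin_quot)
    ultimately show "\<exists>H. subgroup H (G Mod N) \<and> openin (quot_top G T N) H \<and> H \<subseteq> U" by blast
  qed
qed

section \<open>Unitriangular matrices\<close>

lemma sum_mod_mult: "(\<Sum>k\<in>K. (a k mod m) * c k) mod m = (\<Sum>k\<in>K. a k * c k) mod (m::int)"
proof -
  have "(\<Sum>k\<in>K. (a k mod m) * c k) mod m = (\<Sum>k\<in>K. ((a k mod m) * c k) mod m) mod m"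
    by (rule mod_sum_eq[symmetric])
  also have "\<dots> = (\<Sum>k\<in>K. (a k * c k) mod m) mod m" by (simp add: mod_mult_left_eq)
  finally show ?thesis by (simp add: mod_sum_eq)
qed

lemma sum_mod_mult': "(\<Sum>k\<in>K. c k * (a k mod m)) mod m = (\<Sum>k\<in>K. c k * a k) mod (m::int)"
  using sum_mod_mult[where K = K and a = a and c = c] by (simp add: mult.commute)

lemma carrier_unitri:
  "A \<in> carrier (unitri s m) \<longleftrightarrow>
    (\<forall>i j. if i \<le> s \<and> j \<le> s \<and> i < j then A i j \<in> {0..<int m} else A i j = (if i = j \<and> i \<le> s then 1 else 0))"
  by (simp add: unitri_def)

lemma mult_unitri:
  "(A \<otimes>\<^bsub>unitri s m\<^esub> B) i j = (if i \<le> s \<and> j \<le> s then (\<Sum>k\<le>s. A i k * B k j) mod int m else 0)"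
  by (simp add: unitri_def)

lemma one_unitri: "\<one>\<^bsub>unitri s m\<^esub> i j = (if i = j \<and> i \<le> s then 1 else 0)"
  by (simp add: unitri_def)

lemma unitri_entries:
  assumes "A \<in> carrier (unitri s m)"
  shows "A i i = (if i \<le> s then 1 else 0)" "j < i \<Longrightarrow> A i j = 0" "s < j \<Longrightarrow> A i j = 0"
    "i < j \<Longrightarrow> j \<le> s \<Longrightarrow> A i j \<in> {0..<int m}"
proof -
  have "\<forall>i j. if i \<le> s \<and> j \<le> s \<and> i < j then A i j \<in> {0..<int m} else A i j = (if i = j \<and> i \<le> s then 1 else 0)"
    using assms by (simp only: carrier_unitri)
  then show "A i i = (if i \<le> s then 1 else 0)" "j < i \<Longrightarrow> A i j = 0" "s < j \<Longrightarrow> A i j = 0"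
    "i < j \<Longrightarrow> j \<le> s \<Longrightarrow> A i j \<in> {0..<int m}"
    by (auto dest!: spec[of _ i] spec[of _ j] spec[of _ i] split: if_splits)
qed

text \<open>Triangularity leaves the indices from \<open>i\<close> to \<open>j\<close>, and the two
  ends give the entries themselves. Every later estimate concerns the strictly intermediate
  products.\<close>

lemma unitri_mult_sum:
  assumes A: "A \<in> carrier (unitri s m)" and B: "B \<in> carrier (unitri s m)" and ij: "i < j" "j \<le> s"
  shows "(\<Sum>k\<le>s. A i k * B k j) = A i j + B i j + (\<Sum>k\<in>{i<..<j}. A i k * B k j)"
proof -
  have "(\<Sum>k\<le>s. A i k * B k j) = (\<Sum>k\<in>insert i (insert j {i<..<j}). A i k * B k j)"
  proof (rule sum.mono_neutral_right)
    show "\<forall>k\<in>{..s} - insert i (insert j {i<..<j}). A i k * B k j = 0"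
    proof
      fix k assume "k \<in> {..s} - insert i (insert j {i<..<j})"
      then have "k < i \<or> j < k" by auto
      then show "A i k * B k j = 0" using unitri_entries(2)[OF A] unitri_entries(2)[OF B] by auto
    qed
  qed (use ij in auto)
  also have "\<dots> = A i j + B i j + (\<Sum>k\<in>{i<..<j}. A i k * B k j)"
    using ij unitri_entries(1)[OF A] unitri_entries(1)[OF B] by simp
  finally show ?thesis .
qed

lemma unitri_mult_entry:
  assumes "A \<in> carrier (unitri s m)" "B \<in> carrier (unitri s m)" "i < j" "j \<le> s"
  shows "(A \<otimes>\<^bsub>unitri s m\<^esub> B) i j = (A i j + B i j + (\<Sum>k\<in>{i<..<j}. A i k * B k j)) mod int m"
  using assms by (simp add: mult_unitri unitri_mult_sum)

lemma unitri_mult_closed: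
  assumes A: "A \<in> carrier (unitri s m)" and B: "B \<in> carrier (unitri s m)" and m: "1 < m"
  shows "A \<otimes>\<^bsub>unitri s m\<^esub> B \<in> carrier (unitri s m)"
  unfolding carrier_unitri
proof (intro allI)
  fix i j
  consider "i < j" "j \<le> s" | "s < j \<or> s < i" | "j < i" "i \<le> s" | "i = j" "i \<le> s" by linarith
  then show "if i \<le> s \<and> j \<le> s \<and> i < j then (A \<otimes>\<^bsub>unitri s m\<^esub> B) i j \<in> {0..<int m}
     else (A \<otimes>\<^bsub>unitri s m\<^esub> B) i j = (if i = j \<and> i \<le> s then 1 else 0)"
  proof cases
    case 1
    then show ?thesis using m by (simp add: mult_unitri)
  next
    case 2
    then show ?thesis by (auto simp: mult_unitri)
  next
    case 3
    have "A i k * B k j = 0" for k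
      using unitri_entries(2)[OF A, of k i] unitri_entries(2)[OF B, of j k] 3 by (cases "k < i") auto
    then have "(\<Sum>k\<le>s. A i k * B k j) = 0" by (intro sum.neutral) blast
    with 3 show ?thesis by (simp add: mult_unitri)
  next
    case 4
    have "(\<Sum>k\<le>s. A i k * B k i) = (\<Sum>k\<in>{i}. A i k * B k i)"
    proof (rule sum.mono_neutral_right)
      show "\<forall>k\<in>{..s} - {i}. A i k * B k i = 0"
      proof
        fix k assume "k \<in> {..s} - {i}"
        then have "k < i \<or> i < k" by auto
        then show "A i k * B k i = 0" using unitri_entries(2)[OF A] unitri_entries(2)[OF B] by auto
      qed
    qed (use 4 in auto)
    also have "\<dots> = 1" using 4 unitri_entries(1)[OF A] unitri_entries(1)[OF B] by simp
    finally show ?thesis using 4 m by (simp add: mult_unitri)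
  qed
qed

lemma unitri_one_closed: "1 < m \<Longrightarrow> \<one>\<^bsub>unitri s m\<^esub> \<in> carrier (unitri s m)"
  by (auto simp: carrier_unitri one_unitri)

lemma unitri_eqI:
  assumes A: "A \<in> carrier (unitri s m)" and B: "B \<in> carrier (unitri s m)"
    and eq: "\<And>i j. i < j \<Longrightarrow> j \<le> s \<Longrightarrow> int m dvd A i j - B i j"
  shows "A = B"
proof (intro ext)
  fix i j
  consider "i < j" "j \<le> s" | "s < j" | "j < i" | "i = j" by linarith
  then show "A i j = B i j"
  proof cases
    case 1
    then have "A i j mod int m = B i j mod int m" using eq by (simp add: mod_eq_dvd_iff)
    then show ?thesis using unitri_entries(4)[OF A 1] unitri_entries(4)[OF B 1] by simp
  qed (use unitri_entries[OF A] unitri_entries[OF B] in auto)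
qed

lemma finite_unitri: "finite (carrier (unitri s m))"
proof -
  let ?f = "\<lambda>f i j. if i \<le> s \<and> j \<le> s then f (i, j) else 0 :: int"
  have "carrier (unitri s m) \<subseteq> ?f ` (PiE ({..s} \<times> {..s}) (\<lambda>_. {0..int m} \<union> {1}))"
  proof
    fix A assume A: "A \<in> carrier (unitri s m)"
    let ?a = "restrict (\<lambda>(i, j). A i j) ({..s} \<times> {..s})"
    have "?a \<in> PiE ({..s} \<times> {..s}) (\<lambda>_. {0..int m} \<union> {1})"
    proof (intro restrict_PiE_iff[THEN iffD2] ballI)
      fix x assume "x \<in> {..s} \<times> {..s}"
      then obtain i j where x: "x = (i, j)" "i \<le> s" "j \<le> s" by auto
      consider "i < j" | "i = j" | "j < i" by linarith
      then show "(case x of (i, j) \<Rightarrow> A i j) \<in> {0..int m} \<union> {1}"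
        using x unitri_entries(2)[OF A, of j i] unitri_entries(4)[OF A, of i j] unitri_entries(1)[OF A, of i]
        by cases auto
    qed
    moreover have "A = ?f ?a"
    proof (intro ext)
      fix i j
      show "A i j = ?f ?a i j"
        using unitri_entries(3)[OF A, of j i] unitri_entries(2)[OF A, of j i] by (cases "j < i") auto
    qed
    ultimately show "A \<in> ?f ` (PiE ({..s} \<times> {..s}) (\<lambda>_. {0..int m} \<union> {1}))" by blast
  qed
  moreover have "finite (PiE ({..s} \<times> {..s}) (\<lambda>_. {0..int m} \<union> {1}))" by (intro finite_PiE) auto
  ultimately show ?thesis using finite_surj by blast
qed

text \<open>Inverses come from finiteness: left multiplication is injective, because an entry is
  determined once those nearer to the diagonal in its column are known, and hence it is
  surjective.\<close>

lemma group_unitri: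
  assumes m: "1 < m"
  shows "group (unitri s m)"
proof -
  let ?U = "unitri s m"
  note cl = unitri_mult_closed[OF _ _ m] unitri_one_closed[OF m]
  have assoc: "A \<otimes>\<^bsub>?U\<^esub> B \<otimes>\<^bsub>?U\<^esub> C = A \<otimes>\<^bsub>?U\<^esub> (B \<otimes>\<^bsub>?U\<^esub> C)" for A B C
  proof (intro ext)
    fix i j
    show "(A \<otimes>\<^bsub>?U\<^esub> B \<otimes>\<^bsub>?U\<^esub> C) i j = (A \<otimes>\<^bsub>?U\<^esub> (B \<otimes>\<^bsub>?U\<^esub> C)) i j"
    proof (cases "i \<le> s \<and> j \<le> s")
      case True
      then have "(A \<otimes>\<^bsub>?U\<^esub> B \<otimes>\<^bsub>?U\<^esub> C) i j = (\<Sum>k\<le>s. ((\<Sum>l\<le>s. A i l * B l k) mod int m) * C k j) mod int m"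
        by (simp add: mult_unitri)
      also have "\<dots> = (\<Sum>k\<le>s. (\<Sum>l\<le>s. A i l * B l k) * C k j) mod int m" by (rule sum_mod_mult)
      also have "(\<Sum>k\<le>s. (\<Sum>l\<le>s. A i l * B l k) * C k j) = (\<Sum>k\<le>s. \<Sum>l\<le>s. A i l * (B l k * C k j))"
        by (simp add: sum_distrib_right mult.assoc)
      also have "\<dots> = (\<Sum>l\<le>s. \<Sum>k\<le>s. A i l * (B l k * C k j))" by (rule sum.swap)
      also have "\<dots> = (\<Sum>l\<le>s. A i l * (\<Sum>k\<le>s. B l k * C k j))" by (simp add: sum_distrib_left)
      also have "\<dots> mod int m = (\<Sum>l\<le>s. A i l * ((\<Sum>k\<le>s. B l k * C k j) mod int m)) mod int m"
        by (rule sum_mod_mult'[symmetric])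
      also have "\<dots> = (A \<otimes>\<^bsub>?U\<^esub> (B \<otimes>\<^bsub>?U\<^esub> C)) i j" using True by (simp add: mult_unitri)
      finally show ?thesis .
    qed (auto simp: mult_unitri)
  qed
  have one: "\<one>\<^bsub>?U\<^esub> \<otimes>\<^bsub>?U\<^esub> A = A" "A \<otimes>\<^bsub>?U\<^esub> \<one>\<^bsub>?U\<^esub> = A" if A: "A \<in> carrier ?U" for A
  proof -
    have "(\<one>\<^bsub>?U\<^esub> \<otimes>\<^bsub>?U\<^esub> A) i j = A i j mod int m" "(A \<otimes>\<^bsub>?U\<^esub> \<one>\<^bsub>?U\<^esub>) i j = A i j mod int m"
      if ij: "i < j" "j \<le> s" for i j
      unfolding unitri_mult_entry[OF cl(2) A ij] unitri_mult_entry[OF A cl(2) ij]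
      using ij by (simp_all add: one_unitri)
    then show "\<one>\<^bsub>?U\<^esub> \<otimes>\<^bsub>?U\<^esub> A = A" "A \<otimes>\<^bsub>?U\<^esub> \<one>\<^bsub>?U\<^esub> = A"
      using A cl by (auto intro!: unitri_eqI[of _ s m] simp flip: mod_eq_dvd_iff)
  qed
  have inj: "inj_on (\<lambda>B. A \<otimes>\<^bsub>?U\<^esub> B) (carrier ?U)" if A: "A \<in> carrier ?U" for A
  proof (rule inj_onI)
    fix B C assume B: "B \<in> carrier ?U" and C: "C \<in> carrier ?U" and eq: "A \<otimes>\<^bsub>?U\<^esub> B = A \<otimes>\<^bsub>?U\<^esub> C"
    have "B i j = C i j" if "i < j" "j \<le> s" for i j
      using that
    proof (induction "j - i" arbitrary: i rule: less_induct)
      case less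
      have "(A i j + B i j + (\<Sum>k\<in>{i<..<j}. A i k * B k j)) mod int m
          = (A i j + C i j + (\<Sum>k\<in>{i<..<j}. A i k * C k j)) mod int m"
        using unitri_mult_entry[OF A B less.prems] unitri_mult_entry[OF A C less.prems] eq by simp
      moreover have "(\<Sum>k\<in>{i<..<j}. A i k * B k j) = (\<Sum>k\<in>{i<..<j}. A i k * C k j)"
        using less by (intro sum.cong) auto
      ultimately have "int m dvd B i j - C i j" by (simp add: mod_eq_dvd_iff)
      then have "B i j mod int m = C i j mod int m" by (simp add: mod_eq_dvd_iff)
      then show ?case using unitri_entries(4)[OF B less.prems] unitri_entries(4)[OF C less.prems] by simp
    qed
    then show "B = C" using B C by (intro unitri_eqI[of _ s m]) auto
  qed
  have r_inv: "\<exists>B\<in>carrier ?U. A \<otimes>\<^bsub>?U\<^esub> B = \<one>\<^bsub>?U\<^esub>" if A: "A \<in> carrier ?U" for A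
  proof -
    have "(\<lambda>B. A \<otimes>\<^bsub>?U\<^esub> B) ` carrier ?U = carrier ?U"
      using endo_inj_surj[OF finite_unitri _ inj[OF A]] A cl by blast
    then show ?thesis using cl(2) by (metis imageE)
  qed
  show ?thesis
  proof (rule groupI)
    fix A assume A: "A \<in> carrier ?U"
    obtain B where B: "B \<in> carrier ?U" "A \<otimes>\<^bsub>?U\<^esub> B = \<one>\<^bsub>?U\<^esub>" using r_inv[OF A] by blast
    obtain C where C: "C \<in> carrier ?U" "B \<otimes>\<^bsub>?U\<^esub> C = \<one>\<^bsub>?U\<^esub>" using r_inv[OF B(1)] by blast
    have "A = C" using assoc[of A B C] B C one A by simp
    then show "\<exists>y\<in>carrier ?U. y \<otimes>\<^bsub>?U\<^esub> A = \<one>\<^bsub>?U\<^esub>" using B C by blast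
  qed (use cl assoc one in auto)
qed

locale unitri_ppow =
  fixes p e s :: nat
  assumes p: "1 < p" and e: "0 < e"
begin

abbreviation "U \<equiv> unitri s (p ^ e)"

lemma one_less_m: "1 < p ^ e"
  by (rule one_less_power[OF p e])

lemma one_less_m': "1 < int p ^ e" "0 < p"
  using one_less_power[of "int p" e] p e by simp_all

sublocale U: group U
  by (rule group_unitri[OF one_less_m])

text \<open>The divisor that weight \<open>k\<close> imposes on an entry of the \<open>d\<close>-th
  superdiagonal. The cap at \<open>e\<close> reflects that entries are residues modulo
  \<open>p ^ e\<close>; for \<open>d\<close> at least \<open>k\<close> the truncated difference is
  zero and there is no condition.\<close>

definition q :: "nat \<Rightarrow> nat \<Rightarrow> int" where
  "q k d = int p ^ min e (k - d)"

lemma q_dvd_m: "q k d dvd int (p ^ e)"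
  unfolding q_def by (simp add: le_imp_power_dvd)

lemma q_dvd_q: "k - d \<le> k' - d' \<Longrightarrow> q k d dvd q k' d'"
  unfolding q_def by (intro le_imp_power_dvd) auto

text \<open>Congruence modulo the weight filtration, tested on entries. Multiplying such a
  congruence by an inverse replaces any formula for the entries of inverses.\<close>

definition wcong :: "nat \<Rightarrow> mat \<Rightarrow> mat \<Rightarrow> bool" where
  "wcong k A B \<longleftrightarrow> (\<forall>i j. i < j \<longrightarrow> j \<le> s \<longrightarrow> q k (j - i) dvd A i j - B i j)"

lemma wcong_trans:
  assumes "wcong k A B" "wcong k B C"
  shows "wcong k A C"
  unfolding wcong_def
proof (intro allI impI)
  fix i j :: nat assume "i < j" "j \<le> s"
  then have "q k (j - i) dvd (A i j - B i j) + (B i j - C i j)"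
    using assms unfolding wcong_def by (intro dvd_add) auto
  then show "q k (j - i) dvd A i j - C i j" by simp
qed

lemma wcong_sym: "wcong k A B \<Longrightarrow> wcong k B A"
  unfolding wcong_def by (auto intro: dvd_diff_commute[THEN iffD1])

lemma q_dvd_mod_iff: "q k d dvd a mod int (p ^ e) - b \<longleftrightarrow> q k d dvd a - b"
  "q k d dvd b - a mod int (p ^ e) \<longleftrightarrow> q k d dvd b - a"
proof -
  obtain t where t: "a = a mod int (p ^ e) + q k d * t"
    using q_dvd_m[of k d] by (metis dvd_def mod_mult_div_eq mult.assoc)
  have e: "a - b = (a mod int (p ^ e) - b) + q k d * t" "b - a = (b - a mod int (p ^ e)) + q k d * (- t)"
    by (subst t, simp)+
  show "q k d dvd a mod int (p ^ e) - b \<longleftrightarrow> q k d dvd a - b"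
    "q k d dvd b - a mod int (p ^ e) \<longleftrightarrow> q k d dvd b - a"
    unfolding e by (simp_all only: dvd_add_left_iff[OF dvd_triv_left])
qed

lemma wcong_mult_right:
  assumes "A \<in> carrier U" "B \<in> carrier U" "C \<in> carrier U" "wcong k A B"
  shows "wcong k (A \<otimes>\<^bsub>U\<^esub> C) (B \<otimes>\<^bsub>U\<^esub> C)"
  unfolding wcong_def
proof (intro allI impI)
  fix i j :: nat assume ij: "i < j" "j \<le> s"
  have "q k (j - i) dvd (\<Sum>l\<in>{i<..<j}. (A i l - B i l) * C l j)"
  proof (intro dvd_sum dvd_mult2)
    fix l assume l: "l \<in> {i<..<j}"
    then have "q k (l - i) dvd A i l - B i l" using assms(4) ij unfolding wcong_def by simp
    moreover have "q k (j - i) dvd q k (l - i)" using l by (intro q_dvd_q) auto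
    ultimately show "q k (j - i) dvd A i l - B i l" using dvd_trans by blast
  qed
  moreover have "q k (j - i) dvd A i j - B i j" using assms(4) ij unfolding wcong_def by simp
  ultimately have "q k (j - i) dvd (A i j - B i j) + (\<Sum>l\<in>{i<..<j}. (A i l - B i l) * C l j)" by (rule dvd_add[rotated])
  moreover have "(A i j - B i j) + (\<Sum>l\<in>{i<..<j}. (A i l - B i l) * C l j)
      = (A i j + C i j + (\<Sum>l\<in>{i<..<j}. A i l * C l j)) - (B i j + C i j + (\<Sum>l\<in>{i<..<j}. B i l * C l j))"
    by (simp add: sum_subtractf left_diff_distrib)
  ultimately show "q k (j - i) dvd (A \<otimes>\<^bsub>U\<^esub> C) i j - (B \<otimes>\<^bsub>U\<^esub> C) i j"
    using assms ij by (simp only: unitri_mult_entry q_dvd_mod_iff)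
qed

text \<open>The weight filtration: an entry on the \<open>d\<close>-th superdiagonal has weight \<open>v + d\<close>, where
  \<open>v\<close> is its \<open>p\<close>-adic valuation.\<close>

definition F :: "nat \<Rightarrow> mat set" where
  "F k = {A \<in> carrier U. wcong k A \<one>\<^bsub>U\<^esub>}"

lemma F_carrier: "A \<in> F k \<Longrightarrow> A \<in> carrier U"
  unfolding F_def by simp

lemma F_entry: "A \<in> F k \<Longrightarrow> i < j \<Longrightarrow> j \<le> s \<Longrightarrow> q k (j - i) dvd A i j"
  unfolding F_def wcong_def by (auto simp: one_unitri)

lemma subgroup_F: "subgroup (F k) U"
proof (rule U.subgroupI)
  show "F k \<noteq> {}" unfolding F_def wcong_def by (auto intro!: exI[of _ "\<one>\<^bsub>U\<^esub>"])
  show "inv\<^bsub>U\<^esub> A \<in> F k" if "A \<in> F k" for A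
    using that wcong_mult_right[of A "\<one>\<^bsub>U\<^esub>" "inv\<^bsub>U\<^esub> A" k] wcong_sym unfolding F_def by auto
  show "A \<otimes>\<^bsub>U\<^esub> B \<in> F k" if "A \<in> F k" "B \<in> F k" for A B
    using that wcong_mult_right[of A "\<one>\<^bsub>U\<^esub>" B k] wcong_trans unfolding F_def by auto
qed (auto simp: F_def)

lemma F_1: "F 1 = carrier U"
  unfolding F_def wcong_def q_def by auto

text \<open>The terms linear in the entries of \<open>A\<close> and \<open>B\<close> cancel between
  the two products. In the others the entry of \<open>B\<close> lies on a strictly lower
  superdiagonal, where weight \<open>k\<close> is at least as strong as weight \<open>Suc k\<close>
  on the superdiagonal \<open>j - i\<close>.\<close>

lemma F_gcomm:
  assumes A: "A \<in> carrier U" and B: "B \<in> F k"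
  shows "gcomm U A B \<in> F (Suc k)"
proof -
  have Bc: "B \<in> carrier U" using B by (rule F_carrier)
  have "wcong (Suc k) (A \<otimes>\<^bsub>U\<^esub> B) (B \<otimes>\<^bsub>U\<^esub> A)"
    unfolding wcong_def
  proof (intro allI impI)
    fix i j :: nat assume ij: "i < j" "j \<le> s"
    have "q (Suc k) (j - i) dvd (\<Sum>l\<in>{i<..<j}. A i l * B l j - B i l * A l j)"
    proof (intro dvd_sum dvd_diff)
      fix l assume l: "l \<in> {i<..<j}"
      have "q k (j - l) dvd B l j" "q k (l - i) dvd B i l" using F_entry[OF B] l ij by auto
      moreover have "q (Suc k) (j - i) dvd q k (j - l)" "q (Suc k) (j - i) dvd q k (l - i)"
        using l by (auto intro!: q_dvd_q)
      ultimately show "q (Suc k) (j - i) dvd A i l * B l j" "q (Suc k) (j - i) dvd B i l * A l j"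
        by (metis dvd_trans dvd_mult dvd_mult2)+
    qed
    moreover have "(\<Sum>l\<in>{i<..<j}. A i l * B l j - B i l * A l j)
      = (A i j + B i j + (\<Sum>l\<in>{i<..<j}. A i l * B l j)) - (B i j + A i j + (\<Sum>l\<in>{i<..<j}. B i l * A l j))"
      by (simp add: sum_subtractf)
    ultimately show "q (Suc k) (j - i) dvd (A \<otimes>\<^bsub>U\<^esub> B) i j - (B \<otimes>\<^bsub>U\<^esub> A) i j"
      using A Bc ij by (simp only: unitri_mult_entry q_dvd_mod_iff)
  qed
  then have "wcong (Suc k) (A \<otimes>\<^bsub>U\<^esub> B \<otimes>\<^bsub>U\<^esub> inv\<^bsub>U\<^esub> (B \<otimes>\<^bsub>U\<^esub> A)) (B \<otimes>\<^bsub>U\<^esub> A \<otimes>\<^bsub>U\<^esub> inv\<^bsub>U\<^esub> (B \<otimes>\<^bsub>U\<^esub> A))"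
    using A Bc by (intro wcong_mult_right) auto
  moreover have "A \<otimes>\<^bsub>U\<^esub> B \<otimes>\<^bsub>U\<^esub> inv\<^bsub>U\<^esub> (B \<otimes>\<^bsub>U\<^esub> A) = gcomm U A B"
    unfolding gcomm_def using A Bc by (simp add: U.inv_mult_group U.m_assoc)
  ultimately show ?thesis
    unfolding F_def using A Bc by (simp add: gcomm_def)
qed

text \<open>Modulo weight \<open>Suc k\<close> the entries of the \<open>t\<close>-th power are
  \<open>t\<close> times those of \<open>A\<close>, since intermediate products again involve lower
  superdiagonals. For \<open>t = p\<close> the factor \<open>p\<close> supplies the missing
  step.\<close>

lemma F_pow:
  assumes A: "A \<in> F k"
  shows "A [^]\<^bsub>U\<^esub> p \<in> F (Suc k)"
proof -
  have Ac: "A \<in> carrier U" using A by (rule F_carrier)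
  have *: "q (Suc k) (j - i) dvd (A [^]\<^bsub>U\<^esub> t) i j - int t * A i j" if ij: "i < j" "j \<le> s" for t i j
    using ij
  proof (induction t)
    case 0
    then show ?case by (simp add: one_unitri)
  next
    case (Suc t)
    have "q (Suc k) (j - i) dvd (\<Sum>l\<in>{i<..<j}. (A [^]\<^bsub>U\<^esub> t) i l * A l j)"
    proof (intro dvd_sum dvd_mult)
      fix l assume l: "l \<in> {i<..<j}"
      have "q k (j - l) dvd A l j" using F_entry[OF A] l ij by auto
      moreover have "q (Suc k) (j - i) dvd q k (j - l)" using l by (intro q_dvd_q) auto
      ultimately show "q (Suc k) (j - i) dvd A l j" using dvd_trans by blast
    qed
    with Suc have "q (Suc k) (j - i) dvd ((A [^]\<^bsub>U\<^esub> t) i j - int t * A i j) + (\<Sum>l\<in>{i<..<j}. (A [^]\<^bsub>U\<^esub> t) i l * A l j)"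
      by (intro dvd_add) auto
    moreover have "((A [^]\<^bsub>U\<^esub> t) i j - int t * A i j) + (\<Sum>l\<in>{i<..<j}. (A [^]\<^bsub>U\<^esub> t) i l * A l j)
        = ((A [^]\<^bsub>U\<^esub> t) i j + A i j + (\<Sum>l\<in>{i<..<j}. (A [^]\<^bsub>U\<^esub> t) i l * A l j)) - int (Suc t) * A i j"
      by (simp add: algebra_simps)
    ultimately show ?case
      using Ac Suc.prems by (simp only: U.nat_pow_Suc unitri_mult_entry U.nat_pow_closed q_dvd_mod_iff)
  qed
  have "q (Suc k) (j - i) dvd (A [^]\<^bsub>U\<^esub> p) i j" if ij: "i < j" "j \<le> s" for i j
  proof -
    have "int p * q k (j - i) dvd int p * A i j" using F_entry[OF A ij] by simp
    moreover have "q (Suc k) (j - i) dvd int p * q k (j - i)"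
      unfolding q_def power_Suc[symmetric] by (intro le_imp_power_dvd) auto
    ultimately have "q (Suc k) (j - i) dvd int p * A i j" using dvd_trans by blast
    then show ?thesis using *[OF ij, of p] by (metis diff_add_cancel dvd_add)
  qed
  then show ?thesis
    unfolding F_def wcong_def using Ac by (auto simp: one_unitri)
qed

definition zmat :: "int \<Rightarrow> mat" where
  "zmat c = (\<lambda>i j. if i = j \<and> i \<le> s then 1 else if i = 0 \<and> j = s then c else 0)"

lemma zmat_carrier: "0 < s \<Longrightarrow> 0 \<le> c \<Longrightarrow> c < int (p ^ e) \<Longrightarrow> zmat c \<in> carrier U"
  using one_less_m' by (auto simp: carrier_unitri zmat_def)

lemma zmat_mult:
  assumes "0 < s" "0 \<le> c" "c < int (p ^ e)" "A \<in> carrier U"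
  shows "(zmat c \<otimes>\<^bsub>U\<^esub> A) i j = (if i = 0 \<and> j = s then (A i j + c) mod int (p ^ e) else A i j)"
    "(A \<otimes>\<^bsub>U\<^esub> zmat c) i j = (if i = 0 \<and> j = s then (A i j + c) mod int (p ^ e) else A i j)"
proof -
  have z: "zmat c \<in> carrier U" using zmat_carrier assms by blast
  note en = unitri_entries[OF U.m_closed[OF z assms(4)]] unitri_entries[OF U.m_closed[OF assms(4) z]] unitri_entries[OF assms(4)]
  have 0: "(\<Sum>k\<in>{i<..<j}. zmat c i k * A k j) = 0" "(\<Sum>k\<in>{i<..<j}. A i k * zmat c k j) = 0" if "j \<le> s"
    using that by (auto intro!: sum.neutral simp: zmat_def)
  consider "i < j" "j \<le> s" | "s < j" | "j < i" | "i = j" by linarith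
  then have "(zmat c \<otimes>\<^bsub>U\<^esub> A) i j = (if i = 0 \<and> j = s then (A i j + c) mod int (p ^ e) else A i j) \<and>
    (A \<otimes>\<^bsub>U\<^esub> zmat c) i j = (if i = 0 \<and> j = s then (A i j + c) mod int (p ^ e) else A i j)"
  proof cases
    case 1
    then show ?thesis
      using unitri_mult_entry[OF z assms(4) 1] unitri_mult_entry[OF assms(4) z 1] 0 en(12)[OF 1]
      by (auto simp: zmat_def add.commute)
  qed (use assms(1) en in auto)
  then show "(zmat c \<otimes>\<^bsub>U\<^esub> A) i j = (if i = 0 \<and> j = s then (A i j + c) mod int (p ^ e) else A i j)"
    "(A \<otimes>\<^bsub>U\<^esub> zmat c) i j = (if i = 0 \<and> j = s then (A i j + c) mod int (p ^ e) else A i j)" by auto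
qed

lemma zmat_pow:
  assumes "0 < s" "0 \<le> c" "c < int (p ^ e)"
  shows "zmat c [^]\<^bsub>U\<^esub> k = zmat (int k * c mod int (p ^ e))"
proof (induction k)
  case 0
  then show ?case by (auto simp: zmat_def fun_eq_iff one_unitri)
next
  case (Suc k)
  let ?d = "int k * c mod int (p ^ e)"
  have "0 < int (p ^ e)" using one_less_m by linarith
  then have d: "0 \<le> ?d" "?d < int (p ^ e)" by simp_all
  have *: "((c + int k * c mod int (p ^ e)) mod int (p ^ e)) = int (Suc k) * c mod int (p ^ e)"
    by (simp add: mod_add_right_eq algebra_simps)
  have "zmat ?d \<otimes>\<^bsub>U\<^esub> zmat c = zmat (int (Suc k) * c mod int (p ^ e))"
  proof (intro ext)
    fix i j
    have "zmat ?d 0 s = ?d" using assms(1) by (simp add: zmat_def)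
    then show "(zmat ?d \<otimes>\<^bsub>U\<^esub> zmat c) i j = zmat (int (Suc k) * c mod int (p ^ e)) i j"
      unfolding zmat_mult(2)[OF assms zmat_carrier[OF assms(1) d]]
      using * assms(1) by (simp add: zmat_def add.commute)
  qed
  then show ?case by (simp only: U.nat_pow_Suc Suc)
qed

text \<open>The Magnus representation cut down to one word: \<open>x\<close> acts by ones above the
  diagonal at the positions where \<open>w\<close> reads \<open>x\<close>. Beyond index
  \<open>length w\<close> it is the identity, so \<open>w\<close> may be shorter than
  \<open>s\<close>.\<close>

definition letter_mat :: "'c list \<Rightarrow> 'c \<Rightarrow> mat" where
  "letter_mat w x = (\<lambda>i j. if i = j \<and> i \<le> s then 1
     else if j = Suc i \<and> i < length w \<and> w ! i = x then 1 else 0)"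

lemma letter_mat_carrier: "length w \<le> s \<Longrightarrow> letter_mat w x \<in> carrier U"
  using one_less_m' by (auto simp: carrier_unitri letter_mat_def)

lemma letter_mat_one: "x \<notin> set w \<Longrightarrow> letter_mat w x = \<one>\<^bsub>U\<^esub>"
  by (auto simp: letter_mat_def fun_eq_iff one_unitri)

lemma letter_mat_mult_entry:
  assumes "length w \<le> s" "A \<in> carrier U" "i < j" "j \<le> length w"
  shows "(letter_mat w x \<otimes>\<^bsub>U\<^esub> A) i j = (A i j + (if w ! i = x then A (Suc i) j else 0)) mod int (p ^ e)"
proof -
  have "(\<Sum>k\<le>s. letter_mat w x i k * A k j) = (\<Sum>k\<in>{i, Suc i}. letter_mat w x i k * A k j)"
    using assms by (intro sum.mono_neutral_right) (auto simp: letter_mat_def)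
  also have "\<dots> = A i j + (if w ! i = x then A (Suc i) j else 0)"
    using assms by (auto simp: letter_mat_def)
  finally show ?thesis using assms by (simp add: mult_unitri)
qed

text \<open>Multiplying by the matrix of a letter adds row \<open>Suc i\<close> to row
  \<open>i\<close> when \<open>w ! i\<close> is that letter, which is the recursion of
  \<open>binom\<close> for the segment of \<open>w\<close> from \<open>i\<close> to
  \<open>j\<close>.\<close>

lemma eval_letter_mat:
  assumes "length w \<le> s" "i \<le> j" "j \<le> length w"
  shows "U.eval_word (letter_mat w) f i j = int (binom f (take (j - i) (drop i w))) mod int (p ^ e)"
  using assms(2,3)
proof (induction f arbitrary: i)
  case Nil
  show ?case
  proof (cases "i = j")
    case True
    then show ?thesis using Nil assms(1) one_less_m' by (simp add: one_unitri)
  next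
    case False
    then have "take (j - i) (drop i w) = w ! i # take (j - Suc i) (drop (Suc i) w)"
      using Nil by (metis Cons_nth_drop_Suc Suc_diff_Suc le_neq_implies_less less_le_trans take_Suc_Cons)
    then show ?thesis using False Nil assms(1) by (simp add: one_unitri)
  qed
next
  case (Cons x f)
  have A: "U.eval_word (letter_mat w) f \<in> carrier U"
    using letter_mat_carrier[OF assms(1)] by (intro U.eval_word_closed[OF U.subgroup_self]) auto
  show ?case
  proof (cases "i = j")
    case True
    have "U.eval_word (letter_mat w) (x # f) \<in> carrier U"
      using letter_mat_carrier[OF assms(1)] by (intro U.eval_word_closed[OF U.subgroup_self]) auto
    then have "U.eval_word (letter_mat w) (x # f) i i = 1" using unitri_entries(1) Cons.prems assms(1) True by fastforce
    then show ?thesis using True one_less_m' by simp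
  next
    case False
    then have ij: "i < j" using Cons.prems by simp
    then have v: "take (j - i) (drop i w) = w ! i # take (j - Suc i) (drop (Suc i) w)"
      using Cons.prems by (metis Cons_nth_drop_Suc Suc_diff_Suc less_le_trans take_Suc_Cons)
    show ?thesis
      using letter_mat_mult_entry[OF assms(1) A ij Cons.prems(2), of x] Cons.IH[of i] Cons.IH[of "Suc i"] ij Cons.prems
      by (auto simp: v mod_simps)
  qed
qed

end

section \<open>Positive words and homomorphisms on free profinite groups\<close>

lemma (in group) finite_submonoid_subgroup:
  assumes "finite H" "H \<subseteq> carrier G" "\<one> \<in> H" "\<And>x y. x \<in> H \<Longrightarrow> y \<in> H \<Longrightarrow> x \<otimes> y \<in> H"
  shows "subgroup H G"
proof (rule subgroupI)
  fix x assume x: "x \<in> H"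
  have "inj_on (\<lambda>y. x \<otimes> y) H" using assms(2) x by (auto simp: inj_on_def subset_iff)
  then have "(\<lambda>y. x \<otimes> y) ` H = H" using assms(1,4) x by (intro endo_inj_surj) auto
  then obtain y where "y \<in> H" "x \<otimes> y = \<one>" using assms(3) by (metis imageE)
  then show "inv x \<in> H" using assms(2) x by (metis inv_unique' subsetD inv_comm)
qed (use assms in auto)

lemma (in monoid) eval_word_in_carrier: "set f \<subseteq> carrier G \<Longrightarrow> eval_word (\<lambda>x. x) f \<in> carrier G"
  by (induction f) auto

lemma (in monoid) eval_word_append:
  "g ` set f \<subseteq> carrier G \<Longrightarrow> g ` set f' \<subseteq> carrier G \<Longrightarrow> eval_word g (f @ f') = eval_word g f \<otimes> eval_word g f'"
proof (induction f)
  have cl: "g ` set u \<subseteq> carrier G \<Longrightarrow> eval_word g u \<in> carrier G" for u by (induction u) auto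
  case Nil
  then show ?case using cl by simp
next
  have cl: "g ` set u \<subseteq> carrier G \<Longrightarrow> eval_word g u \<in> carrier G" for u by (induction u) auto
  case (Cons c f)
  then show ?case using cl[of f] cl[of f'] by (simp add: m_assoc)
qed

lemma (in monoid) eval_word_filter:
  "(\<And>x. x \<in> set f \<Longrightarrow> x \<notin> X \<Longrightarrow> g x = \<one>) \<Longrightarrow> g ` set f \<subseteq> carrier G
    \<Longrightarrow> eval_word g (filter (\<lambda>x. x \<in> X) f) = eval_word g f"
proof (induction f)
  have cl: "g ` set u \<subseteq> carrier G \<Longrightarrow> eval_word g u \<in> carrier G" for u by (induction u) auto
  case (Cons c f)
  then show ?case using cl[of f] by auto
qed simp

text \<open>The condition inside \<open>free_profinite_group\<close>, with the basis as a
  parameter.\<close>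

definition profinite_basis :: "('a, 'b) monoid_scheme \<Rightarrow> 'a topology \<Rightarrow> 'a set \<Rightarrow> bool" where
  "profinite_basis S T B \<longleftrightarrow> B \<subseteq> carrier S \<and>
     (\<forall>V. openin T V \<and> \<one>\<^bsub>S\<^esub> \<in> V \<longrightarrow> finite (B - V)) \<and>
     closed_subgroup_gen S T B = carrier S \<and>
     (\<forall>P f. group (P :: nat monoid) \<and> finite (carrier P) \<and> f \<in> (B \<rightarrow> carrier P)
            \<and> finite {x \<in> B. f x \<noteq> \<one>\<^bsub>P\<^esub>}
            \<longrightarrow> (\<exists>h \<in> cont_hom_fin S T P. \<forall>x\<in>B. h x = f x))"

text \<open>The universal property speaks of groups of naturals; any finite target is transported
  along an injection into the naturals and back.\<close>

lemma profinite_basis_extend: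
  assumes B: "profinite_basis S T B" and P: "group (P :: ('c, 'd) monoid_scheme)" "finite (carrier P)"
    and f: "\<And>x. x \<in> B \<Longrightarrow> f x \<in> carrier P" "finite {x \<in> B. f x \<noteq> \<one>\<^bsub>P\<^esub>}"
  shows "\<exists>h\<in>cont_hom_fin S T P. \<forall>x\<in>B. h x = f x"
proof -
  interpret P: group P by (rule P)
  obtain e :: "'c \<Rightarrow> nat" where e: "inj_on e (carrier P)"
    using P(2) finite_imp_inj_to_nat_seg by metis
  define d where "d = the_inv_into (carrier P) e"
  have de: "d (e x) = x" if "x \<in> carrier P" for x
    unfolding d_def using that e by (simp add: the_inv_into_f_f)
  define P' where "P' = \<lparr>carrier = e ` carrier P, mult = (\<lambda>a b. e (d a \<otimes>\<^bsub>P\<^esub> d b)), one = e \<one>\<^bsub>P\<^esub>\<rparr>"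
  have "group P'"
  proof (rule groupI)
    show "\<exists>y\<in>carrier P'. y \<otimes>\<^bsub>P'\<^esub> x = \<one>\<^bsub>P'\<^esub>" if "x \<in> carrier P'" for x
      using that by (auto simp: P'_def de intro!: bexI[of _ "inv\<^bsub>P\<^esub> (d x)"])
  qed (auto simp: P'_def de P.m_assoc)
  moreover have "finite (carrier P')" unfolding P'_def using P(2) by simp
  moreover have "e \<circ> f \<in> B \<rightarrow> carrier P'" using f(1) by (auto simp: P'_def)
  moreover have "{x \<in> B. (e \<circ> f) x \<noteq> \<one>\<^bsub>P'\<^esub>} \<subseteq> {x \<in> B. f x \<noteq> \<one>\<^bsub>P\<^esub>}" by (auto simp: P'_def)
  then have "finite {x \<in> B. (e \<circ> f) x \<noteq> \<one>\<^bsub>P'\<^esub>}" using f(2) finite_subset by blast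
  ultimately obtain h where h: "h \<in> cont_hom_fin S T P'" "\<forall>x\<in>B. h x = (e \<circ> f) x"
    using B unfolding profinite_basis_def by blast
  have "d \<circ> h \<in> hom S P"
  proof (rule homI)
    have hc: "d (h x) \<in> carrier P" if "x \<in> carrier S" for x
    proof -
      have "h x \<in> e ` carrier P" using h(1) that unfolding cont_hom_fin_def hom_def P'_def by auto
      then show ?thesis using de by auto
    qed
    show "(d \<circ> h) x \<in> carrier P" if "x \<in> carrier S" for x using hc[OF that] by simp
    show "(d \<circ> h) (x \<otimes>\<^bsub>S\<^esub> y) = (d \<circ> h) x \<otimes>\<^bsub>P\<^esub> (d \<circ> h) y" if "x \<in> carrier S" "y \<in> carrier S" for x y
    proof -
      have "h (x \<otimes>\<^bsub>S\<^esub> y) = h x \<otimes>\<^bsub>P'\<^esub> h y"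
        using h(1) that unfolding cont_hom_fin_def by (auto simp: hom_mult)
      then show ?thesis using hc that by (simp add: P'_def de)
    qed
  qed
  moreover have "continuous_map T (discrete_topology (carrier P)) (d \<circ> h)"
    using h(1) unfolding cont_hom_fin_def
    by (auto intro!: continuous_map_compose[of T "discrete_topology (carrier P')"] continuous_map_from_discrete
        simp: P'_def de)
  moreover have "(d \<circ> h) x = f x" if "x \<in> B" for x
    using that h(2) f(1) de by simp
  ultimately show ?thesis unfolding cont_hom_fin_def by blast
qed

lemma (in top_group) cont_hom_fin_iff:
  "h \<in> cont_hom_fin G T P \<longleftrightarrow> h \<in> hom G P \<and> (\<forall>d. openin T {x \<in> carrier G. h x = d})"
  unfolding cont_hom_fin_def continuous_map_discrete_iff topspace by (auto simp: hom_def)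

lemma (in top_group) cont_hom_fin_closed_preimage:
  assumes "h \<in> cont_hom_fin G T P" "subgroup H P" "group P"
  shows "subgroup {x \<in> carrier G. h x \<in> H} G" "closedin T {x \<in> carrier G. h x \<in> H}"
proof -
  interpret h: group_hom G P h
    using assms unfolding cont_hom_fin_def by (intro group_hom.intro group_hom_axioms.intro is_group) auto
  show "subgroup {x \<in> carrier G. h x \<in> H} G"
    using subgroup.m_closed[OF assms(2)] subgroup.m_inv_closed[OF assms(2)] subgroup.one_closed[OF assms(2)]
    by (intro subgroupI) (auto intro!: exI[of _ \<one>])
  show "closedin T {x \<in> carrier G. h x \<in> H}"
    using assms closedin_continuous_map_preimage[of T "discrete_topology (carrier P)" h H] subgroup.subset[OF assms(2)]
    unfolding cont_hom_fin_def by auto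
qed

text \<open>Words without inverses are enough: their images form a submonoid of a finite group,
  hence a subgroup, whose preimage is closed and contains \<open>B\<close>.\<close>

lemma (in top_group) dense_words:
  assumes B: "closed_subgroup_gen G T B = carrier G" "B \<subseteq> carrier G"
    and h: "h \<in> cont_hom_fin G T P" and P: "group P" "finite (carrier P)" and g: "g \<in> carrier G"
  shows "\<exists>f. set f \<subseteq> B \<and> h (eval_word (\<lambda>x. x) f) = h g"
proof -
  interpret h: group_hom G P h
    using h P unfolding cont_hom_fin_def by (intro group_hom.intro group_hom_axioms.intro is_group) auto
  define M where "M = {h.H.eval_word h f | f. set f \<subseteq> B}"
  have Mc: "h.H.eval_word h f \<in> carrier P" if "set f \<subseteq> B" for f
    using that B(2) by (intro h.H.eval_word_closed[OF h.H.subgroup_self]) auto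
  have "subgroup M P"
  proof (rule h.H.finite_submonoid_subgroup)
    show "M \<subseteq> carrier P" unfolding M_def using Mc by auto
    then show "finite M" using P(2) finite_subset by blast
    show "\<one>\<^bsub>P\<^esub> \<in> M" unfolding M_def by (auto intro!: exI[of _ "[]"])
    show "x \<otimes>\<^bsub>P\<^esub> y \<in> M" if xy: "x \<in> M" "y \<in> M" for x y
    proof -
      obtain f f' where f: "set f \<subseteq> B" "set f' \<subseteq> B" "x = h.H.eval_word h f" "y = h.H.eval_word h f'"
        using xy unfolding M_def by blast
      moreover have "h.H.eval_word h (f @ f') = h.H.eval_word h f \<otimes>\<^bsub>P\<^esub> h.H.eval_word h f'"
        using f B(2) by (intro h.H.eval_word_append) auto
      ultimately show ?thesis unfolding M_def by (auto intro!: exI[of _ "f @ f'"])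
    qed
  qed
  note pre = cont_hom_fin_closed_preimage[OF h this P(1)]
  have "B \<subseteq> {x \<in> carrier G. h x \<in> M}"
  proof
    fix x assume x: "x \<in> B"
    then have "h x = h.H.eval_word h [x]" using B(2) by auto
    then show "x \<in> {x \<in> carrier G. h x \<in> M}" unfolding M_def using x B(2) by (auto intro!: exI[of _ "[x]"])
  qed
  then have "g \<in> {x \<in> carrier G. h x \<in> M}" using closed_subgroup_gen_le[OF pre] B g by auto
  then obtain f where "set f \<subseteq> B" "h g = h.H.eval_word h f" unfolding M_def by auto
  moreover have "h (eval_word (\<lambda>x. x) f) = h.H.eval_word (h \<circ> (\<lambda>x. x)) f"
    using calculation B(2) by (intro h.hom_eval_word) auto
  ultimately show ?thesis by (auto simp: o_def)
qed

text \<open>A constant, because the simplifier would rewrite \<open>p ^ (n - s + 1)\<close> inside \<open>unitri\<close>.\<close>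

definition expo :: "nat \<Rightarrow> nat \<Rightarrow> nat" where
  "expo n s = n - s + 1"

section \<open>The groups U_{n,s}, their central subgroup of order p and the quotient by it\<close>

locale unm =
  fixes p n s :: nat
  assumes prime: "prime p" and s: "0 < s" "s \<le> n"
begin

sublocale unitri_ppow p "expo n s" s
  using prime_gt_1_nat[OF prime] by unfold_locales (auto simp: expo_def)

lemma Unm_eq: "Unm p n s = U"
  by (simp add: Unm_def expo_def)

lemma zel_eq: "zel p n s = zmat (int (p ^ (n - s)))"
  unfolding zel_def zmat_def ..

lemma zel_bounds: "0 \<le> int (p ^ (n - s))" "int (p ^ (n - s)) < int (p ^ (expo n s))"
proof -
  have "p ^ (n - s) < p ^ (expo n s)" unfolding expo_def using p by (intro power_strict_increasing) auto
  then show "int (p ^ (n - s)) < int (p ^ (expo n s))" by linarith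
qed simp

lemma zel_carrier: "zel p n s \<in> carrier U"
  unfolding zel_eq using zmat_carrier s zel_bounds by blast

lemma zel_pow: "zel p n s [^]\<^bsub>U\<^esub> k = zmat (int (k mod p) * int (p ^ (n - s)))"
proof -
  have "int k * int (p ^ (n - s)) mod int (p ^ (expo n s)) = int ((k * p ^ (n - s)) mod (p * p ^ (n - s)))"
    by (simp add: zmod_int expo_def)
  also have "(k * p ^ (n - s)) mod (p * p ^ (n - s)) = (k mod p) * p ^ (n - s)"
    by (simp add: mult_mod_left)
  finally have *: "int k * int (p ^ (n - s)) mod int (p ^ (expo n s)) = int ((k mod p) * p ^ (n - s))" .
  show ?thesis unfolding zel_eq zmat_pow[OF s(1) zel_bounds] * by (simp only: of_nat_mult)
qed

lemma zel_pow_eq_iff: "zel p n s [^]\<^bsub>U\<^esub> k = zel p n s [^]\<^bsub>U\<^esub> l \<longleftrightarrow> k mod p = l mod p"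
proof
  assume "zel p n s [^]\<^bsub>U\<^esub> k = zel p n s [^]\<^bsub>U\<^esub> l"
  then have "zmat (int (k mod p) * int (p ^ (n - s))) 0 s = zmat (int (l mod p) * int (p ^ (n - s))) 0 s"
    by (simp only: zel_pow)
  then show "k mod p = l mod p" using s p by (auto simp: zmat_def)
qed (simp add: zel_pow)

lemma zel_pow_mod: "zel p n s [^]\<^bsub>U\<^esub> (k mod p) = zel p n s [^]\<^bsub>U\<^esub> k"
  by (simp add: zel_pow_eq_iff)

lemma zel_pow_central:
  assumes "A \<in> carrier U"
  shows "zel p n s [^]\<^bsub>U\<^esub> k \<otimes>\<^bsub>U\<^esub> A = A \<otimes>\<^bsub>U\<^esub> zel p n s [^]\<^bsub>U\<^esub> (k::nat)"
proof -
  have "zel p n s \<otimes>\<^bsub>U\<^esub> A = A \<otimes>\<^bsub>U\<^esub> zel p n s"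
    unfolding zel_eq using zmat_mult[OF s(1) zel_bounds assms] by (intro ext) simp
  then show ?thesis
    using assms zel_carrier by (induction k) (auto intro!: U.mult_commute_closed)
qed

text \<open>Off the corner the superdiagonal is below \<open>s\<close>, so weight \<open>n\<close>
  demands divisibility by the full modulus \<open>p ^ (n - s + 1)\<close> and the entry is zero. The
  corner only has to be divisible by \<open>p ^ (n - s)\<close>, which leaves the powers of
  \<open>zel\<close>.\<close>

lemma F_n: "F n = {zel p n s [^]\<^bsub>U\<^esub> k | k. k < p}"
proof (intro equalityI subsetI)
  fix A assume A: "A \<in> F n"
  have Ac: "A \<in> carrier U" using A by (rule F_carrier)
  have z: "A i j = 0" if ij: "i < j" "j \<le> s" "\<not> (i = 0 \<and> j = s)" for i j
  proof -
    have "expo n s \<le> n - (j - i)" using ij s by (auto simp: expo_def)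
    then have "q n (j - i) = int (p ^ (expo n s))" unfolding q_def by (simp add: min_absorb1)
    then have "A i j mod int (p ^ (expo n s)) = 0" using F_entry[OF A ij(1,2)] by simp
    then show ?thesis using unitri_entries(4)[OF Ac ij(1,2)] by simp
  qed
  have "q n s = int (p ^ (n - s))" unfolding q_def by (simp add: expo_def min_absorb2)
  then have "int (p ^ (n - s)) dvd A 0 s" using F_entry[OF A, of 0 s] s by simp
  then obtain t where t: "A 0 s = int (p ^ (n - s)) * t" by blast
  have b: "0 \<le> A 0 s" "A 0 s < int (p ^ (expo n s))" using unitri_entries(4)[OF Ac, of 0 s] s by auto
  have pos: "0 < int (p ^ (n - s))" using p by simp
  have "0 \<le> t" using b(1) pos unfolding t zero_le_mult_iff by linarith
  moreover have "int (p ^ (n - s)) * t < int (p ^ (n - s)) * int p" using b(2) unfolding t expo_def by (simp add: mult.commute)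
  then have "t < int p" using pos by (simp only: mult_less_cancel_left_pos)
  ultimately have t': "t = int (nat t mod p)" "nat t < p" by auto
  have "A = zmat (int (nat t mod p) * int (p ^ (n - s)))"
  proof (intro ext)
    fix i j
    consider "i < j" "j \<le> s" "\<not> (i = 0 \<and> j = s)" | "i = 0" "j = s" | "s < j" | "j < i" | "i = j" "0 < i \<or> j < s" by linarith
    then show "A i j = zmat (int (nat t mod p) * int (p ^ (n - s))) i j"
    proof cases
      case 2
      then show ?thesis using t t' s by (simp add: zmat_def mult.commute)
    qed (use z unitri_entries[OF Ac] s in \<open>auto simp: zmat_def\<close>)
  qed
  then have "A = zel p n s [^]\<^bsub>U\<^esub> nat t" by (simp only: zel_pow)
  then show "A \<in> {zel p n s [^]\<^bsub>U\<^esub> k | k. k < p}" using t'(2) by blast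
next
  have "zel p n s \<in> F n"
    unfolding F_def wcong_def
  proof (intro CollectI conjI allI impI zel_carrier)
    fix i j assume "i < j" "j \<le> s"
    then show "q n (j - i) dvd zel p n s i j - \<one>\<^bsub>U\<^esub> i j"
      by (auto simp: zel_eq zmat_def one_unitri q_def intro!: le_imp_power_dvd)
  qed
  then show "A \<in> F n" if "A \<in> {zel p n s [^]\<^bsub>U\<^esub> k | k. k < p}" for A
    using that U.nat_pow_in_subgroup[OF subgroup_F] by auto
qed

text \<open>One weight further the corner too must be divisible by the modulus. Hence homomorphisms
  into these groups kill the term of index \<open>Suc n\<close>.\<close>

lemma F_Suc_n: "F (Suc n) = {\<one>\<^bsub>U\<^esub>}"
proof (intro equalityI subsetI)
  fix A assume A: "A \<in> F (Suc n)"
  have Ac: "A \<in> carrier U" using A by (rule F_carrier)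
  have "int (p ^ (expo n s)) dvd A i j - \<one>\<^bsub>U\<^esub> i j" if ij: "i < j" "j \<le> s" for i j
  proof -
    have "expo n s \<le> Suc n - (j - i)" using ij s by (auto simp: expo_def)
    then have "q (Suc n) (j - i) = int (p ^ (expo n s))" unfolding q_def by (simp add: min_absorb1)
    then show ?thesis using F_entry[OF A ij] ij by (simp add: one_unitri)
  qed
  then show "A \<in> {\<one>\<^bsub>U\<^esub>}" using unitri_eqI[OF Ac U.one_closed] by blast
qed (use subgroup.one_closed[OF subgroup_F] in auto)

lemma generate_zel: "generate U {zel p n s} = F n"
proof (intro equalityI)
  have "zel p n s [^]\<^bsub>U\<^esub> (1::nat) = zel p n s" using zel_carrier by simp
  then have "zel p n s \<in> F n" unfolding F_n using prime_gt_1_nat[OF prime] by (metis (mono_tags, lifting) mem_Collect_eq)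
  then show "generate U {zel p n s} \<subseteq> F n" using U.generate_subgroup_incl[OF _ subgroup_F] by simp
  have "zel p n s [^]\<^bsub>U\<^esub> k \<in> generate U {zel p n s}" for k :: nat
    using zel_carrier by (intro U.nat_pow_in_subgroup U.generate_is_subgroup generate.incl) auto
  then show "F n \<subseteq> generate U {zel p n s}" unfolding F_n by auto
qed

lemma F_normal: "F k \<lhd> U"
proof -
  have "A \<otimes>\<^bsub>U\<^esub> B \<otimes>\<^bsub>U\<^esub> inv\<^bsub>U\<^esub> A \<in> F k" if "A \<in> carrier U" "B \<in> F k" for A B
  proof -
    have "wcong k (gcomm U A B) \<one>\<^bsub>U\<^esub>"
    proof -
      have "wcong (Suc k) (gcomm U A B) \<one>\<^bsub>U\<^esub>" using F_gcomm[OF that] unfolding F_def by simp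
      moreover have "q k d dvd q (Suc k) d" for d by (rule q_dvd_q) simp
      ultimately show ?thesis unfolding wcong_def using dvd_trans by blast
    qed
    then have "gcomm U A B \<in> F k" using F_carrier[OF F_gcomm[OF that]] unfolding F_def by simp
    moreover have "A \<otimes>\<^bsub>U\<^esub> B \<otimes>\<^bsub>U\<^esub> inv\<^bsub>U\<^esub> A = gcomm U A B \<otimes>\<^bsub>U\<^esub> B"
      using that F_carrier unfolding gcomm_def by (simp add: U.m_assoc)
    ultimately show ?thesis using that subgroup.m_closed[OF subgroup_F] by metis
  qed
  then show ?thesis using U.normal_inv_iff subgroup_F by blast
qed

lemma Ubar_eq: "Ubar p n s = U Mod F n"
  unfolding Ubar_def Unm_eq generate_zel ..

sublocale Fn: normal "F n" U by (rule F_normal)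

lemma group_Ubar: "group (Ubar p n s)"
  unfolding Ubar_eq by (rule Fn.factorgroup_is_group)

lemma hom_Unm_lpc:
  assumes "top_group G T" "h \<in> cont_hom_fin G T (Unm p n s)" "0 < k"
  shows "h ` lpc G T p k \<subseteq> F k"
proof -
  interpret top_group G T by (rule assms)
  have h: "h \<in> hom G U" "continuous_map T (discrete_topology (carrier U)) h"
    using assms(2) unfolding cont_hom_fin_def Unm_eq by auto
  show ?thesis
  proof (rule lpc_image_subset[OF h U.is_group])
    show "closedin (discrete_topology (carrier U)) (F k)" for k using F_carrier by auto
    show "h ` carrier G \<subseteq> F 1" using h(1) unfolding F_1 hom_def by auto
  qed (use subgroup_F F_gcomm F_pow assms(3) in auto)
qed

text \<open>The images of the \<open>F k\<close> in the quotient are again stable under commutators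
  and p-th powers, and the \<open>n\<close>-th image is trivial.\<close>

lemma hom_Ubar_lpc:
  assumes "top_group G T" "h \<in> cont_hom_fin G T (Ubar p n s)" "0 < n"
  shows "h ` lpc G T p n \<subseteq> {\<one>\<^bsub>Ubar p n s\<^esub>}"
proof -
  interpret top_group G T by (rule assms)
  have h: "h \<in> hom G (U Mod F n)" "continuous_map T (discrete_topology (carrier (U Mod F n))) h"
    using assms(2) unfolding cont_hom_fin_def Ubar_eq by auto
  let ?\<pi> = "\<lambda>x. F n #>\<^bsub>U\<^esub> x"
  interpret \<pi>: group_hom U "U Mod F n" ?\<pi>
    by (intro group_hom.intro group_hom_axioms.intro U.is_group Fn.factorgroup_is_group Fn.r_coset_hom_Mod)
  have "h ` lpc G T p n \<subseteq> ?\<pi> ` F n"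
  proof (rule lpc_image_subset[OF h Fn.factorgroup_is_group, where F = "\<lambda>k. ?\<pi> ` F k"])
    show "subgroup (?\<pi> ` F k) (U Mod F n)" for k by (rule \<pi>.subgroup_img_is_subgroup[OF subgroup_F])
    show "closedin (discrete_topology (carrier (U Mod F n))) (?\<pi> ` F k)" for k
      using F_carrier \<pi>.hom_closed by auto
    show "h ` carrier G \<subseteq> ?\<pi> ` F 1" using h(1) unfolding F_1 hom_def carrier_FactGroup by auto
    show "gcomm (U Mod F n) x y \<in> ?\<pi> ` F (Suc k)" if xy: "x \<in> carrier (U Mod F n)" "y \<in> ?\<pi> ` F k" for k x y
    proof -
      obtain A B where AB: "A \<in> carrier U" "x = ?\<pi> A" "B \<in> F k" "y = ?\<pi> B"
        using xy unfolding carrier_FactGroup by auto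
      then have "gcomm (U Mod F n) x y = ?\<pi> (gcomm U A B)"
        using F_carrier[OF AB(3)] unfolding gcomm_def by (simp only: \<pi>.hom_mult \<pi>.hom_inv U.m_closed U.inv_closed)
      then show ?thesis using F_gcomm[OF AB(1,3)] by blast
    qed
    show "x [^]\<^bsub>U Mod F n\<^esub> p \<in> ?\<pi> ` F (Suc k)" if x: "x \<in> ?\<pi> ` F k" for k x
    proof -
      obtain A where A: "A \<in> F k" "x = ?\<pi> A" using x by auto
      then have "x [^]\<^bsub>U Mod F n\<^esub> p = ?\<pi> (A [^]\<^bsub>U\<^esub> p)"
        using F_carrier[OF A(1)] by (simp only: \<pi>.hom_nat_pow)
      then show ?thesis using F_pow[OF A(1)] by blast
    qed
  qed (rule assms(3))
  moreover have "?\<pi> A = \<one>\<^bsub>Ubar p n s\<^esub>" if "A \<in> F n" for A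
    using that Fn.rcos_const[OF U.is_group] unfolding Ubar_eq by simp
  ultimately show ?thesis by auto
qed

end

text \<open>The representation of a word \<open>w\<close> is placed in the upper left block of \<open>Unm p n (length w + 1)\<close>,
  the group of matrices over \<open>\<int>/p^(n - length w)\<close> with one more row and column.\<close>

lemma word_hom_exists:
  assumes S: "top_group S T" and B: "profinite_basis S T B" and pr: "prime p"
    and w: "w \<noteq> []" "length w < n"
  obtains h where "h \<in> cont_hom_fin S T (Unm p n (Suc (length w)))"
    "\<And>x. x \<in> B \<Longrightarrow> h x = unitri_ppow.letter_mat (Suc (length w)) w x"
    "\<And>g. g \<in> lpc S T p n \<Longrightarrow> h g = \<one>\<^bsub>Unm p n (Suc (length w))\<^esub>"
proof -
  interpret top_group S T by (rule S)
  interpret V: unm p n "Suc (length w)" using pr w by unfold_locales auto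
  have lm: "V.letter_mat w x \<in> carrier V.U" for x by (rule V.letter_mat_carrier) simp
  have "{x \<in> B. V.letter_mat w x \<noteq> \<one>\<^bsub>V.U\<^esub>} \<subseteq> set w"
    by (intro subsetI, rule ccontr) (simp add: V.letter_mat_one)
  then have "finite {x \<in> B. V.letter_mat w x \<noteq> \<one>\<^bsub>V.U\<^esub>}" using finite_subset by blast
  then obtain h where h: "h \<in> cont_hom_fin S T V.U" "\<forall>x\<in>B. h x = V.letter_mat w x"
    using profinite_basis_extend[where f = "V.letter_mat w", OF B V.U.is_group finite_unitri lm] by blast
  \<comment> \<open>Matrices with trivial last column. The image of \<open>h\<close> stays among
    them, whereas \<open>V.F n\<close> is concentrated in the corner of that column; so
    \<open>h\<close> kills the \<open>n\<close>-th term and will descend to quotients by subgroups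
    of it.\<close>
  define E where "E = {A \<in> carrier V.U. \<forall>i\<le>length w. A i (Suc (length w)) = 0}"
  have "subgroup E V.U"
  proof (rule V.U.finite_submonoid_subgroup)
    show "finite E" unfolding E_def using finite_unitri by simp
    show "x \<otimes>\<^bsub>V.U\<^esub> y \<in> E" if "x \<in> E" "y \<in> E" for x y
      using that V.U.m_closed unfolding E_def by (auto simp: unitri_mult_entry)
  qed (auto simp: E_def one_unitri)
  note pre = cont_hom_fin_closed_preimage[OF h(1) this V.U.is_group]
  have BE: "B \<subseteq> {x \<in> carrier S. h x \<in> E}"
    using B h(2) lm unfolding profinite_basis_def E_def by (auto simp: V.letter_mat_def)
  have "closed_subgroup_gen S T B = carrier S" using B unfolding profinite_basis_def by blast
  with closed_subgroup_gen_le[OF pre BE] have E: "h g \<in> E" if "g \<in> carrier S" for g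
    using that by blast
  have hU: "h \<in> cont_hom_fin S T (Unm p n (Suc (length w)))" using h(1) unfolding V.Unm_eq .
  have "h g = \<one>\<^bsub>Unm p n (Suc (length w))\<^esub>" if g: "g \<in> lpc S T p n" for g
  proof -
    have "h g \<in> V.F n" using V.hom_Unm_lpc[OF S hU, of n] g w by auto
    then obtain k where k: "h g = zel p n (Suc (length w)) [^]\<^bsub>V.U\<^esub> k" "k < p" unfolding V.F_n by auto
    have "h g 0 (Suc (length w)) = 0" using E[OF lpc_carrier[OF g]] unfolding E_def by simp
    then have "k = 0"
      using k pr unfolding k(1) V.zel_pow by (auto simp: V.zmat_def dest: prime_gt_0_nat)
    then show ?thesis using k V.Unm_eq by simp
  qed
  then show ?thesis using that hU h(2) by blast
qed

text \<open>If \<open>g\<close> were outside, it would stay outside modulo some open normal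
  \<open>W\<close>. A positive word congruent to \<open>g\<close> modulo \<open>W\<close> and modulo
  the relevant kernels has the corresponding entries zero, that is, coefficients divisible as
  elimination requires, and so lies in the \<open>n\<close>-th term: a contradiction.\<close>

lemma mem_lpc_of_word_homs:
  fixes S :: "('a, 'b) monoid_scheme"
  assumes S: "pro_group S T" and B: "profinite_basis S T B" and pr: "prime p" and n: "2 \<le> n"
    and g: "g \<in> carrier S"
    and vanish: "\<And>(w :: 'a list) h. w \<noteq> [] \<Longrightarrow> length w < n \<Longrightarrow> h \<in> cont_hom_fin S T (Unm p n (Suc (length w)))
      \<Longrightarrow> (\<And>x. x \<in> lpc S T p n \<Longrightarrow> h x = \<one>\<^bsub>Unm p n (Suc (length w))\<^esub>) \<Longrightarrow> h g 0 (length w) = 0"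
  shows "g \<in> lpc S T p n"
proof (rule ccontr)
  interpret pro_group S T by (rule S)
  have Bc: "B \<subseteq> carrier S" and Bgen: "closed_subgroup_gen S T B = carrier S"
    using B unfolding profinite_basis_def by auto
  assume "g \<notin> lpc S T p n"
  then obtain W where W: "W \<lhd> S" "openin T W" "\<forall>w\<in>W. w \<otimes>\<^bsub>S\<^esub> g \<notin> lpc S T p n"
    using closed_separation[OF lpc_closed g] by blast
  interpret W: normal W S by (rule W)
  \<comment> \<open>Finite because the basis converges to the neutral element; the remaining basis
    elements are trivial modulo \<open>W\<close>.\<close>
  define X where "X = B - W"
  have fX: "finite X" unfolding X_def using B W W.one_closed unfolding profinite_basis_def by blast
  define Ws where "Ws = {w. set w \<subseteq> X \<and> w \<noteq> [] \<and> length w < n}"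
  have "Ws \<subseteq> {w. set w \<subseteq> X \<and> length w \<le> n}" unfolding Ws_def by auto
  then have fWs: "finite Ws" using finite_lists_length_le[OF fX] finite_subset by blast
  have "\<forall>w\<in>Ws. \<exists>h. h \<in> cont_hom_fin S T (Unm p n (Suc (length w)))
    \<and> (\<forall>x\<in>B. h x = unitri_ppow.letter_mat (Suc (length w)) w x) \<and> h g 0 (length w) = 0"
  proof
    fix w assume "w \<in> Ws"
    then have w: "w \<noteq> []" "length w < n" unfolding Ws_def by auto
    from word_hom_exists[OF top_group_axioms B pr w] obtain h where
      "h \<in> cont_hom_fin S T (Unm p n (Suc (length w)))"
      "\<And>x. x \<in> B \<Longrightarrow> h x = unitri_ppow.letter_mat (Suc (length w)) w x"
      "\<And>g. g \<in> lpc S T p n \<Longrightarrow> h g = \<one>\<^bsub>Unm p n (Suc (length w))\<^esub>" by blast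
    then show "\<exists>h. h \<in> cont_hom_fin S T (Unm p n (Suc (length w)))
      \<and> (\<forall>x\<in>B. h x = unitri_ppow.letter_mat (Suc (length w)) w x) \<and> h g 0 (length w) = 0"
      using vanish[OF w] by blast
  qed
  then obtain H where H: "\<And>w. w \<in> Ws \<Longrightarrow> H w \<in> cont_hom_fin S T (Unm p n (Suc (length w)))"
    "\<And>w x. w \<in> Ws \<Longrightarrow> x \<in> B \<Longrightarrow> H w x = unitri_ppow.letter_mat (Suc (length w)) w x"
    "\<And>w. w \<in> Ws \<Longrightarrow> H w g 0 (length w) = 0"
    by metis
  have grp: "group (Unm p n (Suc (length w)))" for w :: "'a list"
    unfolding Unm_def using prime_gt_1_nat[OF pr] by (intro group_unitri one_less_power) auto
  have hom: "group_hom S (Unm p n (Suc (length w))) (H w)" if "w \<in> Ws" for w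
    using H(1)[OF that] grp unfolding cont_hom_fin_def
    by (intro group_hom.intro group_hom_axioms.intro is_group) auto
  \<comment> \<open>Congruence modulo \<open>V\<close> controls the class modulo \<open>W\<close>
    and the entries at all words of \<open>Ws\<close> at once.\<close>
  define V where "V = W \<inter> (\<Inter>w\<in>Ws. kernel S (Unm p n (Suc (length w))) (H w)) \<inter> carrier S"
  have "V \<lhd> S"
  proof -
    have "subgroup V S"
    proof (rule subgroupI)
      have "\<one>\<^bsub>S\<^esub> \<in> V"
        using W.one_closed subgroup.one_closed[OF group_hom.subgroup_kernel[OF hom]] unfolding V_def by auto
      then show "V \<noteq> {}" by blast
      show "inv\<^bsub>S\<^esub> a \<in> V" if "a \<in> V" for a
        using that W.m_inv_closed subgroup.m_inv_closed[OF group_hom.subgroup_kernel[OF hom]]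
        unfolding V_def by auto
      show "a \<otimes>\<^bsub>S\<^esub> b \<in> V" if "a \<in> V" "b \<in> V" for a b
        using that W.m_closed subgroup.m_closed[OF group_hom.subgroup_kernel[OF hom]]
        unfolding V_def by auto
    qed (auto simp: V_def)
    moreover have "x \<otimes>\<^bsub>S\<^esub> h \<otimes>\<^bsub>S\<^esub> inv\<^bsub>S\<^esub> x \<in> V" if "x \<in> carrier S" "h \<in> V" for x h
      using that W.inv_op_closed2 normal.inv_op_closed2[OF group_hom.normal_kernel[OF hom]]
      unfolding V_def by auto
    ultimately show ?thesis using normal_inv_iff by blast
  qed
  then interpret V: normal V S .
  have "openin T V"
  proof -
    have ker: "openin T (kernel S (Unm p n (Suc (length w))) (H w))" if "w \<in> Ws" for w
      using H(1)[OF that] unfolding kernel_def cont_hom_fin_iff by auto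
    have "openin T (carrier S \<inter> \<Inter>((\<lambda>w. kernel S (Unm p n (Suc (length w))) (H w)) ` Ws))"
    proof (cases "Ws = {}")
      case True
      then show ?thesis by (simp flip: topspace)
    next
      case False
      then show ?thesis using fWs ker openin_topspace[of T]
        by (intro openin_Int openin_Inter) auto
    qed
    then have "openin T (W \<inter> (carrier S \<inter> \<Inter>((\<lambda>w. kernel S (Unm p n (Suc (length w))) (H w)) ` Ws)))"
      using W(2) by blast
    moreover have "V = W \<inter> (carrier S \<inter> \<Inter>((\<lambda>w. kernel S (Unm p n (Suc (length w))) (H w)) ` Ws))"
      unfolding V_def by blast
    ultimately show ?thesis by simp
  qed
  have "(\<lambda>x. V #>\<^bsub>S\<^esub> x) \<in> cont_hom_fin S T (S Mod V)"
    unfolding cont_hom_fin_def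
  proof (intro CollectI conjI V.r_coset_hom_Mod)
    show "continuous_map T (discrete_topology (carrier (S Mod V))) (\<lambda>x. V #>\<^bsub>S\<^esub> x)"
    proof (rule continuous_map_locally_constant[OF V.is_subgroup \<open>openin T V\<close>])
      show "V #>\<^bsub>S\<^esub> (h \<otimes>\<^bsub>S\<^esub> x) = V #>\<^bsub>S\<^esub> x" if "h \<in> V" "x \<in> carrier S" for h x
        using that V.rcos_eq_iff[of "h \<otimes>\<^bsub>S\<^esub> x" x] by (simp add: m_assoc)
    qed (auto simp: carrier_FactGroup)
  qed
  moreover have "finite (carrier (S Mod V))"
    using finite_rcosets[OF V.is_subgroup \<open>openin T V\<close>] by (simp add: FactGroup_def)
  ultimately obtain f where f: "set f \<subseteq> B" "V #>\<^bsub>S\<^esub> (eval_word (\<lambda>x. x) f) = V #>\<^bsub>S\<^esub> g"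
    using dense_words[OF Bgen Bc _ V.factorgroup_is_group _ g] by blast
  have fc: "eval_word (\<lambda>x. x) f \<in> carrier S" using f Bc eval_word_in_carrier by blast
  then have fg: "eval_word (\<lambda>x. x) f \<otimes>\<^bsub>S\<^esub> inv\<^bsub>S\<^esub> g \<in> V" using V.rcos_eq_iff f(2) g by simp
  \<comment> \<open>Deleting the letters in \<open>W\<close> changes neither the class modulo
    \<open>W\<close> nor the coefficients at words over \<open>X\<close>, and leaves a word over the
    alphabet for which \<open>V\<close> was chosen.\<close>
  define f0 where "f0 = filter (\<lambda>x. x \<in> X) f"
  have f0: "set f0 \<subseteq> X" "set f0 \<subseteq> carrier S" unfolding f0_def using f Bc by auto
  then have f0c: "eval_word (\<lambda>x. x) f0 \<in> carrier S" using eval_word_in_carrier by blast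
  have "eval_word (\<lambda>x. x) f0 \<in> lpc S T p (n - 1 + 1)"
  proof (rule lpc.eval_word_in_D[OF fX])
    show "p ^ (n - 1 + 1 - length w) dvd binom f0 w" if w: "set w \<subseteq> X" "w \<noteq> []" "length w \<le> n - 1" for w
    proof -
      have wW: "w \<in> Ws" unfolding Ws_def using w n by auto
      interpret U: unm p n "Suc (length w)" using pr w n by unfold_locales auto
      interpret Hw: group_hom S U.U "H w" using hom[OF wW] unfolding U.Unm_eq .
      have "H w (eval_word (\<lambda>x. x) f \<otimes>\<^bsub>S\<^esub> inv\<^bsub>S\<^esub> g) = \<one>\<^bsub>U.U\<^esub>"
        using fg wW unfolding V_def kernel_def U.Unm_eq[symmetric] by auto
      then have "H w (eval_word (\<lambda>x. x) f) = H w g"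
        using fc g U.U.inv_solve_right[of "\<one>\<^bsub>U.U\<^esub>" "H w (eval_word (\<lambda>x. x) f)" "H w g"] by auto
      moreover have "H w (eval_word (\<lambda>x. x) f) = U.U.eval_word (U.letter_mat w) f"
      proof -
        have "H w (eval_word (\<lambda>x. x) f) = U.U.eval_word (H w \<circ> (\<lambda>x. x)) f"
          using f(1) Bc by (intro Hw.hom_eval_word) auto
        also have "\<dots> = U.U.eval_word (U.letter_mat w) f"
          using f(1) H(2)[OF wW] by (intro U.U.eval_word_cong) auto
        finally show ?thesis .
      qed
      moreover have "U.U.eval_word (U.letter_mat w) f0 = U.U.eval_word (U.letter_mat w) f"
        unfolding f0_def
      proof (rule U.U.eval_word_filter)
        show "U.letter_mat w x = \<one>\<^bsub>U.U\<^esub>" if "x \<notin> X" for x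
          using that w by (intro U.letter_mat_one) auto
        show "U.letter_mat w ` set f \<subseteq> carrier U.U" using U.letter_mat_carrier[of w] by auto
      qed
      ultimately have "U.U.eval_word (U.letter_mat w) f0 0 (length w) = 0" using H(3)[OF wW] by simp
      then have "int (binom f0 w) mod int (p ^ (expo n (Suc (length w)))) = 0"
        using U.eval_letter_mat[of w 0 "length w" f0] by simp
      then have "p ^ (expo n (Suc (length w))) dvd binom f0 w"
        by (simp only: mod_eq_0_iff_dvd int_dvd_int_iff)
      moreover have "expo n (Suc (length w)) = n - 1 + 1 - length w" using w n by (auto simp: expo_def)
      ultimately show ?thesis by simp
    qed
  qed (use f0 Bc in \<open>auto simp: X_def\<close>)
  then have "eval_word (\<lambda>x. x) f0 \<in> lpc S T p n" using n by simp
  moreover have "eval_word (\<lambda>x. x) f0 \<otimes>\<^bsub>S\<^esub> inv\<^bsub>S\<^esub> g \<in> W"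
  proof -
    interpret \<pi>: group_hom S "S Mod W" "\<lambda>x. W #>\<^bsub>S\<^esub> x"
      by (intro group_hom.intro group_hom_axioms.intro is_group W.factorgroup_is_group W.r_coset_hom_Mod)
    have "W #>\<^bsub>S\<^esub> eval_word (\<lambda>x. x) f0 = \<pi>.H.eval_word (\<lambda>x. W #>\<^bsub>S\<^esub> x) f0"
      using \<pi>.hom_eval_word[of f0 "\<lambda>x. x"] f0 by (auto simp: o_def)
    also have "\<dots> = \<pi>.H.eval_word (\<lambda>x. W #>\<^bsub>S\<^esub> x) f"
      unfolding f0_def
    proof (rule \<pi>.H.eval_word_filter)
      show "W #>\<^bsub>S\<^esub> x = \<one>\<^bsub>S Mod W\<^esub>" if "x \<in> set f" "x \<notin> X" for x
        using that f W.rcos_const[OF is_group] unfolding X_def by auto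
    qed (use f Bc in \<open>auto simp: carrier_FactGroup\<close>)
    also have "\<dots> = W #>\<^bsub>S\<^esub> eval_word (\<lambda>x. x) f"
      using \<pi>.hom_eval_word[of f "\<lambda>x. x"] f Bc by (auto simp: o_def)
    also have "\<dots> = W #>\<^bsub>S\<^esub> g" using W.rcos_eq_iff fg fc g unfolding V_def by auto
    finally show ?thesis using W.rcos_eq_iff f0c g by simp
  qed
  moreover have "(eval_word (\<lambda>x. x) f0 \<otimes>\<^bsub>S\<^esub> inv\<^bsub>S\<^esub> g) \<otimes>\<^bsub>S\<^esub> g = eval_word (\<lambda>x. x) f0"
    using f0c g by (simp add: m_assoc)
  ultimately show False using W(3) by metis
qed

section \<open>The second cohomology group\<close>

lemma continuous_map_discrete_comp2:
  assumes f: "continuous_map X (discrete_topology A) f" and g: "continuous_map X (discrete_topology B) g"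
    and F: "\<And>x. x \<in> topspace X \<Longrightarrow> F (f x) (g x) \<in> C"
  shows "continuous_map X (discrete_topology C) (\<lambda>x. F (f x) (g x))"
  unfolding continuous_map_discrete_iff
proof (intro conjI allI)
  fix d
  have "{x \<in> topspace X. F (f x) (g x) = d}
    = (\<Union>(a, b)\<in>{(a, b). F a b = d}. {x \<in> topspace X. f x = a} \<inter> {x \<in> topspace X. g x = b})"
    by auto
  moreover have "openin X (\<Union>(a, b)\<in>{(a, b). F a b = d}. {x \<in> topspace X. f x = a} \<inter> {x \<in> topspace X. g x = b})"
    using f g unfolding continuous_map_discrete_iff by (intro openin_Union) auto
  ultimately show "openin X {x \<in> topspace X. F (f x) (g x) = d}" by simp
qed (use F in auto)

lemma mod4_simp: "(a mod m - b mod m + c mod m - d mod m) mod m = (a - b + c - d) mod (m::int)"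
  by (intro mod_diff_cong mod_add_cong mod_mod_trivial)

lemma mod3_simp: "(a mod m - b mod m + c mod m) mod m = (a - b + c) mod (m::int)"
  by (intro mod_diff_cong mod_add_cong mod_mod_trivial)

lemma mod3_add:
  "((a1 - a2 + a3) mod m + (b1 - b2 + b3) mod m) mod m
    = ((a1 + b1) mod m - (a2 + b2) mod m + (a3 + b3) mod m) mod (m::int)"
  unfolding mod3_simp mod_add_eq by (simp add: algebra_simps)

lemma mod3_sub:
  "((a1 - a2 + a3) mod m - (b1 - b2 + b3) mod m) mod m
    = ((a1 - b1) mod m - (a2 - b2) mod m + (a3 - b3) mod m) mod (m::int)"
  unfolding mod3_simp mod_diff_eq by (simp add: algebra_simps)

locale coh_group = top_group +
  fixes p :: nat
  assumes p_pos: "0 < p"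
begin

definition cadd :: "('a \<Rightarrow> 'a \<Rightarrow> int) \<Rightarrow> ('a \<Rightarrow> 'a \<Rightarrow> int) \<Rightarrow> 'a \<Rightarrow> 'a \<Rightarrow> int" where
  "cadd c d = (\<lambda>x y. (c x y + d x y) mod int p)"

definition csub :: "('a \<Rightarrow> 'a \<Rightarrow> int) \<Rightarrow> ('a \<Rightarrow> 'a \<Rightarrow> int) \<Rightarrow> 'a \<Rightarrow> 'a \<Rightarrow> int" where
  "csub c d = (\<lambda>x y. (c x y - d x y) mod int p)"

abbreviation czero :: "'a \<Rightarrow> 'a \<Rightarrow> int" where
  "czero \<equiv> \<lambda>x y. 0"

lemma mod_range [simp]: "0 \<le> a mod int p" "a mod int p < int p"
  using p_pos by simp_all

lemma cochain1_range: "f \<in> cochain1 G T p \<Longrightarrow> x \<in> carrier G \<Longrightarrow> f x \<in> {0..<int p}"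
  unfolding cochain1_def continuous_map_discrete_iff by auto

lemma cochain1_mod: "f \<in> cochain1 G T p \<Longrightarrow> x \<in> carrier G \<Longrightarrow> f x mod int p = f x"
  using cochain1_range by fastforce

lemma cochain1_comb:
  assumes "f \<in> cochain1 G T p" "g \<in> cochain1 G T p"
  shows "(\<lambda>x. if x \<in> carrier G then F (f x) (g x) mod int p else 0) \<in> cochain1 G T p"
proof -
  have "continuous_map T (discrete_topology {0..<int p}) (\<lambda>x. F (f x) (g x) mod int p)"
    using assms unfolding cochain1_def by (intro continuous_map_discrete_comp2[where F = "\<lambda>a b. F a b mod int p"]) auto
  then have "continuous_map T (discrete_topology {0..<int p}) (\<lambda>x. if x \<in> carrier G then F (f x) (g x) mod int p else 0)"
    by (rule continuous_map_eq) simp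
  then show ?thesis unfolding cochain1_def by simp
qed

lemma cochain1_const: "(\<lambda>x. if x \<in> carrier G then a mod int p else 0) \<in> cochain1 G T p"
proof -
  have "continuous_map T (discrete_topology {0..<int p}) (\<lambda>x. a mod int p)" using p_pos by simp
  then have "continuous_map T (discrete_topology {0..<int p}) (\<lambda>x. if x \<in> carrier G then a mod int p else 0)"
    by (rule continuous_map_eq) simp
  then show ?thesis unfolding cochain1_def by simp
qed

lemma cochain2_range: "c \<in> cochain2 G T p \<Longrightarrow> x \<in> carrier G \<Longrightarrow> y \<in> carrier G \<Longrightarrow> c x y \<in> {0..<int p}"
  unfolding cochain2_def continuous_map_discrete_iff by (auto simp: image_subset_iff)

lemma cochain2_outside: "c \<in> cochain2 G T p \<Longrightarrow> \<not> (x \<in> carrier G \<and> y \<in> carrier G) \<Longrightarrow> c x y = 0"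
  unfolding cochain2_def by auto

lemma cochain2_mod: "c \<in> cochain2 G T p \<Longrightarrow> c x y mod int p = c x y"
  using cochain2_range[of c x y] cochain2_outside[of c x y] by fastforce

lemma cochain2I:
  assumes "continuous_map (prod_topology T T) (discrete_topology {0..<int p}) (\<lambda>(x, y). c' x y)"
    and "\<And>x y. x \<in> carrier G \<Longrightarrow> y \<in> carrier G \<Longrightarrow> c x y = c' x y"
    and "\<And>x y. \<not> (x \<in> carrier G \<and> y \<in> carrier G) \<Longrightarrow> c x y = 0"
  shows "c \<in> cochain2 G T p"
proof -
  have "continuous_map (prod_topology T T) (discrete_topology {0..<int p}) (\<lambda>(x, y). c x y)"
    by (rule continuous_map_eq[OF assms(1)]) (use assms(2) in auto)
  then show ?thesis using assms(3) unfolding cochain2_def by auto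
qed

lemma cochain2_comb:
  assumes "c \<in> cochain2 G T p" "d \<in> cochain2 G T p" "F 0 0 mod int p = 0"
  shows "(\<lambda>x y. F (c x y) (d x y) mod int p) \<in> cochain2 G T p"
proof (rule cochain2I)
  have "continuous_map (prod_topology T T) (discrete_topology {0..<int p})
      (\<lambda>z. F ((\<lambda>(x, y). c x y) z) ((\<lambda>(x, y). d x y) z) mod int p)"
    using assms unfolding cochain2_def by (intro continuous_map_discrete_comp2[where F = "\<lambda>a b. F a b mod int p"]) auto
  then show "continuous_map (prod_topology T T) (discrete_topology {0..<int p}) (\<lambda>(x, y). F (c x y) (d x y) mod int p)"
    by (simp add: case_prod_beta')
qed (use assms(3) cochain2_outside[OF assms(1)] cochain2_outside[OF assms(2)] in auto)

lemma coboundary_cochain2: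
  assumes f: "f \<in> cochain1 G T p"
  shows "coboundary G p f \<in> cochain2 G T p"
proof (rule cochain2I)
  have f': "continuous_map T (discrete_topology {0..<int p}) f" using f unfolding cochain1_def by simp
  have m: "continuous_map (prod_topology T T) T (\<lambda>z. fst z \<otimes> snd z)"
    by (intro continuous_map_mult continuous_map_fst continuous_map_snd)
  have 1: "continuous_map (prod_topology T T) (discrete_topology {0..<int p}) (f \<circ> snd)"
    "continuous_map (prod_topology T T) (discrete_topology {0..<int p}) (f \<circ> fst)"
    "continuous_map (prod_topology T T) (discrete_topology {0..<int p}) (f \<circ> (\<lambda>z. fst z \<otimes> snd z))"
    by (rule continuous_map_compose[OF _ f'] continuous_map_snd continuous_map_fst m)+
  have 2: "continuous_map (prod_topology T T) (discrete_topology UNIV) (\<lambda>z. f (snd z) - f (fst z \<otimes> snd z))"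
    using continuous_map_discrete_comp2[OF 1(1,3), of "\<lambda>a b. a - b" UNIV] by simp
  show "continuous_map (prod_topology T T) (discrete_topology {0..<int p}) (\<lambda>(x, y). (f y - f (x \<otimes> y) + f x) mod int p)"
    using continuous_map_discrete_comp2[OF 2 1(2), of "\<lambda>a b. (a + b) mod int p" "{0..<int p}"] p_pos
    by (simp add: case_prod_beta')
qed (auto simp: coboundary_def)

lemma coboundary_Z2:
  assumes f: "f \<in> cochain1 G T p"
  shows "coboundary G p f \<in> Z2 G T p"
  unfolding Z2_def
proof (intro CollectI conjI ballI coboundary_cochain2[OF f])
  fix x y z assume "x \<in> carrier G" "y \<in> carrier G" "z \<in> carrier G"
  then show "(coboundary G p f y z - coboundary G p f (x \<otimes> y) z + coboundary G p f x (y \<otimes> z)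
      - coboundary G p f x y) mod int p = 0"
    by (simp add: coboundary_def mod4_simp m_assoc)
qed

lemma B2_Z2: "B2 G T p \<subseteq> Z2 G T p"
  unfolding B2_def using coboundary_Z2 by auto

lemma coboundary_add:
  "cadd (coboundary G p f) (coboundary G p g)
    = coboundary G p (\<lambda>x. if x \<in> carrier G then (f x + g x) mod int p else 0)"
  by (intro ext) (simp add: cadd_def coboundary_def mod3_add)

lemma coboundary_sub:
  "csub (coboundary G p f) (coboundary G p g)
    = coboundary G p (\<lambda>x. if x \<in> carrier G then (f x - g x) mod int p else 0)"
  by (intro ext) (simp add: csub_def coboundary_def mod3_sub)

lemma coboundary_const:
  "coboundary G p (\<lambda>x. if x \<in> carrier G then a mod int p else 0)
    = (\<lambda>x y. if x \<in> carrier G \<and> y \<in> carrier G then a mod int p else 0)"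
  by (intro ext) (simp add: coboundary_def mod_simps)

lemma B2_cadd: "c \<in> B2 G T p \<Longrightarrow> d \<in> B2 G T p \<Longrightarrow> cadd c d \<in> B2 G T p"
  unfolding B2_def using coboundary_add cochain1_comb[where F = "\<lambda>a b. a + b"] by (auto intro!: image_eqI)

lemma B2_csub: "c \<in> B2 G T p \<Longrightarrow> d \<in> B2 G T p \<Longrightarrow> csub c d \<in> B2 G T p"
  unfolding B2_def using coboundary_sub cochain1_comb[where F = "\<lambda>a b. a - b"] by (auto intro!: image_eqI)

lemma B2_zero: "czero \<in> B2 G T p"
proof -
  have "coboundary G p (\<lambda>x. if x \<in> carrier G then 0 mod int p else 0) = czero"
    unfolding coboundary_const by (intro ext) simp
  then show ?thesis unfolding B2_def using cochain1_const[of 0] by (metis imageI)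
qed

lemma Z2_cochain2: "c \<in> Z2 G T p \<Longrightarrow> c \<in> cochain2 G T p"
  unfolding Z2_def by simp

lemma Z2_cocycle:
  "c \<in> Z2 G T p \<Longrightarrow> x \<in> carrier G \<Longrightarrow> y \<in> carrier G \<Longrightarrow> z \<in> carrier G \<Longrightarrow>
    (c y z - c (x \<otimes> y) z + c x (y \<otimes> z) - c x y) mod int p = 0"
  unfolding Z2_def by simp

lemma Z2_cadd:
  assumes c: "c \<in> Z2 G T p" and d: "d \<in> Z2 G T p"
  shows "cadd c d \<in> Z2 G T p"
  unfolding Z2_def
proof (intro CollectI conjI ballI)
  show "cadd c d \<in> cochain2 G T p"
    unfolding cadd_def
    using cochain2_comb[where F = "\<lambda>a b. a + b", OF Z2_cochain2[OF c] Z2_cochain2[OF d]] by simp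
  fix x y z assume xyz: "x \<in> carrier G" "y \<in> carrier G" "z \<in> carrier G"
  have "int p dvd (c y z - c (x \<otimes> y) z + c x (y \<otimes> z) - c x y) + (d y z - d (x \<otimes> y) z + d x (y \<otimes> z) - d x y)"
    by (rule dvd_add[OF Z2_cocycle[OF c xyz, unfolded mod_eq_0_iff_dvd] Z2_cocycle[OF d xyz, unfolded mod_eq_0_iff_dvd]])
  then show "(cadd c d y z - cadd c d (x \<otimes> y) z + cadd c d x (y \<otimes> z) - cadd c d x y) mod int p = 0"
    unfolding cadd_def mod4_simp mod_eq_0_iff_dvd by (simp add: algebra_simps)
qed

lemma Z2_csub:
  assumes c: "c \<in> Z2 G T p" and d: "d \<in> Z2 G T p"
  shows "csub c d \<in> Z2 G T p"
  unfolding Z2_def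
proof (intro CollectI conjI ballI)
  show "csub c d \<in> cochain2 G T p"
    unfolding csub_def
    using cochain2_comb[where F = "\<lambda>a b. a - b", OF Z2_cochain2[OF c] Z2_cochain2[OF d]] by simp
  fix x y z assume xyz: "x \<in> carrier G" "y \<in> carrier G" "z \<in> carrier G"
  have "int p dvd (c y z - c (x \<otimes> y) z + c x (y \<otimes> z) - c x y) - (d y z - d (x \<otimes> y) z + d x (y \<otimes> z) - d x y)"
    by (rule dvd_diff[OF Z2_cocycle[OF c xyz, unfolded mod_eq_0_iff_dvd] Z2_cocycle[OF d xyz, unfolded mod_eq_0_iff_dvd]])
  then show "(csub c d y z - csub c d (x \<otimes> y) z + csub c d x (y \<otimes> z) - csub c d x y) mod int p = 0"
    unfolding csub_def mod4_simp mod_eq_0_iff_dvd by (simp add: algebra_simps)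
qed

lemma Z2_zero: "czero \<in> Z2 G T p"
  using B2_zero B2_Z2 by blast

lemma h2cls_eq_def: "h2cls G T p c = {d \<in> Z2 G T p. csub d c \<in> B2 G T p}"
  unfolding h2cls_def csub_def ..

lemma csub_self: "csub c c = czero"
  by (intro ext) (simp add: csub_def)

lemma h2cls_self: "c \<in> Z2 G T p \<Longrightarrow> c \<in> h2cls G T p c"
  unfolding h2cls_eq_def using csub_self B2_zero by simp

lemma csub_trans: "cadd (csub a b) (csub b c) = csub a c"
  by (intro ext) (simp add: csub_def cadd_def mod_simps)

lemma csub_zero: "csub czero (csub a b) = csub b a"
  by (intro ext) (simp add: csub_def mod_simps)

lemma h2cls_eq_iff:
  assumes "c \<in> Z2 G T p" "d \<in> Z2 G T p"
  shows "h2cls G T p c = h2cls G T p d \<longleftrightarrow> csub c d \<in> B2 G T p"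
proof
  assume "h2cls G T p c = h2cls G T p d"
  then show "csub c d \<in> B2 G T p" using h2cls_self[OF assms(1)] unfolding h2cls_eq_def by simp
next
  assume *: "csub c d \<in> B2 G T p"
  have "csub d c \<in> B2 G T p" using B2_csub[OF B2_zero *] unfolding csub_zero .
  with * show "h2cls G T p c = h2cls G T p d"
    unfolding h2cls_eq_def using B2_cadd csub_trans by (metis (no_types, lifting))
qed

lemma B2_eq_h2cls: "B2 G T p = h2cls G T p czero"
proof -
  have "csub d czero = d" if "d \<in> Z2 G T p" for d
    using that cochain2_mod[OF Z2_cochain2] by (intro ext) (simp add: csub_def)
  then show ?thesis unfolding h2cls_eq_def using B2_Z2 by auto
qed

lemma h2cls_eq_B2_iff: "c \<in> Z2 G T p \<Longrightarrow> h2cls G T p c = B2 G T p \<longleftrightarrow> c \<in> B2 G T p"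
proof -
  assume c: "c \<in> Z2 G T p"
  have "csub c czero = c"
    using c cochain2_mod[OF Z2_cochain2] by (intro ext) (simp add: csub_def)
  then show ?thesis unfolding B2_eq_h2cls[symmetric] using h2cls_eq_iff[OF c Z2_zero] B2_eq_h2cls by simp
qed

lemma h2cls_some:
  assumes "c \<in> Z2 G T p"
  shows "(SOME a. a \<in> h2cls G T p c) \<in> Z2 G T p" "csub (SOME a. a \<in> h2cls G T p c) c \<in> B2 G T p"
  using someI[of "\<lambda>a. a \<in> h2cls G T p c", OF h2cls_self[OF assms]] unfolding h2cls_eq_def by auto

lemma carrier_H2: "carrier (H2 G T p) = h2cls G T p ` Z2 G T p"
  by (simp add: H2_def)

lemma one_H2: "\<one>\<^bsub>H2 G T p\<^esub> = h2cls G T p czero"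
  by (simp add: H2_def B2_eq_h2cls)

text \<open>The product is defined through chosen representatives; another choice changes the sum by
  a sum of coboundaries.\<close>

lemma mult_H2:
  assumes "c \<in> Z2 G T p" "d \<in> Z2 G T p"
  shows "h2cls G T p c \<otimes>\<^bsub>H2 G T p\<^esub> h2cls G T p d = h2cls G T p (cadd c d)"
proof -
  let ?c = "SOME a. a \<in> h2cls G T p c" and ?d = "SOME a. a \<in> h2cls G T p d"
  have "h2cls G T p c \<otimes>\<^bsub>H2 G T p\<^esub> h2cls G T p d = h2cls G T p (cadd ?c ?d)"
    by (simp add: H2_def cadd_def)
  moreover have "csub (cadd ?c ?d) (cadd c d) = cadd (csub ?c c) (csub ?d d)"
  proof (intro ext)
    fix x y
    show "csub (cadd ?c ?d) (cadd c d) x y = cadd (csub ?c c) (csub ?d d) x y"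
      unfolding csub_def cadd_def mod_diff_eq mod_add_eq by (simp add: algebra_simps)
  qed
  moreover have "cadd (csub ?c c) (csub ?d d) \<in> B2 G T p"
    using h2cls_some(2) assms by (intro B2_cadd) auto
  ultimately show ?thesis
    using h2cls_eq_iff[of "cadd ?c ?d" "cadd c d"] h2cls_some(1) assms Z2_cadd by simp
qed

lemma group_H2: "group (H2 G T p)"
proof (rule groupI)
  show "\<one>\<^bsub>H2 G T p\<^esub> \<in> carrier (H2 G T p)" unfolding one_H2 carrier_H2 using Z2_zero by blast
  fix A assume "A \<in> carrier (H2 G T p)"
  then obtain a where a: "a \<in> Z2 G T p" "A = h2cls G T p a" unfolding carrier_H2 by blast
  have "cadd czero a = a"
    using cochain2_mod[OF Z2_cochain2[OF a(1)]] by (intro ext) (simp add: cadd_def)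
  then show "\<one>\<^bsub>H2 G T p\<^esub> \<otimes>\<^bsub>H2 G T p\<^esub> A = A" unfolding one_H2 a using mult_H2[OF Z2_zero a(1)] by simp
  have "cadd (csub czero a) a = czero"
    by (intro ext) (simp add: csub_def cadd_def mod_simps)
  then show "\<exists>B\<in>carrier (H2 G T p). B \<otimes>\<^bsub>H2 G T p\<^esub> A = \<one>\<^bsub>H2 G T p\<^esub>"
    unfolding one_H2 a carrier_H2 using mult_H2[OF Z2_csub[OF Z2_zero a(1)] a(1)] Z2_csub[OF Z2_zero a(1)] by auto
  fix B assume "B \<in> carrier (H2 G T p)"
  then obtain b where b: "b \<in> Z2 G T p" "B = h2cls G T p b" unfolding carrier_H2 by blast
  show "A \<otimes>\<^bsub>H2 G T p\<^esub> B \<in> carrier (H2 G T p)"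
    unfolding a b mult_H2[OF a(1) b(1)] carrier_H2 using Z2_cadd a b by blast
  fix C assume "C \<in> carrier (H2 G T p)"
  then obtain c where c: "c \<in> Z2 G T p" "C = h2cls G T p c" unfolding carrier_H2 by blast
  have "cadd (cadd a b) c = cadd a (cadd b c)"
    by (intro ext) (simp add: cadd_def mod_simps add.assoc)
  then show "A \<otimes>\<^bsub>H2 G T p\<^esub> B \<otimes>\<^bsub>H2 G T p\<^esub> C = A \<otimes>\<^bsub>H2 G T p\<^esub> (B \<otimes>\<^bsub>H2 G T p\<^esub> C)"
    unfolding a b c using mult_H2 Z2_cadd a(1) b(1) c(1) by simp
qed

end

definition pull :: "('g, 'x) monoid_scheme \<Rightarrow> ('g \<Rightarrow> 'q) \<Rightarrow> ('q \<Rightarrow> 'q \<Rightarrow> int) \<Rightarrow> 'g \<Rightarrow> 'g \<Rightarrow> int" where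
  "pull G \<rho> c = (\<lambda>x y. if x \<in> carrier G \<and> y \<in> carrier G then c (\<rho> x) (\<rho> y) else 0)"

locale coh_hom = G: coh_group G T p + H: coh_group H TH p
  for G :: "('g, 'x) monoid_scheme" and T and H :: "('h, 'y) monoid_scheme" and TH and p +
  fixes \<rho>
  assumes hom: "\<rho> \<in> hom G H" and cont: "continuous_map T TH \<rho>"
begin

lemma \<rho>_carrier: "x \<in> carrier G \<Longrightarrow> \<rho> x \<in> carrier H"
  using hom by (auto simp: hom_def)

lemma \<rho>_mult: "x \<in> carrier G \<Longrightarrow> y \<in> carrier G \<Longrightarrow> \<rho> (x \<otimes>\<^bsub>G\<^esub> y) = \<rho> x \<otimes>\<^bsub>H\<^esub> \<rho> y"
  using hom by (rule hom_mult)

lemma pull_Z2: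
  assumes c: "c \<in> Z2 H TH p"
  shows "pull G \<rho> c \<in> Z2 G T p"
  unfolding Z2_def
proof (intro CollectI conjI ballI)
  show "pull G \<rho> c \<in> cochain2 G T p"
  proof (rule G.cochain2I)
    have "continuous_map (prod_topology T T) TH (\<rho> \<circ> fst)" "continuous_map (prod_topology T T) TH (\<rho> \<circ> snd)"
      by (rule continuous_map_compose[OF _ cont] continuous_map_fst continuous_map_snd)+
    then have "continuous_map (prod_topology T T) (prod_topology TH TH) (\<lambda>z. (\<rho> (fst z), \<rho> (snd z)))"
      by (simp add: continuous_map_pairwise o_def)
    from continuous_map_compose[OF this, of _ "\<lambda>(x, y). c x y"]
    show "continuous_map (prod_topology T T) (discrete_topology {0..<int p}) (\<lambda>(x, y). c (\<rho> x) (\<rho> y))"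
      using c unfolding Z2_def cochain2_def by (simp add: o_def case_prod_beta')
  qed (auto simp: pull_def)
  fix x y z assume "x \<in> carrier G" "y \<in> carrier G" "z \<in> carrier G"
  then show "(pull G \<rho> c y z - pull G \<rho> c (x \<otimes>\<^bsub>G\<^esub> y) z + pull G \<rho> c x (y \<otimes>\<^bsub>G\<^esub> z) - pull G \<rho> c x y) mod int p = 0"
    using H.Z2_cocycle[OF c \<rho>_carrier \<rho>_carrier \<rho>_carrier] by (simp add: pull_def \<rho>_mult)
qed

lemma pull_cochain1:
  assumes "u \<in> cochain1 H TH p"
  shows "(\<lambda>x. if x \<in> carrier G then u (\<rho> x) else 0) \<in> cochain1 G T p"
proof -
  have "continuous_map T (discrete_topology {0..<int p}) (u \<circ> \<rho>)"
    using assms unfolding cochain1_def by (intro continuous_map_compose[OF cont]) auto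
  then have "continuous_map T (discrete_topology {0..<int p}) (\<lambda>x. if x \<in> carrier G then u (\<rho> x) else 0)"
    by (rule continuous_map_eq) simp
  then show ?thesis unfolding cochain1_def by simp
qed

lemma pull_coboundary:
  "pull G \<rho> (coboundary H p u) = coboundary G p (\<lambda>x. if x \<in> carrier G then u (\<rho> x) else 0)"
  by (intro ext) (simp add: pull_def coboundary_def \<rho>_carrier \<rho>_mult)

lemma pull_B2: "c \<in> B2 H TH p \<Longrightarrow> pull G \<rho> c \<in> B2 G T p"
  unfolding B2_def using pull_coboundary pull_cochain1 by auto

text \<open>The chosen representative differs from \<open>c\<close> by a coboundary, and
  coboundaries pull back to coboundaries.\<close>

lemma h2_pull_h2cls:
  assumes c: "c \<in> Z2 H TH p"
  shows "h2_pull G T p \<rho> (h2cls H TH p c) = h2cls G T p (pull G \<rho> c)"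
proof -
  let ?c = "SOME a. a \<in> h2cls H TH p c"
  note some = H.h2cls_some[OF c]
  have "G.csub (pull G \<rho> ?c) (pull G \<rho> c) = pull G \<rho> (H.csub ?c c)"
    by (intro ext) (simp add: pull_def G.csub_def H.csub_def)
  then have "h2cls G T p (pull G \<rho> ?c) = h2cls G T p (pull G \<rho> c)"
    using G.h2cls_eq_iff[OF pull_Z2[OF some(1)] pull_Z2[OF c]] pull_B2[OF some(2)] by simp
  then show ?thesis by (simp add: h2_pull_def pull_def)
qed

end

section \<open>The kernel of inflation\<close>

context coh_group
begin

text \<open>Cocycles need not be normalised, so the value at the neutral element has to be carried
  along; the cocycle identity shows that it is a single constant.\<close>

lemma Z2_one:
  assumes c: "c \<in> Z2 G T p" and x: "x \<in> carrier G"
  shows "c \<one> x = c \<one> \<one>" "c x \<one> = c \<one> \<one>"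
proof -
  have eq: "a = b" if "a \<in> {0..<int p}" "b \<in> {0..<int p}" "(a - b) mod int p = 0" for a b
    using that by (metis atLeastLessThan_iff mod_0_imp_dvd mod_eq_dvd_iff mod_pos_pos_trivial)
  note r = cochain2_range[OF Z2_cochain2[OF c]]
  have "(c \<one> x - c \<one> \<one>) mod int p = 0" using Z2_cocycle[OF c one_closed one_closed x] x by simp
  then show "c \<one> x = c \<one> \<one>" by (rule eq[OF r[OF one_closed x] r[OF one_closed one_closed]])
  have "(c \<one> \<one> - c x \<one>) mod int p = 0" using Z2_cocycle[OF c x one_closed one_closed] x by simp
  then show "c x \<one> = c \<one> \<one>" by (rule eq[OF r[OF one_closed one_closed] r[OF x one_closed], symmetric])
qed

text \<open>For normal \<open>L\<close> the two halves together force invariance of the restriction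
  to \<open>L\<close> under conjugation. Such a cochain thus packages an invariant character of
  \<open>L\<close> with an extension to the whole group.\<close>

definition additive_on :: "'a set \<Rightarrow> ('a \<Rightarrow> int) \<Rightarrow> bool" where
  "additive_on L f \<longleftrightarrow> (\<forall>k\<in>L. \<forall>y\<in>carrier G.
     f (k \<otimes> y) = (f k + f y) mod int p \<and> f (y \<otimes> k) = (f y + f k) mod int p)"

lemma mod_add_cancel_left:
  "(a + b) mod int p = (a + c) mod int p \<Longrightarrow> b \<in> {0..<int p} \<Longrightarrow> c \<in> {0..<int p} \<Longrightarrow> b = c"
proof -
  assume "(a + b) mod int p = (a + c) mod int p" and r: "b \<in> {0..<int p}" "c \<in> {0..<int p}"
  then have "b mod int p = c mod int p" unfolding mod_eq_dvd_iff by simp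
  then show "b = c" using r by (metis atLeastLessThan_iff mod_pos_pos_trivial)
qed

lemma additive_one:
  assumes "f \<in> cochain1 G T p" "additive_on L f" "\<one> \<in> L"
  shows "f \<one> = 0"
proof -
  have "f (\<one> \<otimes> \<one>) = (f \<one> + f \<one>) mod int p" using assms(2,3) unfolding additive_on_def by blast
  then have "(f \<one> + 0) mod int p = (f \<one> + f \<one>) mod int p"
    using cochain1_mod[OF assms(1) one_closed] by simp
  then show ?thesis using mod_add_cancel_left[of "f \<one>" 0 "f \<one>"] cochain1_range[OF assms(1) one_closed] p_pos by simp
qed

lemma additive_conj:
  assumes f: "f \<in> cochain1 G T p" "additive_on L f" and L: "L \<lhd> G" and x: "x \<in> carrier G" and k: "k \<in> L"
  shows "f (x \<otimes> k \<otimes> inv x) = f k"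
proof -
  interpret L: normal L G by (rule L)
  have k': "x \<otimes> k \<otimes> inv x \<in> L" "k \<in> carrier G" using L.inv_op_closed2[OF x k] k L.mem_carrier by auto
  have "(x \<otimes> k \<otimes> inv x) \<otimes> x = x \<otimes> k" using x k' by (simp add: m_assoc)
  then have "(f (x \<otimes> k \<otimes> inv x) + f x) mod int p = (f x + f k) mod int p"
    using f(2) k' k x unfolding additive_on_def by metis
  then have "(f x + f (x \<otimes> k \<otimes> inv x)) mod int p = (f x + f k) mod int p" by (simp add: add.commute)
  then show ?thesis using mod_add_cancel_left cochain1_range[OF f(1)] k' L.mem_carrier by blast
qed

text \<open>The zeros of \<open>f\<close> in \<open>lpc G T p j\<close> form a closed subgroup. It
  contains p-th powers because values are taken modulo \<open>p\<close>, and commutators because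
  \<open>f\<close> is invariant under conjugation.\<close>

lemma additive_vanish:
  assumes f: "f \<in> cochain1 G T p" "additive_on (lpc G T p j) f" and j: "0 < j"
    and x: "x \<in> lpc G T p (Suc j)"
  shows "f x = 0"
proof -
  let ?L = "lpc G T p j"
  interpret L: normal ?L G by (rule lpc_normal)
  have f1: "f \<one> = 0" using additive_one[OF f] by simp
  have add: "f (a \<otimes> b) = (f a + f b) mod int p" if "a \<in> ?L" "b \<in> carrier G" for a b
    using f(2) that unfolding additive_on_def by blast
  have inv: "f (inv a) = 0" if "a \<in> ?L" "f a = 0" for a
    using add[OF that(1), of "inv a"] that f1 cochain1_mod[OF f(1), of "inv a"] L.mem_carrier[OF that(1)] by simp
  define C where "C = {x \<in> ?L. f x = 0}"
  have "subgroup C G"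
  proof (rule subgroupI)
    have "\<one> \<in> C" unfolding C_def using f1 L.one_closed by blast
    then show "C \<noteq> {}" by blast
    show "a \<otimes> b \<in> C" if "a \<in> C" "b \<in> C" for a b using that add L.mem_carrier unfolding C_def by auto
  qed (use L.mem_carrier inv in \<open>auto simp: C_def\<close>)
  moreover have "closedin T C"
  proof -
    have "closedin T {x \<in> topspace T. f x \<in> {0}}"
      using f(1) p_pos unfolding cochain1_def by (intro closedin_continuous_map_preimage[of T "discrete_topology {0..<int p}"]) auto
    then have "closedin T (?L \<inter> {x \<in> topspace T. f x \<in> {0}})" using lpc_closed by blast
    moreover have "C = ?L \<inter> {x \<in> topspace T. f x \<in> {0}}" unfolding C_def using L.mem_carrier by auto
    ultimately show ?thesis by simp
  qed
  moreover have "lpc_gens p (j - 1) \<subseteq> C"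
  proof -
    have "x [^] p \<in> C" if x: "x \<in> ?L" for x
    proof -
      have xL: "x [^] k \<in> ?L" for k :: nat using nat_pow_in_subgroup[OF lpc_subgroup x] .
      have "f (x [^] k) = (int k * f x) mod int p" for k :: nat
      proof (induction k)
        case 0
        then show ?case using f1 by simp
      next
        case (Suc k)
        have "f (x [^] Suc k) = (f (x [^] k) + f x) mod int p" using add[OF xL] L.mem_carrier[OF x] by simp
        also have "\<dots> = (int k * f x + f x) mod int p" unfolding Suc by (rule mod_add_left_eq)
        also have "int k * f x + f x = int (Suc k) * f x" by (simp add: algebra_simps)
        finally show ?case .
      qed
      then show ?thesis using xL[of p] unfolding C_def by simp
    qed
    moreover have "gcomm G x y \<in> C" if x: "x \<in> carrier G" and y: "y \<in> ?L" for x y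
    proof -
      have yc: "y \<in> carrier G" "inv y \<in> ?L" "x \<otimes> y \<otimes> inv x \<in> ?L"
        using y L.mem_carrier L.m_inv_closed L.inv_op_closed2[OF x] by auto
      have "f (gcomm G x y) = (f (x \<otimes> y \<otimes> inv x) + f (inv y)) mod int p"
        unfolding gcomm_def using add yc by simp
      also have "\<dots> = (f y + f (inv y)) mod int p" using additive_conj[OF f lpc_normal x y] by simp
      also have "\<dots> = f (y \<otimes> inv y)" using yc by (intro add[OF y, symmetric]) simp
      finally have "f (gcomm G x y) = 0" using f1 yc by simp
      moreover have "gcomm G x y \<in> ?L" unfolding gcomm_def using yc L.m_closed by auto
      ultimately show ?thesis unfolding C_def by simp
    qed
    ultimately show ?thesis using j by auto
  qed
  ultimately have "closed_subgroup_gen G T (lpc_gens p (j - 1)) \<subseteq> C" by (rule closed_subgroup_gen_le)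
  moreover have "lpc G T p (Suc j) = closed_subgroup_gen G T (lpc_gens p (j - 1))"
    using j by (cases j) auto
  ultimately show ?thesis using x unfolding C_def by auto
qed

end

locale lpc_coh = pro_group +
  fixes p n :: nat
  assumes prime: "prime p" and n: "2 \<le> n"
begin

abbreviation "K \<equiv> lpc G T p n"
abbreviation "Q \<equiv> G Mod K"
abbreviation "TQ \<equiv> quot_top G T K"

sublocale coh_group G T p
  using prime_gt_0_nat[OF prime] by unfold_locales

sublocale M: top_group_mod G T K
  by (intro top_group_mod.intro top_group_axioms lpc_normal)

sublocale Q: coh_group Q TQ p
  by (intro coh_group.intro coh_group_axioms.intro M.top_group_quot p_pos)

sublocale P: coh_hom G T Q TQ p M.\<pi>
  by (intro coh_hom.intro coh_hom_axioms.intro coh_group_axioms Q.coh_group_axioms M.r_coset_hom_Mod M.continuous_map_proj)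

text \<open>A section without any continuity; continuity of what is built from it comes from the
  quotient topology, once independence of the choice is known.\<close>

definition rep :: "'a set \<Rightarrow> 'a" where
  "rep a = (SOME x. x \<in> carrier G \<and> M.\<pi> x = a)"

lemma rep:
  assumes "a \<in> carrier Q"
  shows "rep a \<in> carrier G" "M.\<pi> (rep a) = a"
proof -
  have "\<exists>x. x \<in> carrier G \<and> M.\<pi> x = a" using assms unfolding carrier_FactGroup by auto
  from someI_ex[OF this] show "rep a \<in> carrier G" "M.\<pi> (rep a) = a" unfolding rep_def by auto
qed

lemma rep_diff:
  assumes "x \<in> carrier G"
  obtains k where "k \<in> K" "x = k \<otimes> rep (M.\<pi> x)"
proof -
  have r: "rep (M.\<pi> x) \<in> carrier G" "M.\<pi> (rep (M.\<pi> x)) = M.\<pi> x"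
    using rep[of "M.\<pi> x"] assms by (auto simp: carrier_FactGroup)
  then have "x \<otimes> inv rep (M.\<pi> x) \<in> K" using M.rcos_eq_iff[OF assms r(1)] by simp
  moreover have "x = (x \<otimes> inv rep (M.\<pi> x)) \<otimes> rep (M.\<pi> x)" using assms r by (simp add: m_assoc)
  ultimately show ?thesis using that by blast
qed

definition FF :: "('a \<Rightarrow> int) set" where
  "FF = {f \<in> cochain1 G T p. additive_on K f}"

lemma FF_cochain1: "f \<in> FF \<Longrightarrow> f \<in> cochain1 G T p"
  unfolding FF_def by simp

lemma FF_add: "f \<in> FF \<Longrightarrow> k \<in> K \<Longrightarrow> y \<in> carrier G \<Longrightarrow> f (k \<otimes> y) = (f k + f y) mod int p"
  unfolding FF_def additive_on_def by simp

lemma FF_one: "f \<in> FF \<Longrightarrow> f \<one> = 0"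
  unfolding FF_def using additive_one by auto

lemma FF_comb:
  assumes "f \<in> FF" "g \<in> FF" and F: "\<And>a b a' b'. F ((a + a') mod int p) ((b + b') mod int p) mod int p = (F a b + F a' b') mod int p"
  shows "(\<lambda>x. if x \<in> carrier G then F (f x) (g x) mod int p else 0) \<in> FF"
  using assms(1,2) cochain1_comb[of f g F] lpc_carrier unfolding FF_def additive_on_def
  by (auto simp: F mod_add_eq)

lemma FF_plus: "f \<in> FF \<Longrightarrow> g \<in> FF \<Longrightarrow> (\<lambda>x. if x \<in> carrier G then (f x + g x) mod int p else 0) \<in> FF"
proof (erule (1) FF_comb[where F = "\<lambda>a b. a + b"])
  show "((a + a') mod int p + (b + b') mod int p) mod int p = (a + b + (a' + b')) mod int p" for a b a' b' :: int
    unfolding mod_add_eq by (simp add: algebra_simps)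
qed

lemma FF_lin: "f \<in> FF \<Longrightarrow> g \<in> FF \<Longrightarrow> (\<lambda>x. if x \<in> carrier G then (f x - c * g x) mod int p else 0) \<in> FF"
proof (erule (1) FF_comb[where F = "\<lambda>a b. a - c * b"])
  fix a b a' b' :: int
  have "((a + a') mod int p - c * ((b + b') mod int p)) mod int p = ((a + a') - c * (b + b')) mod int p"
    by (metis mod_diff_left_eq mod_diff_right_eq mod_mult_right_eq)
  then show "((a + a') mod int p - c * ((b + b') mod int p)) mod int p = (a - c * b + (a' - c * b')) mod int p"
    by (simp add: algebra_simps)
qed

lemma FF_zero: "(\<lambda>x. 0) \<in> FF"
proof -
  have "(\<lambda>x. if x \<in> carrier G then 0 mod int p else 0) = (\<lambda>x. 0)" by (intro ext) simp
  then show ?thesis using cochain1_const[of 0] unfolding FF_def additive_on_def by simp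
qed

text \<open>The value \<open>f k\<close> enters twice with opposite signs. Together with the
  right-hand version this makes the coboundary a function of cosets of \<open>K\<close>.\<close>

lemma cob_shift_left:
  assumes f: "f \<in> FF" and k: "k \<in> K" and x: "x \<in> carrier G" "y \<in> carrier G"
  shows "coboundary G p f (k \<otimes> x) y = coboundary G p f x y"
proof -
  have kc: "k \<in> carrier G" using k lpc_carrier by auto
  have "coboundary G p f (k \<otimes> x) y = (f y - f (k \<otimes> (x \<otimes> y)) + f (k \<otimes> x)) mod int p"
    using x kc by (simp add: coboundary_def m_assoc)
  also have "\<dots> = (f y - (f k + f (x \<otimes> y)) mod int p + (f k + f x) mod int p) mod int p"
    using FF_add[OF f k] x by simp
  also have "\<dots> = (f y - (f k + f (x \<otimes> y)) + (f k + f x)) mod int p"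
    by (intro mod_add_cong mod_diff_cong mod_mod_trivial refl)
  also have "\<dots> = coboundary G p f x y" using x by (simp add: coboundary_def algebra_simps)
  finally show ?thesis .
qed

text \<open>Moving \<open>k\<close> to the left of \<open>x\<close> replaces it by a conjugate, at
  which \<open>f\<close> has the same value.\<close>

lemma cob_shift_right:
  assumes f: "f \<in> FF" and k: "k \<in> K" and x: "x \<in> carrier G" "y \<in> carrier G"
  shows "coboundary G p f x (k \<otimes> y) = coboundary G p f x y"
proof -
  have kc: "k \<in> carrier G" using k lpc_carrier by auto
  have k': "x \<otimes> k \<otimes> inv x \<in> K" "f (x \<otimes> k \<otimes> inv x) = f k"
    using M.inv_op_closed2[OF x(1) k] additive_conj[OF _ _ lpc_normal x(1) k] f unfolding FF_def by auto
  have "x \<otimes> (k \<otimes> y) = (x \<otimes> k \<otimes> inv x) \<otimes> (x \<otimes> y)" using x kc by (simp add: m_assoc inv_mult_cancel)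
  then have "coboundary G p f x (k \<otimes> y) = (f (k \<otimes> y) - f ((x \<otimes> k \<otimes> inv x) \<otimes> (x \<otimes> y)) + f x) mod int p"
    using x kc by (simp add: coboundary_def)
  also have "\<dots> = ((f k + f y) mod int p - (f k + f (x \<otimes> y)) mod int p + f x) mod int p"
    using FF_add[OF f k x(2)] FF_add[OF f k'(1), of "x \<otimes> y"] x k'(2) by simp
  also have "\<dots> = ((f k + f y) - (f k + f (x \<otimes> y)) + f x) mod int p"
    by (intro mod_add_cong mod_diff_cong mod_mod_trivial refl)
  also have "\<dots> = coboundary G p f x y" using x by (simp add: coboundary_def algebra_simps)
  finally show ?thesis .
qed

definition \<Theta>c :: "('a \<Rightarrow> int) \<Rightarrow> 'a set \<Rightarrow> 'a set \<Rightarrow> int" where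
  "\<Theta>c f = (\<lambda>a b. if a \<in> carrier Q \<and> b \<in> carrier Q then coboundary G p f (rep a) (rep b) else 0)"

lemma proj_carrier: "x \<in> carrier G \<Longrightarrow> M.\<pi> x \<in> carrier Q"
  by (rule P.\<rho>_carrier)

lemma \<Theta>c_proj:
  assumes f: "f \<in> FF" and x: "x \<in> carrier G" "y \<in> carrier G"
  shows "\<Theta>c f (M.\<pi> x) (M.\<pi> y) = coboundary G p f x y"
proof -
  obtain k where k: "k \<in> K" "x = k \<otimes> rep (M.\<pi> x)" using rep_diff[OF x(1)] .
  obtain l where l: "l \<in> K" "y = l \<otimes> rep (M.\<pi> y)" using rep_diff[OF x(2)] .
  have r: "rep (M.\<pi> x) \<in> carrier G" "rep (M.\<pi> y) \<in> carrier G" using rep proj_carrier x by auto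
  have "coboundary G p f x y = coboundary G p f (k \<otimes> rep (M.\<pi> x)) y" using k(2) by simp
  also have "\<dots> = coboundary G p f (rep (M.\<pi> x)) y" by (rule cob_shift_left[OF f k(1) r(1) x(2)])
  also have "\<dots> = coboundary G p f (rep (M.\<pi> x)) (l \<otimes> rep (M.\<pi> y))" using l(2) by simp
  also have "\<dots> = coboundary G p f (rep (M.\<pi> x)) (rep (M.\<pi> y))" by (rule cob_shift_right[OF f l(1) r])
  finally show ?thesis using proj_carrier x by (simp add: \<Theta>c_def)
qed

lemma pull_\<Theta>c: "f \<in> FF \<Longrightarrow> pull G M.\<pi> (\<Theta>c f) = coboundary G p f"
  by (intro ext) (auto simp: pull_def \<Theta>c_proj, auto simp: coboundary_def)

lemma Q_ext:
  assumes "pull G M.\<pi> c = pull G M.\<pi> d"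
    and "\<And>a b. \<not> (a \<in> carrier Q \<and> b \<in> carrier Q) \<Longrightarrow> c a b = 0"
    and "\<And>a b. \<not> (a \<in> carrier Q \<and> b \<in> carrier Q) \<Longrightarrow> d a b = 0"
  shows "c = d"
proof (intro ext)
  fix a b
  show "c a b = d a b"
  proof (cases "a \<in> carrier Q \<and> b \<in> carrier Q")
    case True
    have "pull G M.\<pi> c (rep a) (rep b) = pull G M.\<pi> d (rep a) (rep b)" using assms(1) by simp
    then show ?thesis using rep True by (simp add: pull_def)
  qed (use assms in auto)
qed

lemma \<Theta>c_Z2:
  assumes f: "f \<in> FF"
  shows "\<Theta>c f \<in> Z2 Q TQ p"
  unfolding Z2_def
proof (intro CollectI conjI ballI)
  have f1: "coboundary G p f \<in> Z2 G T p" using coboundary_Z2 FF_cochain1[OF f] .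
  show "\<Theta>c f \<in> cochain2 Q TQ p"
  proof (rule Q.cochain2I)
    have "continuous_map (prod_topology T T) (discrete_topology {0..<int p}) (\<lambda>(x, y). coboundary G p f x y)"
      using f1 unfolding Z2_def cochain2_def by simp
    then show "continuous_map (prod_topology TQ TQ) (discrete_topology {0..<int p}) (\<lambda>(x, y). \<Theta>c f x y)"
      by (rule M.continuous_map_descend_prod) (simp add: \<Theta>c_proj[OF f])
  qed (auto simp: \<Theta>c_def)
  fix a b c assume abc: "a \<in> carrier Q" "b \<in> carrier Q" "c \<in> carrier Q"
  obtain x y z where xyz: "x \<in> carrier G" "y \<in> carrier G" "z \<in> carrier G" "a = M.\<pi> x" "b = M.\<pi> y" "c = M.\<pi> z"
    using abc unfolding carrier_FactGroup by auto
  have m: "M.\<pi> x \<otimes>\<^bsub>Q\<^esub> M.\<pi> y = M.\<pi> (x \<otimes> y)" "M.\<pi> y \<otimes>\<^bsub>Q\<^esub> M.\<pi> z = M.\<pi> (y \<otimes> z)"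
    using P.\<rho>_mult xyz by auto
  show "(\<Theta>c f b c - \<Theta>c f (a \<otimes>\<^bsub>Q\<^esub> b) c + \<Theta>c f a (b \<otimes>\<^bsub>Q\<^esub> c) - \<Theta>c f a b) mod int p = 0"
    unfolding xyz(4-6) m using Z2_cocycle[OF f1 xyz(1-3)] xyz(1-3) by (simp add: \<Theta>c_proj[OF f])
qed

text \<open>The transgression, on additive functions on \<open>K\<close> already extended to cochains on \<open>G\<close>.\<close>

definition \<Theta> :: "('a \<Rightarrow> int) \<Rightarrow> ('a set \<Rightarrow> 'a set \<Rightarrow> int) set" where
  "\<Theta> f = h2cls Q TQ p (\<Theta>c f)"

lemma \<Theta>_plus:
  assumes "f \<in> FF" "g \<in> FF"
  shows "\<Theta> (\<lambda>x. if x \<in> carrier G then (f x + g x) mod int p else 0) = \<Theta> f \<otimes>\<^bsub>H2 Q TQ p\<^esub> \<Theta> g"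
proof -
  have "\<Theta>c (\<lambda>x. if x \<in> carrier G then (f x + g x) mod int p else 0) = Q.cadd (\<Theta>c f) (\<Theta>c g)"
    using coboundary_add[of f g, symmetric]
    by (intro ext) (auto simp: \<Theta>c_def Q.cadd_def cadd_def)
  then show ?thesis unfolding \<Theta>_def using Q.mult_H2 \<Theta>c_Z2 assms by simp
qed

text \<open>The difference of \<open>f\<close> and \<open>g\<close> vanishes on \<open>K\<close>, so
  it is constant on cosets and descends to a cochain on \<open>Q\<close> whose coboundary is the
  difference of the two cocycles.\<close>

lemma \<Theta>_eq_of_restrict:
  assumes f: "f \<in> FF" and g: "g \<in> FF" and eq: "\<And>k. k \<in> K \<Longrightarrow> f k = g k"
  shows "\<Theta> f = \<Theta> g"
proof -
  define h where "h = (\<lambda>x. if x \<in> carrier G then (f x - g x) mod int p else 0)"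
  have h: "h \<in> cochain1 G T p"
    unfolding h_def using cochain1_comb[OF FF_cochain1[OF f] FF_cochain1[OF g], of "\<lambda>a b. a - b"] .
  define u where "u = (\<lambda>a. if a \<in> carrier Q then h (rep a) else 0)"
  have u: "u (M.\<pi> x) = h x" if x: "x \<in> carrier G" for x
  proof -
    obtain k where k: "k \<in> K" "x = k \<otimes> rep (M.\<pi> x)" using rep_diff[OF x] .
    have r: "rep (M.\<pi> x) \<in> carrier G" using rep proj_carrier x by auto
    have "f x = (f k + f (rep (M.\<pi> x))) mod int p" "g x = (g k + g (rep (M.\<pi> x))) mod int p"
      using FF_add[OF f k(1) r] FF_add[OF g k(1) r] k(2) by simp_all
    then have "h x = ((f k + f (rep (M.\<pi> x))) - (g k + g (rep (M.\<pi> x)))) mod int p"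
      unfolding h_def using x by (simp add: mod_diff_eq)
    then show ?thesis using eq[OF k(1)] r x proj_carrier unfolding h_def u_def by simp
  qed
  have "u \<in> cochain1 Q TQ p"
  proof -
    have "continuous_map T (discrete_topology {0..<int p}) h" using h unfolding cochain1_def by simp
    then have "continuous_map TQ (discrete_topology {0..<int p}) u"
      by (rule M.continuous_map_descend) (rule u)
    then show ?thesis unfolding cochain1_def u_def by auto
  qed
  moreover have "Q.csub (\<Theta>c f) (\<Theta>c g) = coboundary Q p u"
  proof (rule Q_ext)
    have "pull G M.\<pi> (Q.csub (\<Theta>c f) (\<Theta>c g)) = csub (pull G M.\<pi> (\<Theta>c f)) (pull G M.\<pi> (\<Theta>c g))"
      by (intro ext) (simp add: pull_def Q.csub_def csub_def)
    also have "\<dots> = coboundary G p h" unfolding pull_\<Theta>c[OF f] pull_\<Theta>c[OF g] coboundary_sub h_def ..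
    also have "\<dots> = pull G M.\<pi> (coboundary Q p u)"
      unfolding P.pull_coboundary by (intro ext) (auto simp: coboundary_def u)
    finally show "pull G M.\<pi> (Q.csub (\<Theta>c f) (\<Theta>c g)) = pull G M.\<pi> (coboundary Q p u)" .
  qed (auto simp: Q.csub_def \<Theta>c_def coboundary_def)
  ultimately have "Q.csub (\<Theta>c f) (\<Theta>c g) \<in> B2 Q TQ p" unfolding B2_def by simp
  then show ?thesis unfolding \<Theta>_def using Q.h2cls_eq_iff[OF \<Theta>c_Z2[OF f] \<Theta>c_Z2[OF g]] by simp
qed

text \<open>The place where \<open>n \<ge> 2\<close> enters: \<open>f\<close> minus the inflation of
  \<open>u\<close> is a homomorphism to Z/p, which vanishes on \<open>lpc G T p 2\<close> and so on
  \<open>K\<close>; there the inflation of \<open>u\<close> is constant.\<close>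

lemma restrict_eq_of_cohomologous:
  assumes f: "f \<in> cochain1 G T p" "f \<one> = 0" and u: "u \<in> cochain1 Q TQ p"
    and cob: "coboundary G p f = pull G M.\<pi> (coboundary Q p u)" and k: "k \<in> K"
  shows "f k = 0"
proof -
  define v where "v = (\<lambda>x. if x \<in> carrier G then u (M.\<pi> x) else 0)"
  have v: "v \<in> cochain1 G T p" unfolding v_def by (rule P.pull_cochain1[OF u])
  define t where "t = (\<lambda>x. if x \<in> carrier G then (f x - v x) mod int p else 0)"
  have t: "t \<in> cochain1 G T p" unfolding t_def using cochain1_comb[OF f(1) v, of "\<lambda>a b. a - b"] .
  have "coboundary G p t = csub (coboundary G p f) (coboundary G p v)"
    unfolding coboundary_sub t_def ..
  also have "\<dots> = czero" unfolding cob P.pull_coboundary v_def[symmetric] by (rule csub_self)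
  finally have t0: "coboundary G p t = czero" .
  have "t (x \<otimes> y) = (t x + t y) mod int p" if "x \<in> carrier G" "y \<in> carrier G" for x y
  proof -
    have "(t y - t (x \<otimes> y) + t x) mod int p = 0" using fun_cong[OF fun_cong[OF t0, of x], of y] that by (simp add: coboundary_def)
    then have "int p dvd (t x + t y) - t (x \<otimes> y)" by (simp add: mod_eq_0_iff_dvd algebra_simps)
    then have "(t x + t y) mod int p = t (x \<otimes> y) mod int p" by (simp add: mod_eq_dvd_iff)
    then show ?thesis using cochain1_mod[OF t] that by simp
  qed
  then have "additive_on (lpc G T p 1) t" unfolding additive_on_def by simp
  then have van: "t x = 0" if "x \<in> lpc G T p 2" for x
    using additive_vanish[OF t, of 1 x] that by (simp add: numeral_2_eq_2)
  have kc: "k \<in> carrier G" using k lpc_carrier by auto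
  have "k \<in> lpc G T p 2" using k lpc.D_mono[OF n] by auto
  then have "t k = 0" "t \<one> = 0" using van subgroup.one_closed[OF lpc_subgroup] by auto
  moreover have "v k = v \<one>" using kc M.rcos_const[OF is_group k] M.rcos_const[OF is_group subgroup.one_closed[OF lpc_subgroup]]
    by (simp add: v_def)
  ultimately have "(f k - v \<one>) mod int p = 0" "(0 - v \<one>) mod int p = 0"
    using kc f(2) unfolding t_def by auto
  then have "int p dvd (f k - v \<one>) - (0 - v \<one>)" unfolding mod_eq_0_iff_dvd by (rule dvd_diff)
  then have "f k mod int p = 0" by (simp add: mod_eq_0_iff_dvd)
  then show ?thesis using cochain1_mod[OF f(1) kc] by simp
qed

lemma restrict_eq_of_\<Theta>_eq:
  assumes f: "f \<in> FF" and g: "g \<in> FF" and eq: "\<Theta> f = \<Theta> g" and k: "k \<in> K"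
  shows "f k = g k"
proof -
  define h where "h = (\<lambda>x. if x \<in> carrier G then (f x - g x) mod int p else 0)"
  have h: "h \<in> cochain1 G T p"
    unfolding h_def using cochain1_comb[OF FF_cochain1[OF f] FF_cochain1[OF g], of "\<lambda>a b. a - b"] .
  have "Q.csub (\<Theta>c f) (\<Theta>c g) \<in> B2 Q TQ p"
    using eq Q.h2cls_eq_iff[OF \<Theta>c_Z2[OF f] \<Theta>c_Z2[OF g]] unfolding \<Theta>_def by simp
  then obtain u where u: "u \<in> cochain1 Q TQ p" "Q.csub (\<Theta>c f) (\<Theta>c g) = coboundary Q p u"
    unfolding B2_def by auto
  have "coboundary G p h = csub (pull G M.\<pi> (\<Theta>c f)) (pull G M.\<pi> (\<Theta>c g))"
    unfolding pull_\<Theta>c[OF f] pull_\<Theta>c[OF g] coboundary_sub h_def ..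
  also have "\<dots> = pull G M.\<pi> (Q.csub (\<Theta>c f) (\<Theta>c g))"
    by (intro ext) (simp add: pull_def Q.csub_def csub_def)
  finally have "coboundary G p h = pull G M.\<pi> (coboundary Q p u)" unfolding u(2) .
  moreover have "h \<one> = 0" unfolding h_def using FF_one[OF f] FF_one[OF g] by simp
  ultimately have "h k = 0" using restrict_eq_of_cohomologous[OF h _ u(1) _ k] by simp
  then have "f k mod int p = g k mod int p"
    using k lpc_carrier unfolding h_def by (auto simp: mod_eq_dvd_iff mod_eq_0_iff_dvd)
  then show ?thesis using cochain1_mod FF_cochain1 f g k lpc_carrier by metis
qed

text \<open>The inflated cocycle takes the constant value \<open>f0 \<one>\<close> whenever one
  argument lies in \<open>K\<close>, so subtracting this constant makes \<open>f0\<close> additive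
  against \<open>K\<close>. The class is unchanged because a constant cochain has a constant
  coboundary.\<close>

lemma \<Theta>_of_cobounding:
  assumes c: "c \<in> Z2 Q TQ p" and f0: "f0 \<in> cochain1 G T p" and cob: "pull G M.\<pi> c = coboundary G p f0"
  defines "f \<equiv> \<lambda>x. if x \<in> carrier G then (f0 x - f0 \<one>) mod int p else 0"
  shows "f \<in> FF" "\<Theta> f = h2cls Q TQ p c"
proof -
  have f_eq: "f = (\<lambda>x. if x \<in> carrier G then (\<lambda>a b. a - f0 \<one>) (f0 x) (f0 x) mod int p else 0)"
    by (simp add: f_def)
  have fc: "f \<in> cochain1 G T p"
    unfolding f_eq by (rule cochain1_comb[OF f0 f0])
  have c11: "f0 \<one> = c (M.\<pi> \<one>) (M.\<pi> \<one>)"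
  proof -
    have "pull G M.\<pi> c \<one> \<one> = coboundary G p f0 \<one> \<one>" using cob by simp
    then show ?thesis using cochain1_mod[OF f0 one_closed] by (simp add: pull_def coboundary_def)
  qed
  have \<pi>1: "M.\<pi> k = \<one>\<^bsub>Q\<^esub>" if "k \<in> K" for k using M.rcos_const[OF is_group that] by simp
  have \<pi>1': "M.\<pi> \<one> = \<one>\<^bsub>Q\<^esub>" using \<pi>1[OF subgroup.one_closed[OF lpc_subgroup]] .
  have cb: "f0 \<one> = (f0 b - f0 (a \<otimes> b) + f0 a) mod int p"
    if ab: "a \<in> carrier G" "b \<in> carrier G" "a \<in> K \<or> b \<in> K" for a b
  proof -
    have "pull G M.\<pi> c a b = coboundary G p f0 a b" using cob by simp
    then have "c (M.\<pi> a) (M.\<pi> b) = (f0 b - f0 (a \<otimes> b) + f0 a) mod int p"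
      using ab by (simp add: pull_def coboundary_def)
    moreover have "c (M.\<pi> a) (M.\<pi> b) = c \<one>\<^bsub>Q\<^esub> \<one>\<^bsub>Q\<^esub>"
      using ab \<pi>1 Q.Z2_one[OF c proj_carrier[OF ab(1)]] Q.Z2_one[OF c proj_carrier[OF ab(2)]] by metis
    ultimately show ?thesis unfolding c11 \<pi>1' by simp
  qed
  have add: "f (a \<otimes> b) = (f a + f b) mod int p"
    if ab: "a \<in> carrier G" "b \<in> carrier G" "a \<in> K \<or> b \<in> K" for a b
  proof -
    have "f0 \<one> mod int p = (f0 b - f0 (a \<otimes> b) + f0 a) mod int p"
      using cb[OF ab] by (metis mod_mod_trivial)
    then have "int p dvd f0 \<one> - (f0 b - f0 (a \<otimes> b) + f0 a)" by (simp add: mod_eq_dvd_iff)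
    then have "(f0 (a \<otimes> b) - f0 \<one>) mod int p = ((f0 a - f0 \<one>) + (f0 b - f0 \<one>)) mod int p"
      unfolding mod_eq_dvd_iff by (simp add: algebra_simps)
    then show ?thesis using ab unfolding f_def by (simp add: mod_add_eq)
  qed
  show f: "f \<in> FF"
    unfolding FF_def additive_on_def using fc add lpc_carrier by auto
  let ?u = "\<lambda>a. if a \<in> carrier Q then (- f0 \<one>) mod int p else 0"
  have "Q.csub (\<Theta>c f) c = coboundary Q p ?u"
  proof (rule Q_ext)
    have "pull G M.\<pi> (Q.csub (\<Theta>c f) c) = csub (pull G M.\<pi> (\<Theta>c f)) (pull G M.\<pi> c)"
      by (intro ext) (simp add: pull_def Q.csub_def csub_def)
    also have "\<dots> = csub (coboundary G p f) (coboundary G p f0)" unfolding pull_\<Theta>c[OF f] cob ..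
    also have "\<dots> = coboundary G p (\<lambda>x. if x \<in> carrier G then (f x - f0 x) mod int p else 0)" by (rule coboundary_sub)
    also have "(\<lambda>x. if x \<in> carrier G then (f x - f0 x) mod int p else 0) = (\<lambda>x. if x \<in> carrier G then (- f0 \<one>) mod int p else 0)"
      by (intro ext) (simp add: f_def mod_diff_left_eq)
    also have "coboundary G p \<dots> = pull G M.\<pi> (coboundary Q p ?u)"
      unfolding P.pull_coboundary by (intro ext) (auto simp: coboundary_def proj_carrier)
    finally show "pull G M.\<pi> (Q.csub (\<Theta>c f) c) = pull G M.\<pi> (coboundary Q p ?u)" .
  qed (use Q.cochain2_outside[OF Q.Z2_cochain2[OF c]] in \<open>auto simp: Q.csub_def \<Theta>c_def coboundary_def\<close>)
  then have "Q.csub (\<Theta>c f) c \<in> B2 Q TQ p" unfolding B2_def using Q.cochain1_const by blast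
  then show "\<Theta> f = h2cls Q TQ p c" unfolding \<Theta>_def using Q.h2cls_eq_iff[OF \<Theta>c_Z2[OF f] c] by simp
qed

definition Ker :: "('a set \<Rightarrow> 'a set \<Rightarrow> int) set set" where
  "Ker = {A \<in> carrier (H2 Q TQ p). inflation G T p K A = \<one>\<^bsub>H2 G T p\<^esub>}"

lemma inflation_h2cls: "c \<in> Z2 Q TQ p \<Longrightarrow> inflation G T p K (h2cls Q TQ p c) = h2cls G T p (pull G M.\<pi> c)"
  unfolding inflation_def by (rule P.h2_pull_h2cls)

lemma h2cls_in_Ker_iff: "c \<in> Z2 Q TQ p \<Longrightarrow> h2cls Q TQ p c \<in> Ker \<longleftrightarrow> pull G M.\<pi> c \<in> B2 G T p"
  unfolding Ker_def one_H2 B2_eq_h2cls[symmetric] Q.carrier_H2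
  using inflation_h2cls h2cls_eq_B2_iff[OF P.pull_Z2] by auto

lemma Ker_eq: "Ker = \<Theta> ` FF"
proof (intro equalityI subsetI)
  fix A assume A: "A \<in> Ker"
  then obtain c where c: "c \<in> Z2 Q TQ p" "A = h2cls Q TQ p c" unfolding Ker_def Q.carrier_H2 by auto
  then have "pull G M.\<pi> c \<in> B2 G T p" using A h2cls_in_Ker_iff by simp
  then obtain f0 where "f0 \<in> cochain1 G T p" "pull G M.\<pi> c = coboundary G p f0" unfolding B2_def by auto
  from \<Theta>_of_cobounding[OF c(1) this] show "A \<in> \<Theta> ` FF" unfolding c(2) by blast
next
  fix A assume "A \<in> \<Theta> ` FF"
  then obtain f where f: "f \<in> FF" "A = \<Theta> f" by auto
  have "pull G M.\<pi> (\<Theta>c f) \<in> B2 G T p"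
    unfolding pull_\<Theta>c[OF f(1)] B2_def using FF_cochain1[OF f(1)] by blast
  then show "A \<in> Ker" unfolding f(2) \<Theta>_def using h2cls_in_Ker_iff[OF \<Theta>c_Z2[OF f(1)]] by simp
qed

lemma \<Theta>_zero: "\<Theta> (\<lambda>x. 0) = \<one>\<^bsub>H2 Q TQ p\<^esub>"
proof -
  have "\<Theta>c (\<lambda>x. 0) = Q.czero" by (intro ext) (simp add: \<Theta>c_def coboundary_def)
  then show ?thesis unfolding \<Theta>_def Q.one_H2 by simp
qed

lemma FF_vanish: "f \<in> FF \<Longrightarrow> x \<in> lpc G T p (Suc n) \<Longrightarrow> f x = 0"
  unfolding FF_def using additive_vanish n by auto

end

section \<open>Unitriangular classes and liftings\<close>

lemma discrete_top_group:
  assumes "group P"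
  shows "top_group P (discrete_topology (carrier P))"
proof -
  interpret group P by (rule assms)
  have "topological_group P (discrete_topology (carrier P))"
    unfolding topological_group_def prod_topology_discrete_topology[symmetric]
    by (auto intro!: continuous_map_from_discrete)
  then show ?thesis by (intro top_group.intro top_group_axioms.intro assms)
qed

context unm
begin

text \<open>Exponents are integers because lifts involve the negatives of cochain values.\<close>

definition zp :: "int \<Rightarrow> mat" where
  "zp a = zel p n s [^]\<^bsub>U\<^esub> nat (a mod int p)"

lemma p_pos: "0 < p"
  using prime_gt_0_nat[OF prime] .

lemma zp_carrier [simp]: "zp a \<in> carrier U"
  unfolding zp_def using zel_carrier by simp

lemma zp_of_nat: "zp (int k) = zel p n s [^]\<^bsub>U\<^esub> k"
  unfolding zp_def by (simp add: zel_pow_mod nat_int flip: zmod_int)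

lemma zp_eq_iff: "zp a = zp b \<longleftrightarrow> a mod int p = b mod int p"
proof
  assume "zp a = zp b"
  then have "nat (a mod int p) mod p = nat (b mod int p) mod p" unfolding zp_def zel_pow_eq_iff .
  then have "int (nat (a mod int p)) mod int p = int (nat (b mod int p)) mod int p" by (metis zmod_int)
  then show "a mod int p = b mod int p" using p_pos by simp
qed (simp add: zp_def)

lemma zp_add: "zp a \<otimes>\<^bsub>U\<^esub> zp b = zp (a + b)"
proof -
  have "zp a \<otimes>\<^bsub>U\<^esub> zp b = zp (int (nat (a mod int p) + nat (b mod int p)))"
    unfolding zp_of_nat unfolding zp_def using zel_carrier by (simp add: U.nat_pow_mult)
  also have "\<dots> = zp (a + b)"
    unfolding zp_eq_iff using p_pos by (simp add: mod_add_eq)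
  finally show ?thesis .
qed

lemma zp_central: "A \<in> carrier U \<Longrightarrow> A \<otimes>\<^bsub>U\<^esub> zp a = zp a \<otimes>\<^bsub>U\<^esub> A"
  unfolding zp_def by (rule zel_pow_central[symmetric])

lemma zp_mult_cancel: "A \<in> carrier U \<Longrightarrow> zp a \<otimes>\<^bsub>U\<^esub> A = zp b \<otimes>\<^bsub>U\<^esub> A \<longleftrightarrow> a mod int p = b mod int p"
  by (simp add: zp_eq_iff)

lemma F_n_zp: "F n = range zp"
proof (intro equalityI subsetI)
  fix A assume "A \<in> F n"
  then obtain k :: nat where "A = zel p n s [^]\<^bsub>U\<^esub> k" unfolding F_n by blast
  then have "A = zp (int k)" by (simp only: zp_of_nat)
  then show "A \<in> range zp" by blast
next
  fix A assume "A \<in> range zp"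
  then obtain a where "A = zp a" by blast
  moreover have "nat (a mod int p) < p" using p_pos by (simp add: nat_less_iff)
  ultimately show "A \<in> F n" unfolding F_n zp_def by blast
qed

definition sec :: "mat set \<Rightarrow> mat" where
  "sec c = (SOME x. x \<in> c)"

lemma sec:
  assumes "c \<in> carrier (Ubar p n s)"
  shows "sec c \<in> carrier U" "F n #>\<^bsub>U\<^esub> sec c = c"
proof -
  obtain A where A: "A \<in> carrier U" "c = F n #>\<^bsub>U\<^esub> A"
    using assms unfolding Ubar_eq carrier_FactGroup by auto
  then have "A \<in> c" using U.rcos_self subgroup_F by simp
  then have *: "sec c \<in> F n #>\<^bsub>U\<^esub> A" unfolding sec_def A(2)[symmetric] by (rule someI[of "\<lambda>x. x \<in> c"])
  show "F n #>\<^bsub>U\<^esub> sec c = c" using U.repr_independence[OF * A(1) subgroup_F] A(2) by simp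
  show "sec c \<in> carrier U" using Fn.elemrcos_carrier[OF U.is_group A(1) *] .
qed

lemma same_coset:
  assumes "A \<in> carrier U" "B \<in> carrier U" "F n #>\<^bsub>U\<^esub> A = F n #>\<^bsub>U\<^esub> B"
  obtains a where "A = zp a \<otimes>\<^bsub>U\<^esub> B"
proof -
  have "A \<otimes>\<^bsub>U\<^esub> inv\<^bsub>U\<^esub> B \<in> range zp" using assms Fn.rcos_eq_iff unfolding F_n_zp[symmetric] by simp
  then obtain a where "A \<otimes>\<^bsub>U\<^esub> inv\<^bsub>U\<^esub> B = zp a" by blast
  then have "A = zp a \<otimes>\<^bsub>U\<^esub> B" using assms by (metis U.inv_solve_right' zp_carrier)
  then show ?thesis using that by blast
qed

lemma Ubar_mult: "a \<in> carrier (Ubar p n s) \<Longrightarrow> b \<in> carrier (Ubar p n s) \<Longrightarrow>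
    a \<otimes>\<^bsub>Ubar p n s\<^esub> b = F n #>\<^bsub>U\<^esub> (sec a \<otimes>\<^bsub>U\<^esub> sec b)"
  using Fn.rcos_sum[OF sec(1) sec(1), of a b] sec(2)[of a] sec(2)[of b] by (simp add: Ubar_eq)

lemma ext_cocycle:
  assumes a: "a \<in> carrier (Ubar p n s)" and b: "b \<in> carrier (Ubar p n s)"
  shows "sec a \<otimes>\<^bsub>U\<^esub> sec b = zp (ext_cocycle p n s a b) \<otimes>\<^bsub>U\<^esub> sec (a \<otimes>\<^bsub>Ubar p n s\<^esub> b)"
    "ext_cocycle p n s a b \<in> {0..<int p}"
proof -
  let ?P = "\<lambda>k. k < p \<and> sec a \<otimes>\<^bsub>U\<^esub> sec b = zel p n s [^]\<^bsub>U\<^esub> k \<otimes>\<^bsub>U\<^esub> sec (a \<otimes>\<^bsub>Ubar p n s\<^esub> b)"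
  interpret B: group "Ubar p n s" by (rule group_Ubar)
  have ab: "a \<otimes>\<^bsub>Ubar p n s\<^esub> b \<in> carrier (Ubar p n s)" using a b by simp
  have "F n #>\<^bsub>U\<^esub> (sec a \<otimes>\<^bsub>U\<^esub> sec b) = F n #>\<^bsub>U\<^esub> sec (a \<otimes>\<^bsub>Ubar p n s\<^esub> b)"
    using sec(2)[OF ab] Ubar_mult[OF a b] by simp
  then obtain t where t: "sec a \<otimes>\<^bsub>U\<^esub> sec b = zp t \<otimes>\<^bsub>U\<^esub> sec (a \<otimes>\<^bsub>Ubar p n s\<^esub> b)"
    using same_coset sec(1) a b ab U.m_closed by metis
  have tp: "nat (t mod int p) < p" using p_pos by (simp add: nat_less_iff)
  have uniq: "k = nat (t mod int p)" if "?P k" for k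
  proof -
    have "zp (int k) \<otimes>\<^bsub>U\<^esub> sec (a \<otimes>\<^bsub>Ubar p n s\<^esub> b) = zp t \<otimes>\<^bsub>U\<^esub> sec (a \<otimes>\<^bsub>Ubar p n s\<^esub> b)"
      using that t by (simp add: zp_of_nat)
    then have "int k mod int p = t mod int p" using zp_mult_cancel[OF sec(1)[OF ab]] by simp
    then show ?thesis using that by (metis mod_less nat_int zmod_int)
  qed
  have "?P (nat (t mod int p))" using t tp by (simp add: zp_def)
  then have the: "(THE k. ?P k) = nat (t mod int p)" using uniq by (rule the_equality)
  have "ext_cocycle p n s a b = int (THE k. ?P k)"
    using a b by (simp add: ext_cocycle_def Unm_eq sec_def)
  then have e: "ext_cocycle p n s a b = t mod int p" unfolding the using p_pos by simp
  show "ext_cocycle p n s a b \<in> {0..<int p}" unfolding e using p_pos by simp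
  have "zp (t mod int p) = zp t" unfolding zp_eq_iff by simp
  then show "sec a \<otimes>\<^bsub>U\<^esub> sec b = zp (ext_cocycle p n s a b) \<otimes>\<^bsub>U\<^esub> sec (a \<otimes>\<^bsub>Ubar p n s\<^esub> b)"
    unfolding e using t by simp
qed

abbreviation "TUbar \<equiv> discrete_topology (carrier (Ubar p n s))"

sublocale B: coh_group "Ubar p n s" TUbar p
  by (intro coh_group.intro coh_group_axioms.intro discrete_top_group group_Ubar p_pos)

text \<open>Associativity of a product of three values of \<open>sec\<close>, with the central
  factors collected in front.\<close>

lemma ext_cocycle_Z2: "ext_cocycle p n s \<in> Z2 (Ubar p n s) TUbar p"
  unfolding Z2_def
proof (intro CollectI conjI ballI)
  let ?c = "ext_cocycle p n s"
  show "?c \<in> cochain2 (Ubar p n s) TUbar p"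
    unfolding cochain2_def prod_topology_discrete_topology[symmetric]
  proof (intro CollectI conjI allI impI)
    show "continuous_map (discrete_topology (carrier (Ubar p n s) \<times> carrier (Ubar p n s)))
        (discrete_topology {0..<int p}) (\<lambda>(x, y). ?c x y)"
      using ext_cocycle(2) by (intro continuous_map_from_discrete) auto
    show "?c x y = 0" if "(x, y) \<notin> carrier (Ubar p n s) \<times> carrier (Ubar p n s)" for x y
      using that by (auto simp: ext_cocycle_def)
  qed
  fix x y z assume x: "x \<in> carrier (Ubar p n s)" and y: "y \<in> carrier (Ubar p n s)" and z: "z \<in> carrier (Ubar p n s)"
  let ?xy = "x \<otimes>\<^bsub>Ubar p n s\<^esub> y" and ?yz = "y \<otimes>\<^bsub>Ubar p n s\<^esub> z"
  let ?xyz = "x \<otimes>\<^bsub>Ubar p n s\<^esub> (y \<otimes>\<^bsub>Ubar p n s\<^esub> z)"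
  have xy: "?xy \<in> carrier (Ubar p n s)" and yz: "?yz \<in> carrier (Ubar p n s)" and xyz: "?xyz \<in> carrier (Ubar p n s)"
    using x y z by auto
  have "zp (?c x y + ?c ?xy z) \<otimes>\<^bsub>U\<^esub> sec ?xyz = zp (?c x y) \<otimes>\<^bsub>U\<^esub> (zp (?c ?xy z) \<otimes>\<^bsub>U\<^esub> sec ?xyz)"
    using sec(1)[OF xyz] by (simp add: zp_add flip: U.m_assoc)
  also have "zp (?c ?xy z) \<otimes>\<^bsub>U\<^esub> sec ?xyz = sec ?xy \<otimes>\<^bsub>U\<^esub> sec z"
    using ext_cocycle(1)[OF xy z] x y z by (simp add: B.m_assoc)
  also have "zp (?c x y) \<otimes>\<^bsub>U\<^esub> (sec ?xy \<otimes>\<^bsub>U\<^esub> sec z) = (sec x \<otimes>\<^bsub>U\<^esub> sec y) \<otimes>\<^bsub>U\<^esub> sec z"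
    unfolding ext_cocycle(1)[OF x y] using sec(1) xy z by (simp add: U.m_assoc)
  also have "\<dots> = sec x \<otimes>\<^bsub>U\<^esub> (sec y \<otimes>\<^bsub>U\<^esub> sec z)" using sec(1) x y z by (simp add: U.m_assoc)
  also have "\<dots> = (sec x \<otimes>\<^bsub>U\<^esub> zp (?c y z)) \<otimes>\<^bsub>U\<^esub> sec ?yz"
    unfolding ext_cocycle(1)[OF y z] using sec(1) x yz by (simp add: U.m_assoc)
  also have "\<dots> = zp (?c y z) \<otimes>\<^bsub>U\<^esub> (sec x \<otimes>\<^bsub>U\<^esub> sec ?yz)"
    unfolding zp_central[OF sec(1)[OF x]] using sec(1) x yz by (simp add: U.m_assoc)
  also have "\<dots> = zp (?c y z + ?c x ?yz) \<otimes>\<^bsub>U\<^esub> sec ?xyz"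
    unfolding ext_cocycle(1)[OF x yz] using sec(1)[OF xyz] by (simp add: zp_add flip: U.m_assoc)
  finally have "(?c x y + ?c ?xy z) mod int p = (?c y z + ?c x ?yz) mod int p"
    unfolding zp_mult_cancel[OF sec(1)[OF xyz]] .
  then have "int p dvd (?c y z + ?c x ?yz) - (?c x y + ?c ?xy z)" unfolding mod_eq_dvd_iff by (simp add: dvd_diff_commute)
  then show "(?c y z - ?c ?xy z + ?c x ?yz - ?c x y) mod int p = 0"
    unfolding mod_eq_0_iff_dvd by (simp add: algebra_simps)
qed

end

locale coh_unm = lpc_coh G T p n + V: unm p n s for G (structure) and T p n s
begin

lemma pull_hom:
  assumes "\<rho>b \<in> cont_hom_fin Q TQ (Ubar p n s)"
  shows "coh_hom Q TQ (Ubar p n s) V.TUbar p \<rho>b"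
  using assms unfolding cont_hom_fin_def
  by (intro coh_hom.intro coh_hom_axioms.intro Q.coh_group_axioms V.B.coh_group_axioms) auto

lemma h2_pull_alpha:
  assumes "\<rho>b \<in> cont_hom_fin Q TQ (Ubar p n s)"
  shows "h2_pull Q TQ p \<rho>b (alpha p n s) = h2cls Q TQ p (pull Q \<rho>b (ext_cocycle p n s))"
    "pull Q \<rho>b (ext_cocycle p n s) \<in> Z2 Q TQ p"
  unfolding alpha_def
  using coh_hom.h2_pull_h2cls[OF pull_hom[OF assms] V.ext_cocycle_Z2] coh_hom.pull_Z2[OF pull_hom[OF assms] V.ext_cocycle_Z2]
  by auto

lemma unitriangular_elem:
  assumes "\<rho>b \<in> cont_hom_fin Q TQ (Ubar p n s)"
  shows "h2_pull Q TQ p \<rho>b (alpha p n s) \<in> unitriangular_elems Q TQ p n"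
  unfolding unitriangular_elems_def using assms V.s by (auto intro!: exI[of _ \<rho>b] exI[of _ s])

text \<open>Every lift of \<open>\<rho>b \<circ> \<pi>\<close> to \<open>V.U\<close> differs from the section by powers of \<open>zel\<close>, whose
  exponents are recorded by \<open>- f0\<close>.\<close>

lemma lift_hom_iff:
  assumes \<rho>b: "\<rho>b \<in> cont_hom_fin Q TQ (Ubar p n s)" and f0: "f0 \<in> cochain1 G T p"
    and \<rho>: "\<And>x. x \<in> carrier G \<Longrightarrow> \<rho> x = V.zp (- f0 x) \<otimes>\<^bsub>V.U\<^esub> V.sec (\<rho>b (M.\<pi> x))"
  shows "\<rho> \<in> hom G V.U \<longleftrightarrow> pull G M.\<pi> (pull Q \<rho>b (ext_cocycle p n s)) = coboundary G p f0"
proof -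
  let ?c = "ext_cocycle p n s" and ?s = "\<lambda>x. V.sec (\<rho>b (M.\<pi> x))"
  have \<rho>bh: "\<rho>b \<in> hom Q (Ubar p n s)" using \<rho>b unfolding cont_hom_fin_def by simp
  have \<rho>bc: "\<rho>b (M.\<pi> x) \<in> carrier (Ubar p n s)" if "x \<in> carrier G" for x
    using \<rho>bh proj_carrier[OF that] unfolding hom_def by auto
  have sc: "?s x \<in> carrier V.U" if "x \<in> carrier G" for x using V.sec(1)[OF \<rho>bc[OF that]] .
  have \<rho>c: "\<rho> x \<in> carrier V.U" if "x \<in> carrier G" for x using \<rho>[OF that] sc[OF that] by simp
  have iff: "\<rho> (x \<otimes> y) = \<rho> x \<otimes>\<^bsub>V.U\<^esub> \<rho> y \<longleftrightarrow> ?c (\<rho>b (M.\<pi> x)) (\<rho>b (M.\<pi> y)) = (f0 y - f0 (x \<otimes> y) + f0 x) mod int p"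
    if x: "x \<in> carrier G" and y: "y \<in> carrier G" for x y
  proof -
    let ?e = "?c (\<rho>b (M.\<pi> x)) (\<rho>b (M.\<pi> y))"
    have xy: "x \<otimes> y \<in> carrier G" using x y by simp
    have m: "\<rho>b (M.\<pi> (x \<otimes> y)) = \<rho>b (M.\<pi> x) \<otimes>\<^bsub>Ubar p n s\<^esub> \<rho>b (M.\<pi> y)"
      using P.\<rho>_mult[OF x y] hom_mult[OF \<rho>bh proj_carrier[OF x] proj_carrier[OF y]] by simp
    have "\<rho> x \<otimes>\<^bsub>V.U\<^esub> \<rho> y = V.zp (- f0 x) \<otimes>\<^bsub>V.U\<^esub> (?s x \<otimes>\<^bsub>V.U\<^esub> V.zp (- f0 y)) \<otimes>\<^bsub>V.U\<^esub> ?s y"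
      unfolding \<rho>[OF x] \<rho>[OF y] using sc[OF x] sc[OF y] by (simp add: V.U.m_assoc)
    also have "\<dots> = (V.zp (- f0 x) \<otimes>\<^bsub>V.U\<^esub> V.zp (- f0 y)) \<otimes>\<^bsub>V.U\<^esub> (?s x \<otimes>\<^bsub>V.U\<^esub> ?s y)"
      unfolding V.zp_central[OF sc[OF x]] using sc[OF x] sc[OF y] by (simp add: V.U.m_assoc)
    also have "\<dots> = (V.zp (- f0 x) \<otimes>\<^bsub>V.U\<^esub> V.zp (- f0 y) \<otimes>\<^bsub>V.U\<^esub> V.zp ?e) \<otimes>\<^bsub>V.U\<^esub> ?s (x \<otimes> y)"
      unfolding V.ext_cocycle(1)[OF \<rho>bc[OF x] \<rho>bc[OF y]] m[symmetric] using sc[OF xy] by (simp add: V.U.m_assoc)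
    also have "\<dots> = V.zp (- f0 x + - f0 y + ?e) \<otimes>\<^bsub>V.U\<^esub> ?s (x \<otimes> y)"
      by (simp only: V.zp_add)
    finally have "\<rho> (x \<otimes> y) = \<rho> x \<otimes>\<^bsub>V.U\<^esub> \<rho> y \<longleftrightarrow> (- f0 (x \<otimes> y)) mod int p = (- f0 x + - f0 y + ?e) mod int p"
      unfolding \<rho>[OF xy] by (simp only: V.zp_mult_cancel[OF sc[OF xy]])
    also have "\<dots> \<longleftrightarrow> ?e mod int p = (f0 y - f0 (x \<otimes> y) + f0 x) mod int p"
    proof -
      have "- f0 (x \<otimes> y) - (- f0 x + - f0 y + ?e) = - (?e - (f0 y - f0 (x \<otimes> y) + f0 x))" by simp
      then show ?thesis unfolding mod_eq_dvd_iff by (simp only: dvd_minus_iff)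
    qed
    also have "?e mod int p = ?e" using V.ext_cocycle(2)[OF \<rho>bc[OF x] \<rho>bc[OF y]] by simp
    finally show ?thesis .
  qed
  have pe: "pull G M.\<pi> (pull Q \<rho>b ?c) x y = ?c (\<rho>b (M.\<pi> x)) (\<rho>b (M.\<pi> y))"
    "coboundary G p f0 x y = (f0 y - f0 (x \<otimes> y) + f0 x) mod int p"
    if "x \<in> carrier G" "y \<in> carrier G" for x y
    using that proj_carrier by (auto simp: pull_def coboundary_def)
  show ?thesis
  proof
    assume h: "\<rho> \<in> hom G V.U"
    show "pull G M.\<pi> (pull Q \<rho>b ?c) = coboundary G p f0"
    proof (intro ext)
      fix x y
      show "pull G M.\<pi> (pull Q \<rho>b ?c) x y = coboundary G p f0 x y"
      proof (cases "x \<in> carrier G \<and> y \<in> carrier G")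
        case True
        then show ?thesis using pe[of x y] iff[of x y] hom_mult[OF h, of x y] by simp
      qed (auto simp: pull_def coboundary_def)
    qed
  next
    assume eq: "pull G M.\<pi> (pull Q \<rho>b ?c) = coboundary G p f0"
    show "\<rho> \<in> hom G V.U"
    proof (rule homI)
      show "\<rho> (x \<otimes> y) = \<rho> x \<otimes>\<^bsub>V.U\<^esub> \<rho> y" if "x \<in> carrier G" "y \<in> carrier G" for x y
        using iff[OF that] pe[OF that] eq by simp
    qed (rule \<rho>c)
  qed
qed

text \<open>On \<open>K\<close> the factor coming from the section is constant, so only the central
  exponent varies.\<close>

lemma kernel_of_lift:
  assumes \<rho>b: "\<rho>b \<in> cont_hom_fin Q TQ (Ubar p n s)" and h: "\<rho> \<in> hom G V.U"
    and \<rho>: "\<And>x. x \<in> carrier G \<Longrightarrow> \<rho> x = V.zp (- f0 x) \<otimes>\<^bsub>V.U\<^esub> V.sec (\<rho>b (M.\<pi> x))"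
    and k: "k \<in> K"
  shows "\<rho> k = \<one>\<^bsub>V.U\<^esub> \<longleftrightarrow> (f0 k - f0 \<one>) mod int p = 0"
proof -
  have \<rho>bh: "\<rho>b \<in> hom Q (Ubar p n s)" using \<rho>b unfolding cont_hom_fin_def by simp
  have kc: "k \<in> carrier G" using k lpc_carrier by auto
  have \<pi>k: "M.\<pi> k = M.\<pi> \<one>"
    using M.rcos_const[OF is_group k] M.rcos_const[OF is_group subgroup.one_closed[OF lpc_subgroup]] by simp
  have s1: "V.sec (\<rho>b (M.\<pi> \<one>)) \<in> carrier V.U"
    using \<rho>bh proj_carrier[OF one_closed] unfolding hom_def by (intro V.sec(1)) auto
  have "\<rho> \<one> = \<one>\<^bsub>V.U\<^esub>" using hom_one[OF h is_group V.U.is_group] .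
  then have "\<rho> k = \<one>\<^bsub>V.U\<^esub> \<longleftrightarrow> \<rho> k = \<rho> \<one>" by simp
  also have "\<dots> \<longleftrightarrow> (- f0 k) mod int p = (- f0 \<one>) mod int p"
    unfolding \<rho>[OF kc] \<rho>[OF one_closed] \<pi>k by (rule V.zp_mult_cancel[OF s1])
  also have "\<dots> \<longleftrightarrow> (f0 k - f0 \<one>) mod int p = 0"
    unfolding mod_eq_dvd_iff mod_eq_0_iff_dvd by (simp add: dvd_diff_commute)
  finally show ?thesis .
qed

text \<open>Since \<open>\<rho>\<close> sends \<open>K\<close> into \<open>V.F n\<close>, it induces
  a map from \<open>Q\<close> to \<open>Ubar p n s\<close> and is a lift of it; its central
  exponents cobound the inflated extension cocycle.\<close>

lemma unitriangular_of_hom: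
  assumes "\<rho> \<in> cont_hom_fin G T (Unm p n s)"
  obtains f where "f \<in> FF" "\<Theta> f \<in> unitriangular_elems Q TQ p n"
    "\<And>k. k \<in> K \<Longrightarrow> \<rho> k \<noteq> \<one>\<^bsub>Unm p n s\<^esub> \<Longrightarrow> f k \<noteq> 0"
proof -
  have h: "\<rho> \<in> hom G V.U" and c: "continuous_map T (discrete_topology (carrier V.U)) \<rho>"
    using assms unfolding cont_hom_fin_def V.Unm_eq by auto
  have \<rho>c: "\<rho> x \<in> carrier V.U" if "x \<in> carrier G" for x using h that unfolding hom_def by auto
  let ?h = "\<lambda>x. V.F n #>\<^bsub>V.U\<^esub> \<rho> x"
  have Ub: "V.F n #>\<^bsub>V.U\<^esub> A \<in> carrier (Ubar p n s)" if "A \<in> carrier V.U" for A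
    using that unfolding V.Ubar_eq carrier_FactGroup by auto
  have hh: "?h \<in> hom G (Ubar p n s)"
    using Group.hom_compose[OF h V.Fn.r_coset_hom_Mod] unfolding V.Ubar_eq by (simp add: o_def)
  have const: "?h x = ?h y" if xy: "x \<in> carrier G" "y \<in> carrier G" "M.\<pi> x = M.\<pi> y" for x y
  proof -
    have "x \<otimes> inv y \<in> K" using M.rcos_eq_iff xy by simp
    then have "\<rho> (x \<otimes> inv y) \<in> V.F n"
      using V.hom_Unm_lpc[OF top_group_axioms assms, of n] n by auto
    moreover interpret h: group_hom G V.U \<rho> by (intro group_hom.intro group_hom_axioms.intro is_group V.U.is_group h)
    have "\<rho> (x \<otimes> inv y) = \<rho> x \<otimes>\<^bsub>V.U\<^esub> inv\<^bsub>V.U\<^esub> \<rho> y" using xy by simp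
    ultimately show ?thesis using V.Fn.rcos_eq_iff \<rho>c xy by simp
  qed
  obtain \<rho>b where \<rho>b: "\<rho>b \<in> hom Q (Ubar p n s)" "\<And>x. x \<in> carrier G \<Longrightarrow> \<rho>b (M.\<pi> x) = ?h x"
    using FactGroup_universal[OF hh lpc_normal const] by blast
  have "continuous_map T V.TUbar ((\<lambda>A. V.F n #>\<^bsub>V.U\<^esub> A) \<circ> \<rho>)"
    using Ub by (intro continuous_map_compose[OF c] continuous_map_from_discrete) auto
  then have "continuous_map TQ V.TUbar \<rho>b"
    by (rule M.continuous_map_descend) (simp add: \<rho>b)
  with \<rho>b have \<rho>bc: "\<rho>b \<in> cont_hom_fin Q TQ (Ubar p n s)" unfolding cont_hom_fin_def by simp
  have "\<exists>a. A = V.zp a \<otimes>\<^bsub>V.U\<^esub> V.sec (V.F n #>\<^bsub>V.U\<^esub> A)" if "A \<in> carrier V.U" for A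
    using V.same_coset[OF that V.sec(1)[OF Ub[OF that]]] V.sec(2)[OF Ub[OF that]] by metis
  then obtain e where e: "\<And>A. A \<in> carrier V.U \<Longrightarrow> A = V.zp (e A) \<otimes>\<^bsub>V.U\<^esub> V.sec (V.F n #>\<^bsub>V.U\<^esub> A)" by metis
  \<comment> \<open>The negative sign makes \<open>f0\<close> cobound the inflated cocycle itself
    and not its negative.\<close>
  define f0 where "f0 = (\<lambda>x. if x \<in> carrier G then (- e (\<rho> x)) mod int p else 0)"
  have "continuous_map T (discrete_topology {0..<int p}) ((\<lambda>A. (- e A) mod int p) \<circ> \<rho>)"
    by (intro continuous_map_compose[OF c] continuous_map_from_discrete) auto
  then have "continuous_map T (discrete_topology {0..<int p}) f0"
    by (rule continuous_map_eq) (simp add: f0_def)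
  then have f0: "f0 \<in> cochain1 G T p" unfolding cochain1_def f0_def by simp
  have \<rho>eq: "\<rho> x = V.zp (- f0 x) \<otimes>\<^bsub>V.U\<^esub> V.sec (\<rho>b (M.\<pi> x))" if x: "x \<in> carrier G" for x
  proof -
    have "V.zp (- f0 x) = V.zp (e (\<rho> x))" unfolding V.zp_eq_iff using x by (simp add: f0_def mod_minus_eq)
    then show ?thesis using e[OF \<rho>c[OF x]] \<rho>b(2)[OF x] by simp
  qed
  have cob: "pull G M.\<pi> (pull Q \<rho>b (ext_cocycle p n s)) = coboundary G p f0"
    using lift_hom_iff[OF \<rho>bc f0 \<rho>eq] h by blast
  note th = \<Theta>_of_cobounding[OF h2_pull_alpha(2)[OF \<rho>bc] f0 cob]
  show ?thesis
  proof (rule that[OF th(1)])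
    show "\<Theta> (\<lambda>x. if x \<in> carrier G then (f0 x - f0 \<one>) mod int p else 0) \<in> unitriangular_elems Q TQ p n"
      unfolding th(2) h2_pull_alpha(1)[OF \<rho>bc, symmetric] by (rule unitriangular_elem[OF \<rho>bc])
    show "(if k \<in> carrier G then (f0 k - f0 \<one>) mod int p else 0) \<noteq> 0" if "k \<in> K" "\<rho> k \<noteq> \<one>\<^bsub>Unm p n s\<^esub>" for k
      using kernel_of_lift[OF \<rho>bc h \<rho>eq that(1)] that lpc_carrier unfolding V.Unm_eq by auto
  qed
qed

text \<open>The cocycle of \<open>f\<close> agrees with the pulled back extension cocycle only up to
  the coboundary of some \<open>u\<close>. Subtracting the inflation of \<open>u\<close> from
  \<open>f\<close> gives the exponents of an actual lift; this correction is constant on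
  \<open>K\<close>, so zeros of \<open>f\<close> there can be read off the lift.\<close>

lemma hom_of_unitriangular:
  assumes f: "f \<in> FF" and \<rho>b: "\<rho>b \<in> cont_hom_fin Q TQ (Ubar p n s)" and eq: "\<Theta> f = h2_pull Q TQ p \<rho>b (alpha p n s)"
  obtains \<rho> where "\<rho> \<in> cont_hom_fin G T (Unm p n s)" "\<And>k. k \<in> K \<Longrightarrow> \<rho> k = \<one>\<^bsub>Unm p n s\<^esub> \<Longrightarrow> f k = 0"
proof -
  let ?e = "pull Q \<rho>b (ext_cocycle p n s)"
  note e = h2_pull_alpha[OF \<rho>b]
  have "Q.csub (\<Theta>c f) ?e \<in> B2 Q TQ p"
    using eq Q.h2cls_eq_iff[OF \<Theta>c_Z2[OF f] e(2)] unfolding \<Theta>_def e(1) by simp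
  then obtain u where u: "u \<in> cochain1 Q TQ p" "Q.csub (\<Theta>c f) ?e = coboundary Q p u" unfolding B2_def by auto
  define v where "v = (\<lambda>x. if x \<in> carrier G then u (M.\<pi> x) else 0)"
  have v: "v \<in> cochain1 G T p" unfolding v_def by (rule P.pull_cochain1[OF u(1)])
  define f0 where "f0 = (\<lambda>x. if x \<in> carrier G then (f x - v x) mod int p else 0)"
  have f0: "f0 \<in> cochain1 G T p"
    unfolding f0_def using cochain1_comb[OF FF_cochain1[OF f] v, of "\<lambda>a b. a - b"] .
  have "csub (coboundary G p f) (pull G M.\<pi> ?e) = pull G M.\<pi> (Q.csub (\<Theta>c f) ?e)"
    unfolding pull_\<Theta>c[OF f, symmetric] by (intro ext) (simp add: pull_def Q.csub_def csub_def)
  also have "\<dots> = coboundary G p v" unfolding u(2) P.pull_coboundary v_def ..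
  finally have *: "csub (coboundary G p f) (pull G M.\<pi> ?e) = coboundary G p v" .
  have "pull G M.\<pi> ?e = csub (coboundary G p f) (csub (coboundary G p f) (pull G M.\<pi> ?e))"
  proof (intro ext)
    fix x y
    have "pull G M.\<pi> ?e x y mod int p = pull G M.\<pi> ?e x y"
      by (rule cochain2_mod[OF Z2_cochain2[OF P.pull_Z2[OF e(2)]]])
    then show "pull G M.\<pi> ?e x y = csub (coboundary G p f) (csub (coboundary G p f) (pull G M.\<pi> ?e)) x y"
      by (simp add: csub_def mod_diff_right_eq)
  qed
  also have "\<dots> = coboundary G p f0" unfolding * coboundary_sub f0_def ..
  finally have cob: "pull G M.\<pi> ?e = coboundary G p f0" .
  define \<rho> where "\<rho> = (\<lambda>x. V.zp (- f0 x) \<otimes>\<^bsub>V.U\<^esub> V.sec (\<rho>b (M.\<pi> x)))"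
  have h: "\<rho> \<in> hom G V.U" using lift_hom_iff[OF \<rho>b f0, of \<rho>] cob unfolding \<rho>_def by blast
  have \<rho>bt: "continuous_map T V.TUbar (\<rho>b \<circ> M.\<pi>)"
    using \<rho>b unfolding cont_hom_fin_def by (intro continuous_map_compose[OF M.continuous_map_proj]) auto
  have "continuous_map T (discrete_topology (carrier V.U)) (\<lambda>x. V.zp (- f0 x) \<otimes>\<^bsub>V.U\<^esub> V.sec ((\<rho>b \<circ> M.\<pi>) x))"
  proof (rule continuous_map_discrete_comp2[OF _ \<rho>bt, where F = "\<lambda>a c. V.zp (- a) \<otimes>\<^bsub>V.U\<^esub> V.sec c"])
    show "continuous_map T (discrete_topology {0..<int p}) f0" using f0 unfolding cochain1_def by simp
    show "V.zp (- f0 x) \<otimes>\<^bsub>V.U\<^esub> V.sec ((\<rho>b \<circ> M.\<pi>) x) \<in> carrier V.U" if "x \<in> topspace T" for x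
      using that h unfolding \<rho>_def hom_def by auto
  qed
  then have "\<rho> \<in> cont_hom_fin G T (Unm p n s)"
    using h unfolding cont_hom_fin_def V.Unm_eq \<rho>_def by (simp add: o_def)
  moreover have "f k = 0" if k: "k \<in> K" "\<rho> k = \<one>\<^bsub>Unm p n s\<^esub>" for k
  proof -
    have kc: "k \<in> carrier G" using k lpc_carrier by auto
    have "(f0 k - f0 \<one>) mod int p = 0"
      using kernel_of_lift[OF \<rho>b h _ k(1), of f0] k(2) unfolding V.Unm_eq \<rho>_def by simp
    moreover have "v k = v \<one>"
      using kc M.rcos_const[OF is_group k(1)] M.rcos_const[OF is_group subgroup.one_closed[OF lpc_subgroup]]
      by (simp add: v_def)
    ultimately have "((f k - v \<one>) mod int p - (0 - v \<one>) mod int p) mod int p = 0"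
      using kc FF_one[OF f] unfolding f0_def by simp
    then have "f k mod int p = 0" unfolding mod_diff_eq by simp
    then show ?thesis using cochain1_mod[OF FF_cochain1[OF f] kc] by simp
  qed
  ultimately show ?thesis using that by blast
qed

end

section \<open>Duality\<close>

lemma bezout_prime:
  assumes "prime (p::nat)" "\<not> p dvd j"
  obtains x y where "j * x = p * y + 1"
proof -
  have "j \<noteq> 0" using assms(2) by (metis dvd_0_right)
  moreover have "gcd j p = 1" using assms by (metis coprime_iff_gcd_eq_1 gcd.commute prime_imp_coprime)
  ultimately show ?thesis using bezout_nat[of j p] that by auto
qed

text \<open>Let \<open>H\<close> be maximal among the subgroups between \<open>L\<close> and
  \<open>N\<close> that avoid \<open>g\<close>. Then \<open>N\<close> modulo \<open>H\<close> is
  cyclic of order \<open>p\<close> generated by \<open>g\<close>, which gives a character with value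
  one at \<open>g\<close>. It is invariant because commutators lie in \<open>L\<close>, and
  representatives of the cosets of \<open>N\<close> extend it.\<close>

lemma (in group) finite_character:
  assumes fin: "finite (carrier G)" and N: "N \<lhd> G" and L: "subgroup L G" "L \<subseteq> N"
    and comm: "\<And>x k. x \<in> carrier G \<Longrightarrow> k \<in> N \<Longrightarrow> gcomm G x k \<in> L"
    and pow: "\<And>k. k \<in> N \<Longrightarrow> k [^] p \<in> L"
    and g: "g \<in> N" "g \<notin> L" and p: "prime p"
  shows "\<exists>f. (\<forall>x. f x \<in> {0..<int p}) \<and> f g \<noteq> 0 \<and> (\<forall>k\<in>N. \<forall>y\<in>carrier G.
     f (k \<otimes> y) = (f k + f y) mod int p \<and> f (y \<otimes> k) = (f y + f k) mod int p)"
proof -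
  interpret N: normal N G by (rule N)
  define HH where "HH = {H. subgroup H G \<and> L \<subseteq> H \<and> H \<subseteq> N \<and> g \<notin> H}"
  have "HH \<subseteq> Pow (carrier G)" unfolding HH_def using subgroup.subset by blast
  then have "finite HH" using fin finite_subset by blast
  moreover have "HH \<noteq> {}" unfolding HH_def using L g by blast
  ultimately obtain H where H: "H \<in> HH" "\<And>H'. H' \<in> HH \<Longrightarrow> H \<subseteq> H' \<Longrightarrow> H = H'"
    using finite_has_maximal[of HH] by blast
  have Hs: "subgroup H G" "L \<subseteq> H" "H \<subseteq> N" "g \<notin> H" using H(1) unfolding HH_def by auto
  have Nc: "x \<in> carrier G" if "x \<in> N" for x using that N.mem_carrier by auto
  have gc: "g \<in> carrier G" using g Nc by auto
  have "H \<lhd> G"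
    unfolding normal_inv_iff
  proof (intro conjI ballI Hs(1))
    fix x h assume x: "x \<in> carrier G" and h: "h \<in> H"
    have hN: "h \<in> N" "h \<in> carrier G" using h Hs Nc by auto
    have "x \<otimes> h \<otimes> inv x = gcomm G x h \<otimes> h" unfolding gcomm_def using x hN by (simp add: m_assoc)
    moreover have "gcomm G x h \<in> H" using comm[OF x hN(1)] Hs by auto
    ultimately show "x \<otimes> h \<otimes> inv x \<in> H" using h subgroup.m_closed[OF Hs(1)] by metis
  qed
  then interpret H: normal H G .
  let ?\<pi> = "\<lambda>x. H #> x"
  interpret \<pi>: group_hom G "G Mod H" ?\<pi>
    by (intro group_hom.intro group_hom_axioms.intro is_group H.factorgroup_is_group H.r_coset_hom_Mod)
  have powH: "?\<pi> (k [^] (p * m + j)) = ?\<pi> (k [^] j)" if k: "k \<in> N" for k and m j :: nat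
  proof -
    have kc: "k \<in> carrier G" using k Nc by auto
    have "(k [^] p) [^] m \<in> H" using pow[OF k] Hs nat_pow_in_subgroup[OF Hs(1)] by blast
    then have "k [^] (p * m) \<in> H" using kc by (simp add: nat_pow_pow)
    then have "?\<pi> (k [^] (p * m)) = \<one>\<^bsub>G Mod H\<^esub>" using H.rcos_const[OF is_group] by simp
    moreover have "k [^] (p * m + j) = k [^] (p * m) \<otimes> k [^] j" using kc by (simp add: nat_pow_mult)
    ultimately show ?thesis using kc by (simp only: \<pi>.hom_mult nat_pow_closed \<pi>.H.l_one \<pi>.hom_closed)
  qed
  have in_H: "x \<in> H \<longleftrightarrow> ?\<pi> x = ?\<pi> \<one>" if "x \<in> carrier G" for x
    using H.rcos_eq_iff[OF that one_closed] that by simp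
  have cover: "\<exists>t::nat. ?\<pi> h = ?\<pi> (g [^] t)" if h: "h \<in> N" for h
  proof (cases "h \<in> H")
    case True
    then have "?\<pi> h = ?\<pi> (g [^] (0::nat))" using in_H h Nc by simp
    then show ?thesis by blast
  next
    case False
    have hc: "h \<in> carrier G" using h Nc by auto
    \<comment> \<open>\<open>H\<close> with \<open>h\<close> adjoined. By maximality it contains
      \<open>g\<close>, so \<open>g\<close> is a power of \<open>h\<close> modulo \<open>H\<close>;
      the exponent is prime to \<open>p\<close> and the relation can be inverted.\<close>
    define H' where "H' = {x \<in> carrier G. \<exists>j::nat. ?\<pi> x = ?\<pi> (h [^] j)}"
    have "subgroup H' G"
    proof (rule finite_submonoid_subgroup)
      show "finite H'" unfolding H'_def using fin by simp
      show "\<one> \<in> H'" unfolding H'_def by (auto intro!: exI[of _ 0])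
      fix x y assume "x \<in> H'" "y \<in> H'"
      then obtain i j :: nat where x: "x \<in> carrier G" "?\<pi> x = ?\<pi> (h [^] i)" and y: "y \<in> carrier G" "?\<pi> y = ?\<pi> (h [^] j)"
        unfolding H'_def by auto
      have "?\<pi> (x \<otimes> y) = ?\<pi> (h [^] i) \<otimes>\<^bsub>G Mod H\<^esub> ?\<pi> (h [^] j)"
        using \<pi>.hom_mult[OF x(1) y(1)] by (simp only: x(2) y(2))
      also have "\<dots> = ?\<pi> (h [^] (i + j))"
        using hc by (simp only: \<pi>.hom_mult[symmetric] nat_pow_closed nat_pow_mult)
      finally show "x \<otimes> y \<in> H'" unfolding H'_def using x y by blast
    qed (auto simp: H'_def)
    moreover have "H \<subseteq> H'"
    proof
      fix x assume x: "x \<in> H"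
      then have xc: "x \<in> carrier G" by (rule H.mem_carrier)
      then have "?\<pi> x = ?\<pi> \<one>" using x in_H by blast
      then have "?\<pi> x = ?\<pi> (h [^] (0::nat))" by (simp only: nat_pow_0)
      with xc show "x \<in> H'" unfolding H'_def by blast
    qed
    moreover have "H' \<subseteq> N"
    proof
      fix x assume "x \<in> H'"
      then obtain j :: nat where x: "x \<in> carrier G" "?\<pi> x = ?\<pi> (h [^] j)" unfolding H'_def by auto
      have "x \<otimes> inv (h [^] j) \<in> N" using H.rcos_eq_iff[OF x(1) nat_pow_closed[OF hc]] x(2) Hs(3) by blast
      moreover have "h [^] j \<in> N" using nat_pow_in_subgroup[OF N.is_subgroup h] .
      ultimately have "(x \<otimes> inv (h [^] j)) \<otimes> h [^] j \<in> N" by (rule N.m_closed)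
      then show "x \<in> N" using x hc by (simp add: m_assoc)
    qed
    moreover have "h \<in> H'" unfolding H'_def using hc by (auto intro!: exI[of _ 1])
    ultimately have "g \<in> H'" using H(2)[of H'] Hs False unfolding HH_def by blast
    then obtain j :: nat where j: "?\<pi> g = ?\<pi> (h [^] j)" unfolding H'_def by auto
    have "\<not> p dvd j"
    proof
      assume "p dvd j"
      then obtain m where "j = p * m + 0" by auto
      then have "?\<pi> g = ?\<pi> \<one>" using j powH[OF h, of m 0] by simp
      then show False using in_H gc Hs(4) by simp
    qed
    then obtain x y where xy: "j * x = p * y + 1" using bezout_prime[OF p] by blast
    have "?\<pi> (g [^] x) = ?\<pi> g [^]\<^bsub>G Mod H\<^esub> x" by (rule \<pi>.hom_nat_pow[OF gc])
    also have "\<dots> = ?\<pi> ((h [^] j) [^] x)" unfolding j using hc by (intro \<pi>.hom_nat_pow[symmetric]) simp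
    also have "(h [^] j) [^] x = h [^] (p * y + 1)" using hc xy by (simp add: nat_pow_pow)
    also have "?\<pi> (h [^] (p * y + 1)) = ?\<pi> h" using powH[OF h, of y 1] hc by simp
    finally show ?thesis by metis
  qed
  have uniq: "t mod p = t' mod p" if eq: "?\<pi> (g [^] t) = ?\<pi> (g [^] t')" for t t' :: nat
  proof -
    have *: "p dvd d" if d: "?\<pi> (g [^] d) = ?\<pi> \<one>" for d :: nat
    proof (rule ccontr)
      assume "\<not> p dvd d"
      then obtain x y where xy: "d * x = p * y + 1" using bezout_prime[OF p] by blast
      have "g [^] d \<in> H" using in_H gc d by simp
      then have "(g [^] d) [^] x \<in> H" using nat_pow_in_subgroup[OF Hs(1)] by blast
      then have "?\<pi> (g [^] (p * y + 1)) = ?\<pi> \<one>" using in_H gc xy by (simp add: nat_pow_pow)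
      then have "?\<pi> g = ?\<pi> \<one>" using powH[OF g(1), of y 1] gc by simp
      then show False using in_H gc Hs(4) by simp
    qed
    have le: "t mod p = t' mod p" if "t \<le> t'" "?\<pi> (g [^] t) = ?\<pi> (g [^] t')" for t t' :: nat
    proof -
      obtain d where d: "t' = t + d" using \<open>t \<le> t'\<close> le_Suc_ex by blast
      have "?\<pi> (g [^] t') = ?\<pi> (g [^] t) \<otimes>\<^bsub>G Mod H\<^esub> ?\<pi> (g [^] d)"
        unfolding d using gc by (simp only: nat_pow_mult[symmetric] \<pi>.hom_mult nat_pow_closed)
      then have "?\<pi> (g [^] t) \<otimes>\<^bsub>G Mod H\<^esub> ?\<pi> (g [^] d) = ?\<pi> (g [^] t)" using that(2) by simp
      then have "?\<pi> (g [^] d) = \<one>\<^bsub>G Mod H\<^esub>"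
        using gc by (simp only: \<pi>.H.r_cancel_one' \<pi>.H.r_cancel_one \<pi>.H.l_cancel_one \<pi>.hom_closed nat_pow_closed)
      then have "p dvd d" using *[of d] \<pi>.hom_one by simp
      then show ?thesis unfolding d by auto
    qed
    show ?thesis
    proof (cases "t \<le> t'")
      case True
      then show ?thesis using eq by (rule le)
    next
      case False
      then have "t' \<le> t" by simp
      then show ?thesis using eq[symmetric] by (rule le[symmetric])
    qed
  qed
  define \<phi> where "\<phi> h = int ((SOME t::nat. ?\<pi> h = ?\<pi> (g [^] t)) mod p)" for h
  have \<phi>: "\<phi> h = int t mod int p" if "?\<pi> h = ?\<pi> (g [^] t)" for h and t :: nat
  proof -
    have "?\<pi> h = ?\<pi> (g [^] (SOME t::nat. ?\<pi> h = ?\<pi> (g [^] t)))" using that by (rule someI)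
    then have "(SOME t::nat. ?\<pi> h = ?\<pi> (g [^] t)) mod p = t mod p" using that uniq by metis
    then show ?thesis unfolding \<phi>_def by (simp add: zmod_int)
  qed
  have \<phi>_add: "\<phi> (k \<otimes> l) = (\<phi> k + \<phi> l) mod int p" if k: "k \<in> N" and l: "l \<in> N" for k l
  proof -
    obtain t u :: nat where t: "?\<pi> k = ?\<pi> (g [^] t)" and u: "?\<pi> l = ?\<pi> (g [^] u)" using cover k l by meson
    have "?\<pi> (k \<otimes> l) = ?\<pi> (g [^] t) \<otimes>\<^bsub>G Mod H\<^esub> ?\<pi> (g [^] u)"
      using \<pi>.hom_mult[OF Nc[OF k] Nc[OF l]] by (simp only: t u)
    also have "\<dots> = ?\<pi> (g [^] (t + u))" using gc by (simp only: \<pi>.hom_mult[symmetric] nat_pow_closed nat_pow_mult)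
    finally have "\<phi> (k \<otimes> l) = int (t + u) mod int p" by (rule \<phi>)
    then show ?thesis unfolding \<phi>[OF t] \<phi>[OF u] by (simp add: mod_add_eq)
  qed
  have \<phi>_conj: "\<phi> (y \<otimes> k \<otimes> inv y) = \<phi> k" if y: "y \<in> carrier G" and k: "k \<in> N" for y k
  proof -
    have kc: "k \<in> carrier G" using k Nc by auto
    have "(y \<otimes> k \<otimes> inv y) \<otimes> inv k \<in> H" using comm[OF y k] Hs unfolding gcomm_def by auto
    moreover have "y \<otimes> k \<otimes> inv y \<in> carrier G" using y kc by simp
    ultimately have "?\<pi> (y \<otimes> k \<otimes> inv y) = ?\<pi> k" using H.rcos_eq_iff[OF _ kc] by blast
    then show ?thesis unfolding \<phi>_def by simp
  qed
  \<comment> \<open>The representative depends only on the coset, so left multiplication by an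
    element of \<open>N\<close> changes \<open>f'\<close> by exactly the character.\<close>
  define r where "r y = (SOME z. z \<in> N #> y)" for y
  have r: "r y \<in> carrier G" "y \<otimes> inv (r y) \<in> N" if y: "y \<in> carrier G" for y
  proof -
    have "y \<in> N #> y" by (rule rcos_self[OF y N.is_subgroup])
    then have *: "r y \<in> N #> y" unfolding r_def by (rule someI)
    show rc: "r y \<in> carrier G" by (rule N.elemrcos_carrier[OF is_group y *])
    have "N #> y = N #> r y" by (rule repr_independence[OF * y N.is_subgroup])
    then show "y \<otimes> inv (r y) \<in> N" using N.rcos_eq_iff[OF y rc] by simp
  qed
  have r_shift: "r (k \<otimes> y) = r y" if "k \<in> N" "y \<in> carrier G" for k y
  proof -
    have "N #> (k \<otimes> y) = N #> y" using that Nc N.rcos_eq_iff[of "k \<otimes> y" y] by (simp add: m_assoc)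
    then show ?thesis unfolding r_def by simp
  qed
  define f' where "f' y = \<phi> (y \<otimes> inv (r y))" for y
  have f'_add: "f' (k \<otimes> y) = (\<phi> k + f' y) mod int p" if k: "k \<in> N" and y: "y \<in> carrier G" for k y
  proof -
    have "(k \<otimes> y) \<otimes> inv (r (k \<otimes> y)) = k \<otimes> (y \<otimes> inv (r y))"
      unfolding r_shift[OF k y] using k y Nc r(1)[OF y] by (simp add: m_assoc)
    then show ?thesis unfolding f'_def using \<phi>_add[OF k r(2)[OF y]] by simp
  qed
  \<comment> \<open>The representative of \<open>N\<close> itself may differ from the neutral
    element; subtracting \<open>f' \<one>\<close> corrects this.\<close>
  define f where "f y = (f' y - f' \<one>) mod int p" for y
  have p0: "0 < p" using prime_gt_0_nat[OF p] .
  have f_add: "f (k \<otimes> y) = (\<phi> k + f y) mod int p" if k: "k \<in> N" and y: "y \<in> carrier G" for k y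
  proof -
    have "f (k \<otimes> y) = (\<phi> k + f' y - f' \<one>) mod int p"
      unfolding f_def f'_add[OF k y] by (rule mod_diff_left_eq)
    also have "\<dots> = (\<phi> k + (f' y - f' \<one>)) mod int p" by (simp add: algebra_simps)
    also have "\<dots> = (\<phi> k + f y) mod int p" unfolding f_def by (rule mod_add_right_eq[symmetric])
    finally show ?thesis .
  qed
  have f_N: "f k = \<phi> k" if k: "k \<in> N" for k
  proof -
    have "f (k \<otimes> \<one>) = (\<phi> k + f \<one>) mod int p" by (rule f_add[OF k one_closed])
    moreover have "f \<one> = 0" unfolding f_def by simp
    moreover have "\<phi> k mod int p = \<phi> k" unfolding \<phi>_def using p0 by simp
    ultimately show ?thesis using Nc[OF k] by simp
  qed
  have "f (k \<otimes> y) = (f k + f y) mod int p" "f (y \<otimes> k) = (f y + f k) mod int p"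
    if k: "k \<in> N" and y: "y \<in> carrier G" for k y
  proof -
    show "f (k \<otimes> y) = (f k + f y) mod int p" using f_add[OF k y] f_N[OF k] by simp
    have "(y \<otimes> k \<otimes> inv y) \<otimes> y = y \<otimes> k" using y Nc[OF k] by (simp add: m_assoc)
    then have "f (y \<otimes> k) = (\<phi> (y \<otimes> k \<otimes> inv y) + f y) mod int p"
      using f_add[OF N.inv_op_closed2[OF y k] y] by simp
    then show "f (y \<otimes> k) = (f y + f k) mod int p" using \<phi>_conj[OF y k] f_N[OF k] by (simp add: add.commute)
  qed
  moreover have "f g = 1"
  proof -
    have "?\<pi> g = ?\<pi> (g [^] (1::nat))" using gc by simp
    then show ?thesis using \<phi>[of g 1] f_N[OF g(1)] prime_gt_1_nat[OF p] by simp
  qed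
  moreover have "f x \<in> {0..<int p}" for x unfolding f_def using p0 by simp
  ultimately show ?thesis by (intro exI[of _ f]) auto
qed

section \<open>Functions on K: separation of points and generation of the kernel of
  inflation\<close>

context lpc_coh
begin

text \<open>In a suitable finite quotient \<open>g\<close> stays outside the image of the next term,
  so \<open>finite_character\<close> applies there; its inflation is locally constant and hence
  continuous.\<close>

lemma FF_separates:
  assumes g: "g \<in> K" "g \<notin> lpc G T p (Suc n)"
  obtains f where "f \<in> FF" "f g \<noteq> 0"
proof -
  let ?L = "lpc G T p (Suc n)"
  have gc: "g \<in> carrier G" using g lpc_carrier by auto
  obtain W where W: "W \<lhd> G" "openin T W" "\<forall>w\<in>W. w \<otimes> g \<notin> ?L"
    using closed_separation[OF lpc_closed gc g(2)] by blast
  interpret W: normal W G by (rule W)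
  let ?\<pi> = "\<lambda>x. W #> x"
  interpret \<pi>: group_hom G "G Mod W" ?\<pi>
    by (intro group_hom.intro group_hom_axioms.intro is_group W.factorgroup_is_group W.r_coset_hom_Mod)
  have "\<exists>f. (\<forall>x. f x \<in> {0..<int p}) \<and> f (?\<pi> g) \<noteq> 0 \<and> (\<forall>k\<in>?\<pi> ` K. \<forall>y\<in>carrier (G Mod W).
     f (k \<otimes>\<^bsub>G Mod W\<^esub> y) = (f k + f y) mod int p \<and> f (y \<otimes>\<^bsub>G Mod W\<^esub> k) = (f y + f k) mod int p)"
  proof (rule \<pi>.H.finite_character[OF _ _ _ _ _ _ _ _ prime])
    show "finite (carrier (G Mod W))"
      using finite_rcosets[OF W.is_subgroup W(2)] by (simp add: FactGroup_def)
    show "?\<pi> ` K \<lhd> G Mod W"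
      unfolding \<pi>.H.normal_inv_iff
    proof (intro conjI ballI)
      show "subgroup (?\<pi> ` K) (G Mod W)" by (rule \<pi>.subgroup_img_is_subgroup[OF lpc_subgroup])
      fix x h assume x: "x \<in> carrier (G Mod W)" and h: "h \<in> ?\<pi> ` K"
      obtain y k where y: "y \<in> carrier G" "x = ?\<pi> y" and k: "k \<in> K" "h = ?\<pi> k"
        using x h unfolding carrier_FactGroup by auto
      have "x \<otimes>\<^bsub>G Mod W\<^esub> h \<otimes>\<^bsub>G Mod W\<^esub> inv\<^bsub>G Mod W\<^esub> x = ?\<pi> (y \<otimes> k \<otimes> inv y)"
        unfolding y k using y lpc_carrier[OF k(1)] by (simp only: \<pi>.hom_mult \<pi>.hom_inv m_closed inv_closed)
      then show "x \<otimes>\<^bsub>G Mod W\<^esub> h \<otimes>\<^bsub>G Mod W\<^esub> inv\<^bsub>G Mod W\<^esub> x \<in> ?\<pi> ` K"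
        using M.inv_op_closed2[OF y(1) k(1)] by blast
    qed
    show "subgroup (?\<pi> ` ?L) (G Mod W)" by (rule \<pi>.subgroup_img_is_subgroup[OF lpc_subgroup])
    show "?\<pi> ` ?L \<subseteq> ?\<pi> ` K" using lpc_Suc_subset by blast
    show "gcomm (G Mod W) x k \<in> ?\<pi> ` ?L" if xk: "x \<in> carrier (G Mod W)" "k \<in> ?\<pi> ` K" for x k
    proof -
      obtain y l where y: "y \<in> carrier G" "x = ?\<pi> y" and l: "l \<in> K" "k = ?\<pi> l"
        using xk unfolding carrier_FactGroup by auto
      have "gcomm (G Mod W) x k = ?\<pi> (gcomm G y l)"
        unfolding y l gcomm_def using y lpc_carrier[OF l(1)] by (simp only: \<pi>.hom_mult \<pi>.hom_inv m_closed inv_closed)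
      then show ?thesis using lpc_gcomm[of n y l p] y l n by auto
    qed
    show "k [^]\<^bsub>G Mod W\<^esub> p \<in> ?\<pi> ` ?L" if k: "k \<in> ?\<pi> ` K" for k
    proof -
      obtain l where l: "l \<in> K" "k = ?\<pi> l" using k by auto
      have "k [^]\<^bsub>G Mod W\<^esub> p = ?\<pi> (l [^] p)" unfolding l using lpc_carrier[OF l(1)] by (simp only: \<pi>.hom_nat_pow)
      then show ?thesis using lpc_pow[of n l p] l n by auto
    qed
    show "?\<pi> g \<in> ?\<pi> ` K" using g by blast
    show "?\<pi> g \<notin> ?\<pi> ` ?L"
    proof
      assume "?\<pi> g \<in> ?\<pi> ` ?L"
      then obtain l where l: "l \<in> ?L" "?\<pi> l = ?\<pi> g" by auto
      have lc: "l \<in> carrier G" using l lpc_carrier by auto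
      have "l \<otimes> inv g \<in> W" using W.rcos_eq_iff[OF lc gc] l by simp
      moreover have "(l \<otimes> inv g) \<otimes> g = l" using lc gc by (simp add: m_assoc)
      ultimately show False using W(3) l by metis
    qed
  qed
  then obtain fb where fb: "\<And>x. fb x \<in> {0..<int p}" "fb (?\<pi> g) \<noteq> 0"
    "\<And>k y. k \<in> ?\<pi> ` K \<Longrightarrow> y \<in> carrier (G Mod W) \<Longrightarrow>
     fb (k \<otimes>\<^bsub>G Mod W\<^esub> y) = (fb k + fb y) mod int p \<and> fb (y \<otimes>\<^bsub>G Mod W\<^esub> k) = (fb y + fb k) mod int p"
    by blast
  define f where "f = (\<lambda>x. if x \<in> carrier G then fb (?\<pi> x) else 0)"
  have "continuous_map T (discrete_topology {0..<int p}) f"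
  proof (rule continuous_map_locally_constant[OF W.is_subgroup W(2)])
    show "f (h \<otimes> x) = f x" if "h \<in> W" "x \<in> carrier G" for h x
    proof -
      have "(h \<otimes> x) \<otimes> inv x \<in> W" using that W.mem_carrier by (simp add: m_assoc)
      then have "?\<pi> (h \<otimes> x) = ?\<pi> x" using that W.mem_carrier W.rcos_eq_iff[of "h \<otimes> x" x] by blast
      then show ?thesis unfolding f_def using that W.mem_carrier by simp
    qed
    show "f ` carrier G \<subseteq> {0..<int p}" unfolding f_def using fb(1) by auto
  qed
  then have "f \<in> cochain1 G T p" unfolding cochain1_def f_def by simp
  moreover have "additive_on K f"
    unfolding additive_on_def
  proof (intro ballI)
    fix k y assume k: "k \<in> K" and y: "y \<in> carrier G"
    have kc: "k \<in> carrier G" using k lpc_carrier by auto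
    show "f (k \<otimes> y) = (f k + f y) mod int p \<and> f (y \<otimes> k) = (f y + f k) mod int p"
      using fb(3)[of "?\<pi> k" "?\<pi> y"] k y kc \<pi>.hom_closed[OF y] \<pi>.hom_mult[OF kc y] \<pi>.hom_mult[OF y kc]
      unfolding f_def by simp
  qed
  moreover have "f g \<noteq> 0" unfolding f_def using fb(2) gc by simp
  ultimately show ?thesis using that unfolding FF_def by blast
qed

lemma FF_pow:
  assumes f: "f \<in> FF" and k: "k \<in> K"
  shows "f (k [^] q) = (int q * f k) mod int p"
proof (induction q)
  case 0
  then show ?case using FF_one[OF f] by simp
next
  case (Suc q)
  have "f (k [^] Suc q) = (f (k [^] q) + f k) mod int p"
    using FF_add[OF f nat_pow_in_subgroup[OF lpc_subgroup k] lpc_carrier[OF k]] by simp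
  also have "\<dots> = (int q * f k + f k) mod int p" unfolding Suc by (rule mod_add_left_eq)
  also have "int q * f k + f k = int (Suc q) * f k" by (simp add: algebra_simps)
  finally show ?case .
qed

abbreviation "UE \<equiv> unitriangular_elems Q TQ p n"
abbreviation "Gen \<equiv> generate (H2 Q TQ p) (Ker \<inter> UE)"

lemma Ker_carrier: "Ker \<subseteq> carrier (H2 Q TQ p)"
  unfolding Ker_def by blast

lemma Gen_subgroup: "subgroup Gen (H2 Q TQ p)"
  using Ker_carrier by (intro group.generate_is_subgroup[OF Q.group_H2]) blast

lemma \<Theta>_Ker: "f \<in> FF \<Longrightarrow> \<Theta> f \<in> Ker"
  unfolding Ker_eq by blast

text \<open>Needed for two sets: the empty one, which gives the kernel of inflation, and a single
  point \<open>g\<close>, which gives the classes whose functions vanish at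
  \<open>g\<close>.\<close>

lemma \<Theta>_image_subgroup: "subgroup (\<Theta> ` {h \<in> FF. \<forall>x\<in>X. h x = 0}) (H2 Q TQ p)"
proof -
  interpret H: group "H2 Q TQ p" by (rule Q.group_H2)
  let ?S = "{h \<in> FF. \<forall>x\<in>X. h x = 0}"
  show ?thesis
  proof (rule H.subgroupI)
    show "\<Theta> ` ?S \<subseteq> carrier (H2 Q TQ p)" using \<Theta>_Ker Ker_carrier by blast
    have "(\<lambda>x. 0) \<in> ?S" using FF_zero by simp
    then show "\<Theta> ` ?S \<noteq> {}" by blast
    fix A assume "A \<in> \<Theta> ` ?S"
    then obtain f where f: "f \<in> FF" "\<forall>x\<in>X. f x = 0" "A = \<Theta> f" by blast
    let ?h = "\<lambda>x. if x \<in> carrier G then (0 - 1 * f x) mod int p else 0"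
    have h: "?h \<in> FF" using FF_lin[OF FF_zero f(1), of 1] .
    have "(\<lambda>x. if x \<in> carrier G then (?h x + f x) mod int p else 0) = (\<lambda>x. 0)"
      by (intro ext) (simp add: mod_add_left_eq)
    then have "\<Theta> ?h \<otimes>\<^bsub>H2 Q TQ p\<^esub> \<Theta> f = \<one>\<^bsub>H2 Q TQ p\<^esub>"
      using \<Theta>_plus[OF h f(1)] \<Theta>_zero by simp
    then have "inv\<^bsub>H2 Q TQ p\<^esub> A = \<Theta> ?h"
      unfolding f(3) using \<Theta>_Ker h f(1) Ker_carrier by (intro H.inv_equality) auto
    moreover have "?h \<in> ?S" using h f(2) by simp
    ultimately show "inv\<^bsub>H2 Q TQ p\<^esub> A \<in> \<Theta> ` ?S" by blast
    fix B assume "B \<in> \<Theta> ` ?S"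
    then obtain g where g: "g \<in> FF" "\<forall>x\<in>X. g x = 0" "B = \<Theta> g" by blast
    have "(\<lambda>x. if x \<in> carrier G then (f x + g x) mod int p else 0) \<in> ?S"
      using FF_plus[OF f(1) g(1)] f(2) g(2) by simp
    then show "A \<otimes>\<^bsub>H2 Q TQ p\<^esub> B \<in> \<Theta> ` ?S"
      unfolding f(3) g(3) \<Theta>_plus[OF f(1) g(1), symmetric] by blast
  qed
qed

lemma Ker_subgroup: "subgroup Ker (H2 Q TQ p)"
  using \<Theta>_image_subgroup[of "{}"] unfolding Ker_eq by simp

lemma Gen_subset_Ker: "Gen \<subseteq> Ker"
  by (rule group.generate_subgroup_incl[OF Q.group_H2 _ Ker_subgroup]) blast

abbreviation lin where
  "lin f g c \<equiv> (\<lambda>x. if x \<in> carrier G then (f x - int c * g x) mod int p else 0)"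

lemma Gen_of_lin:
  assumes f: "f \<in> FF" and g: "g \<in> FF" "\<Theta> g \<in> Gen"
  shows "\<Theta> (lin f g c) \<in> Gen \<Longrightarrow> \<Theta> f \<in> Gen"
proof (induction c)
  case 0
  have "lin f g 0 = f"
    using cochain1_mod[OF FF_cochain1[OF f]] FF_cochain1[OF f] unfolding cochain1_def by (intro ext) auto
  then show ?case using 0 by simp
next
  case (Suc c)
  have "(\<lambda>x. if x \<in> carrier G then (lin f g (Suc c) x + g x) mod int p else 0) = lin f g c"
  proof (intro ext)
    fix x
    have "((f x - int (Suc c) * g x) mod int p + g x) mod int p = (f x - int (Suc c) * g x + g x) mod int p"
      by (rule mod_add_left_eq)
    also have "f x - int (Suc c) * g x + g x = f x - int c * g x" by (simp add: algebra_simps)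
    finally show "(if x \<in> carrier G then (lin f g (Suc c) x + g x) mod int p else 0) = lin f g c x" by simp
  qed
  then have "\<Theta> (lin f g c) = \<Theta> (lin f g (Suc c)) \<otimes>\<^bsub>H2 Q TQ p\<^esub> \<Theta> g"
    using \<Theta>_plus[OF FF_lin[OF f g(1), of "int (Suc c)"] g(1)] by simp
  then have "\<Theta> (lin f g c) \<in> Gen" using Suc.prems g(2) subgroup.m_closed[OF Gen_subgroup] by simp
  then show ?case by (rule Suc.IH)
qed

lemma solve_mod_prime:
  assumes "a \<in> {0..<int p}" "a \<noteq> 0" "0 \<le> b"
  obtains t :: nat where "int p dvd int t * a - b"
proof -
  have a: "int (nat a) = a" using assms by simp
  have "0 < nat a" "nat a < p" using assms by auto
  then have "\<not> p dvd nat a" by (rule nat_dvd_not_less)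
  then obtain x y where xy: "nat a * x = p * y + 1" using bezout_prime[OF prime] by blast
  have "int (nat a * x) = int (p * y + 1)" using xy by simp
  then have "a * int x = int p * int y + 1" using a by simp
  then have "(a * int x) * b = (int p * int y + 1) * b" by simp
  then have "int (x * nat b) * a - b = int p * (int y * b)"
    using assms(3) by (simp add: algebra_simps)
  then show ?thesis using that[of "x * nat b"] by (metis dvd_triv_left)
qed

text \<open>Linear algebra over the field with \<open>p\<close> elements: a functional that vanishes
  on the common kernel of finitely many others is a combination of them. The functional
  \<open>g\<close> is removed by subtracting a multiple fitted at a point where \<open>g\<close> is
  nonzero and the members of \<open>I\<close> vanish.\<close>

lemma Gen_of_finite:
  assumes "finite I" "I \<subseteq> {f \<in> FF. \<Theta> f \<in> Gen}" "f \<in> FF"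
    and "\<And>k. k \<in> K \<Longrightarrow> (\<forall>g\<in>I. g k = 0) \<Longrightarrow> f k = 0"
  shows "\<Theta> f \<in> Gen"
  using assms
proof (induction I arbitrary: f rule: finite_induct)
  case empty
  then have "\<Theta> f = \<Theta> (\<lambda>x. 0)" using FF_zero by (intro \<Theta>_eq_of_restrict) auto
  then show ?case unfolding \<Theta>_zero by (simp add: generate.one)
next
  case (insert g I)
  have g: "g \<in> FF" "\<Theta> g \<in> Gen" using insert.prems(1) by auto
  have f: "f \<in> FF" by (rule insert.prems(2))
  show ?case
  proof (cases "\<exists>k0\<in>K. (\<forall>h\<in>I. h k0 = 0) \<and> g k0 \<noteq> 0")
    case False
    then show ?thesis using insert.IH[of f] insert.prems by blast
  next
    case True
    then obtain k0 where k0: "k0 \<in> K" "\<forall>h\<in>I. h k0 = 0" "g k0 \<noteq> 0" by blast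
    have k0c: "k0 \<in> carrier G" using k0 lpc_carrier by auto
    have gk0: "g k0 \<in> {0..<int p}" using cochain1_range[OF FF_cochain1[OF g(1)] k0c] .
    obtain c :: nat where c: "int p dvd int c * g k0 - f k0"
      using solve_mod_prime[OF gk0 k0(3)] cochain1_range[OF FF_cochain1[OF f] k0c] by (metis atLeastLessThan_iff)
    have "lin f g c k = 0" if k: "k \<in> K" "\<forall>h\<in>I. h k = 0" for k
    proof -
      have kc: "k \<in> carrier G" using k lpc_carrier by auto
      obtain t :: nat where t: "int p dvd int t * g k0 - g k"
        using solve_mod_prime[OF gk0 k0(3)] cochain1_range[OF FF_cochain1[OF g(1)] kc] by (metis atLeastLessThan_iff)
      \<comment> \<open>A natural number congruent to \<open>- t\<close> modulo \<open>p\<close>: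
        multiplying \<open>k\<close> by this power of \<open>k0\<close> makes \<open>g\<close>
        vanish and leaves the values of the members of \<open>I\<close> unchanged.\<close>
      define q where "q = (p - 1) * t"
      have q: "int q = int p * int t - int t"
        unfolding q_def using p_pos by (simp add: of_nat_diff algebra_simps)
      define k' where "k' = k \<otimes> k0 [^] q"
      have k': "k' \<in> K" unfolding k'_def
        using k k0 nat_pow_in_subgroup[OF lpc_subgroup] subgroup.m_closed[OF lpc_subgroup] by blast
      have val: "h k' = (h k + int q * h k0) mod int p" if h: "h \<in> FF" for h
        unfolding k'_def using FF_add[OF h k(1), of "k0 [^] q"] FF_pow[OF h k0(1), of q] k0c
        by (simp add: mod_add_right_eq)
      have "h k' = 0" if "h \<in> I" for h
      proof -
        have "h \<in> FF" using that insert.prems(1) by blast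
        moreover have "h k = 0" "h k0 = 0" using k(2) k0(2) that by blast+
        ultimately show ?thesis using val[of h] by simp
      qed
      moreover have "g k' = 0"
      proof -
        have "g k + int q * g k0 = int p * (int t * g k0) - (int t * g k0 - g k)"
          unfolding q by (simp add: algebra_simps)
        then have "int p dvd g k + int q * g k0" using t by (metis dvd_diff dvd_triv_left)
        then show ?thesis using val[OF g(1)] by simp
      qed
      ultimately have "f k' = 0" using insert.prems(3)[OF k'] by blast
      then have fk: "int p dvd f k + int q * f k0" using val[OF f] by (simp add: mod_eq_0_iff_dvd)
      have e: "f k - int c * g k = (f k + int q * f k0) - int p * (int t * f k0)
          - int t * (int c * g k0 - f k0) + int c * (int t * g k0 - g k)"
        unfolding q by (simp add: algebra_simps)
      have "int p dvd f k - int c * g k"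
        unfolding e by (rule dvd_add[OF dvd_diff[OF dvd_diff[OF fk dvd_triv_left] dvd_mult[OF c]] dvd_mult[OF t]])
      then show ?thesis using kc by (simp add: mod_eq_0_iff_dvd)
    qed
    then have "\<Theta> (lin f g c) \<in> Gen"
      using insert.IH[OF _ FF_lin[OF f g(1)]] insert.prems(1) by blast
    then show ?thesis by (rule Gen_of_lin[OF f g])
  qed
qed

lemma coh_unm_axioms: "s \<in> {1..n} \<Longrightarrow> coh_unm G T p n s"
  by (intro coh_unm.intro lpc_coh_axioms unm.intro prime) auto

text \<open>Once the intersection is known to lie in \<open>K\<close>, it is the set of common zeros
  of the functions whose classes are unitriangular. Comparing it with the next term is then a
  duality question about functions on \<open>K\<close>.\<close>

theorem TU_Unm_iff:
  assumes TK: "(\<Inter>s\<in>{1..n}. TU G T (Unm p n s)) \<subseteq> K"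
  shows "(\<Inter>s\<in>{1..n}. TU G T (Unm p n s)) = lpc G T p (Suc n) \<longleftrightarrow> Gen = Ker"
proof
  assume TL: "(\<Inter>s\<in>{1..n}. TU G T (Unm p n s)) = lpc G T p (Suc n)"
  show "Gen = Ker"
  proof (intro equalityI Gen_subset_Ker subsetI)
    fix A assume "A \<in> Ker"
    then obtain f where f: "f \<in> FF" "A = \<Theta> f" unfolding Ker_eq by blast
    let ?GF = "{f \<in> FF. \<Theta> f \<in> Gen}" and ?N = "\<lambda>h. {x \<in> carrier G. h x \<noteq> 0}"
    have opn: "openin T (?N h)" if "h \<in> FF" for h
    proof -
      have "openin T {x \<in> topspace T. h x \<in> {0..<int p} - {0}}"
        using FF_cochain1[OF that] unfolding cochain1_def
        by (intro openin_continuous_map_preimage[of T "discrete_topology {0..<int p}"]) auto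
      moreover have "{x \<in> topspace T. h x \<in> {0..<int p} - {0}} = ?N h"
        using cochain1_range[OF FF_cochain1[OF that]] by auto
      ultimately show ?thesis by simp
    qed
    \<comment> \<open>The part of \<open>K\<close> where \<open>f\<close> is nonzero is compact and
      covered by the open sets where members of \<open>?GF\<close> are nonzero; a finite subcover
      supplies the finite set for \<open>Gen_of_finite\<close>.\<close>
    have "compactin T (K \<inter> ?N f)"
    proof (rule closedin_compact_space[OF compact])
      have "closedin T {x \<in> topspace T. f x \<in> {0..<int p} - {0}}"
        using FF_cochain1[OF f(1)] unfolding cochain1_def
        by (intro closedin_continuous_map_preimage[of T "discrete_topology {0..<int p}"]) auto
      moreover have "{x \<in> topspace T. f x \<in> {0..<int p} - {0}} = ?N f"
        using cochain1_range[OF FF_cochain1[OF f(1)]] by auto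
      ultimately show "closedin T (K \<inter> ?N f)" using lpc_closed by auto
    qed
    moreover have "K \<inter> ?N f \<subseteq> \<Union>(?N ` ?GF)"
    proof
      fix k assume k: "k \<in> K \<inter> ?N f"
      \<comment> \<open>As \<open>f\<close> vanishes on the next term, a point where it is nonzero
        is detected by some homomorphism.\<close>
      then have "k \<notin> (\<Inter>s\<in>{1..n}. TU G T (Unm p n s))" unfolding TL using FF_vanish[OF f(1)] by auto
      then obtain s h where s: "s \<in> {1..n}" and h: "h \<in> cont_hom_fin G T (Unm p n s)" "h k \<noteq> \<one>\<^bsub>Unm p n s\<^esub>"
        using k unfolding TU_def by auto
      interpret V: coh_unm G T p n s by (rule coh_unm_axioms[OF s])
      obtain f' where f': "f' \<in> FF" "\<Theta> f' \<in> UE" "\<And>k. k \<in> K \<Longrightarrow> h k \<noteq> \<one>\<^bsub>Unm p n s\<^esub> \<Longrightarrow> f' k \<noteq> 0"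
        using V.unitriangular_of_hom[OF h(1)] by blast
      have "\<Theta> f' \<in> Gen" using f' \<Theta>_Ker by (intro generate.incl) blast
      then show "k \<in> \<Union>(?N ` ?GF)" using f' h(2) k by blast
    qed
    ultimately obtain \<F> where F: "finite \<F>" "\<F> \<subseteq> ?N ` ?GF" "K \<inter> ?N f \<subseteq> \<Union>\<F>"
      using compactinD[of T "K \<inter> ?N f" "?N ` ?GF"] opn by blast
    then obtain I where I: "I \<subseteq> ?GF" "finite I" "\<F> = ?N ` I" using finite_subset_image[OF F(1,2)] by (elim exE conjE) (rule that)
    have "f k = 0" if k: "k \<in> K" "\<forall>g\<in>I. g k = 0" for k
    proof (rule ccontr)
      assume "f k \<noteq> 0"
      then have "k \<in> \<Union>(?N ` I)" using F(3) k(1) lpc_carrier unfolding I(3) by blast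
      then show False using k(2) by blast
    qed
    then show "A \<in> Gen" unfolding f(2) using Gen_of_finite[OF I(2,1) f(1)] by blast
  qed
next
  assume GK: "Gen = Ker"
  show "(\<Inter>s\<in>{1..n}. TU G T (Unm p n s)) = lpc G T p (Suc n)"
  proof (intro equalityI subsetI)
    fix x assume x: "x \<in> lpc G T p (Suc n)"
    show "x \<in> (\<Inter>s\<in>{1..n}. TU G T (Unm p n s))"
    proof
      fix s assume s: "s \<in> {1..n}"
      interpret V: coh_unm G T p n s by (rule coh_unm_axioms[OF s])
      have "h x = \<one>\<^bsub>Unm p n s\<^esub>" if "h \<in> cont_hom_fin G T (Unm p n s)" for h
        using V.V.hom_Unm_lpc[OF top_group_axioms that, of "Suc n"] x unfolding V.V.F_Suc_n V.V.Unm_eq by auto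
      then show "x \<in> TU G T (Unm p n s)" unfolding TU_def using lpc_carrier[OF x] by blast
    qed
  next
    fix g assume g: "g \<in> (\<Inter>s\<in>{1..n}. TU G T (Unm p n s))"
    then have gK: "g \<in> K" using TK by blast
    show "g \<in> lpc G T p (Suc n)"
    proof (rule ccontr)
      assume "g \<notin> lpc G T p (Suc n)"
      then obtain f where f: "f \<in> FF" "f g \<noteq> 0" using FF_separates[OF gK] by blast
      interpret H: group "H2 Q TQ p" by (rule Q.group_H2)
      \<comment> \<open>Since every homomorphism kills \<open>g\<close>, each generating class comes
        from a function vanishing at \<open>g\<close>. These classes form a subgroup, which
        therefore contains all of \<open>Gen\<close>.\<close>
      define SS where "SS = \<Theta> ` {h \<in> FF. h g = 0}"
      have "subgroup SS (H2 Q TQ p)"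
        using \<Theta>_image_subgroup[of "{g}"] unfolding SS_def by simp
      moreover have "Ker \<inter> UE \<subseteq> SS"
      proof
        fix A assume A: "A \<in> Ker \<inter> UE"
        then obtain a where a: "a \<in> FF" "A = \<Theta> a" unfolding Ker_eq by blast
        obtain \<rho>b s where s: "s \<in> {1..n}" and \<rho>b: "\<rho>b \<in> cont_hom_fin Q TQ (Ubar p n s)" "A = h2_pull Q TQ p \<rho>b (alpha p n s)"
          using A unfolding unitriangular_elems_def by blast
        interpret V: coh_unm G T p n s by (rule coh_unm_axioms[OF s])
        obtain \<rho> where \<rho>: "\<rho> \<in> cont_hom_fin G T (Unm p n s)" "\<And>k. k \<in> K \<Longrightarrow> \<rho> k = \<one>\<^bsub>Unm p n s\<^esub> \<Longrightarrow> a k = 0"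
          using V.hom_of_unitriangular[OF a(1) \<rho>b(1)] \<rho>b(2) a(2) by metis
        have "\<rho> g = \<one>\<^bsub>Unm p n s\<^esub>" using g s \<rho>(1) unfolding TU_def by blast
        then show "A \<in> SS" unfolding SS_def using a \<rho>(2)[OF gK] by blast
      qed
      ultimately have "Gen \<subseteq> SS" by (rule H.generate_subgroup_incl[rotated])
      then have "\<Theta> f \<in> SS" using GK \<Theta>_Ker[OF f(1)] by blast
      then obtain h where h: "h \<in> FF" "h g = 0" "\<Theta> f = \<Theta> h" unfolding SS_def by blast
      then have "f g = h g" using restrict_eq_of_\<Theta>_eq[OF f(1) h(1,3) gK] by simp
      then show False using f h by simp
    qed
  qed
qed

end

section \<open>Quotients of free profinite groups\<close>

lemma (in top_group_mod) cont_hom_fin_descend: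
  assumes h: "h \<in> cont_hom_fin G T P" and P: "group P" and ker: "\<And>x. x \<in> N \<Longrightarrow> h x = \<one>\<^bsub>P\<^esub>"
  obtains hb where "hb \<in> cont_hom_fin (G Mod N) (quot_top G T N) P" "\<And>x. x \<in> carrier G \<Longrightarrow> hb (\<pi> x) = h x"
proof -
  have hh: "h \<in> hom G P" and c: "continuous_map T (discrete_topology (carrier P)) h"
    using h unfolding cont_hom_fin_def by auto
  interpret h: group_hom G P h by (intro group_hom.intro group_hom_axioms.intro is_group P hh)
  have const: "h x = h y" if xy: "x \<in> carrier G" "y \<in> carrier G" "\<pi> x = \<pi> y" for x y
  proof -
    have "h (x \<otimes> inv y) = \<one>\<^bsub>P\<^esub>" using ker rcos_eq_iff xy by blast
    then have "h x \<otimes>\<^bsub>P\<^esub> inv\<^bsub>P\<^esub> h y = \<one>\<^bsub>P\<^esub>" using xy by simp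
    then show ?thesis using xy by (metis h.H.inv_solve_right' h.H.l_one h.H.one_closed h.hom_closed)
  qed
  obtain hb where hb: "hb \<in> hom (G Mod N) P" "\<And>x. x \<in> carrier G \<Longrightarrow> hb (\<pi> x) = h x"
    using FactGroup_universal[OF hh normal_axioms const] by blast
  have "continuous_map (quot_top G T N) (discrete_topology (carrier P)) hb"
    by (rule continuous_map_descend[OF c]) (rule hb(2))
  with hb that show ?thesis unfolding cont_hom_fin_def by blast
qed

lemma cont_hom_fin_compose:
  "h \<in> cont_hom_fin G T P \<Longrightarrow> k \<in> hom P R \<Longrightarrow> k \<circ> h \<in> cont_hom_fin G T R"
  unfolding cont_hom_fin_def
  using Group.hom_compose[of h G P k R]
  by (auto intro!: continuous_map_compose[of T "discrete_topology (carrier P)"] continuous_map_from_discrete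
      simp: hom_def)

locale free_quotient =
  fixes S :: "('a, 'b) monoid_scheme" and TS :: "'a topology" and B N :: "'a set" and p n :: nat
  assumes S: "pro_group S TS" and B: "profinite_basis S TS B" and prime: "prime p" and n: "2 \<le> n"
    and N: "N \<lhd> S" "N \<subseteq> lpc S TS p n"
begin

sublocale S: pro_group S TS by (rule S)

sublocale M: top_group_mod S TS N
  by (intro top_group_mod.intro S.top_group_axioms N)

abbreviation "G \<equiv> S Mod N"
abbreviation "TG \<equiv> quot_top S TS N"

sublocale G: lpc_coh G TG p n
  by (intro lpc_coh.intro lpc_coh_axioms.intro pro_group_quot[OF S N(1)] prime n)

lemma proj_lpc: "M.\<pi> ` lpc S TS p n \<subseteq> lpc G TG p n"
proof (rule S.lpc_image_subset[OF M.r_coset_hom_Mod M.continuous_map_proj G.is_group, where F = "lpc G TG p"])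
  show "M.\<pi> ` carrier S \<subseteq> lpc G TG p 1" by (auto simp: carrier_FactGroup)
qed (use n G.lpc_subgroup G.lpc_closed G.lpc_gcomm G.lpc_pow in auto)

text \<open>The homomorphisms attached to words kill \<open>lpc S TS p n\<close>, which contains
  \<open>N\<close>, and so descend to \<open>G\<close>. The entry at \<open>(0, s - 1)\<close> is
  where a word of length \<open>s - 1\<close> is counted; words are nonempty, whence
  \<open>1 < s\<close>.\<close>

lemma mem_lpc_of_homs:
  assumes A: "A \<in> carrier G"
    and vanish: "\<And>s h. s \<in> {1..n} \<Longrightarrow> 1 < s \<Longrightarrow> h \<in> cont_hom_fin G TG (Unm p n s) \<Longrightarrow> h A 0 (s - 1) = 0"
  shows "A \<in> lpc G TG p n"
proof -
  obtain g where g: "g \<in> carrier S" "A = M.\<pi> g" using A unfolding carrier_FactGroup by auto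
  have "g \<in> lpc S TS p n"
  proof (rule mem_lpc_of_word_homs[OF S B prime n g(1)])
    fix w :: "'a list" and h
    assume w: "w \<noteq> []" "length w < n" and h: "h \<in> cont_hom_fin S TS (Unm p n (Suc (length w)))"
      and ker: "\<And>x. x \<in> lpc S TS p n \<Longrightarrow> h x = \<one>\<^bsub>Unm p n (Suc (length w))\<^esub>"
    interpret V: unm p n "Suc (length w)" using prime w by unfold_locales auto
    have "group (Unm p n (Suc (length w)))" unfolding V.Unm_eq by (rule V.U.is_group)
    then obtain hb where "hb \<in> cont_hom_fin G TG (Unm p n (Suc (length w)))" "\<And>x. x \<in> carrier S \<Longrightarrow> hb (M.\<pi> x) = h x"
      using M.cont_hom_fin_descend[OF h] ker N(2) by blast
    then show "h g 0 (length w) = 0"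
      using vanish[of "Suc (length w)" hb] g w by (cases w) auto
  qed
  then show ?thesis using proj_lpc g by blast
qed

lemma TU_Unm_subset: "(\<Inter>s\<in>{1..n}. TU G TG (Unm p n s)) \<subseteq> lpc G TG p n"
proof
  fix A assume A: "A \<in> (\<Inter>s\<in>{1..n}. TU G TG (Unm p n s))"
  show "A \<in> lpc G TG p n"
  proof (rule mem_lpc_of_homs)
    have "1 \<in> {1..n}" using n by simp
    then have "A \<in> TU G TG (Unm p n 1)" using A by blast
    then show "A \<in> carrier G" unfolding TU_def by blast
    fix s h assume s: "s \<in> {1..n}" "1 < s" and h: "h \<in> cont_hom_fin G TG (Unm p n s)"
    have "A \<in> TU G TG (Unm p n s)" using A s by blast
    then have "h A = \<one>\<^bsub>Unm p n s\<^esub>" using h unfolding TU_def by blast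
    then show "h A 0 (s - 1) = 0" using s by (simp add: Unm_def one_unitri)
  qed
qed

lemma TU_Ubar_eq: "(\<Inter>s\<in>{1..n}. TU G TG (Ubar p n s)) = lpc G TG p n"
proof (intro equalityI subsetI)
  fix A assume A: "A \<in> (\<Inter>s\<in>{1..n}. TU G TG (Ubar p n s))"
  show "A \<in> lpc G TG p n"
  proof (rule mem_lpc_of_homs)
    have "1 \<in> {1..n}" using n by simp
    then have "A \<in> TU G TG (Ubar p n 1)" using A by blast
    then show Ac: "A \<in> carrier G" unfolding TU_def by blast
    fix s h assume s: "s \<in> {1..n}" "1 < s" and h: "h \<in> cont_hom_fin G TG (Unm p n s)"
    interpret V: unm p n s using prime s by unfold_locales auto
    let ?k = "\<lambda>x. V.F n #>\<^bsub>V.U\<^esub> x"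
    have hU: "h A \<in> carrier V.U" using h Ac unfolding cont_hom_fin_def V.Unm_eq hom_def by auto
    have "?k \<circ> h \<in> cont_hom_fin G TG (Ubar p n s)"
      unfolding V.Ubar_eq by (rule cont_hom_fin_compose[OF h]) (unfold V.Unm_eq, rule V.Fn.r_coset_hom_Mod)
    moreover have "A \<in> TU G TG (Ubar p n s)" using A s by blast
    ultimately have "(?k \<circ> h) A = \<one>\<^bsub>Ubar p n s\<^esub>" unfolding TU_def by blast
    then have "V.F n #>\<^bsub>V.U\<^esub> h A = V.F n" unfolding V.Ubar_eq by simp
    then have "h A \<in> V.F n" using V.U.rcos_self[OF hU V.subgroup_F] by metis
    then have d: "V.q n (s - 1) dvd h A 0 (s - 1)" using V.F_entry[of "h A" n 0 "s - 1"] s by simp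
    \<comment> \<open>On the superdiagonal \<open>s - 1\<close> weight \<open>n\<close> demands
      divisibility by the full modulus, so passing to the quotient by the central subgroup loses
      nothing at this entry.\<close>
    have "n - (s - 1) = expo n s" using s by (auto simp: expo_def)
    then have "V.q n (s - 1) = int (p ^ expo n s)" unfolding V.q_def by simp
    moreover have "h A 0 (s - 1) \<in> {0..<int (p ^ expo n s)}"
      using unitri_entries(4)[OF hU, of 0 "s - 1"] s by simp
    ultimately show "h A 0 (s - 1) = 0" using d by (metis atLeastLessThan_iff dvd_imp_mod_0 mod_pos_pos_trivial)
  qed
next
  fix A assume A: "A \<in> lpc G TG p n"
  show "A \<in> (\<Inter>s\<in>{1..n}. TU G TG (Ubar p n s))"
  proof
    fix s assume s: "s \<in> {1..n}"
    interpret V: unm p n s using prime s by unfold_locales auto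
    have "h A = \<one>\<^bsub>Ubar p n s\<^esub>" if "h \<in> cont_hom_fin G TG (Ubar p n s)" for h
      using V.hom_Ubar_lpc[OF G.top_group_axioms that] A n by auto
    then show "A \<in> TU G TG (Ubar p n s)" unfolding TU_def using G.lpc_carrier[OF A] by blast
  qed
qed

end

theorem theorem10p3:
  fixes S :: "('a,'b) monoid_scheme" and TS :: "'a topology" and N :: "'a set" and p n :: nat
  assumes "prime p" and "n \<ge> 2"
    and "free_profinite_group S TS"
    and "closedin TS N" and "N \<lhd> S" and "N \<subseteq> lpc S TS p n"
  shows "let G = S Mod N; TG = quot_top S TS N;
             K = lpc G TG p n; Q = G Mod K; TQ = quot_top G TG K;
             Ker = {A \<in> carrier (H2 Q TQ p). inflation G TG p K A = \<one>\<^bsub>H2 G TG p\<^esub>}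
         in ((\<Inter>s\<in>{1..n}. TU G TG (Ubar p n s)) = lpc G TG p n)
          \<and> ((\<Inter>s\<in>{1..n}. TU G TG (Unm p n s)) = lpc G TG p (Suc n)
              \<longleftrightarrow> generate (H2 Q TQ p) (Ker \<inter> unitriangular_elems Q TQ p n) = Ker)"
proof -
  obtain B where "profinite_basis S TS B" "profinite_group S TS"
    using assms(3) unfolding free_profinite_group_def profinite_basis_def by blast
  then interpret free_quotient S TS B N p n
    using assms by (intro free_quotient.intro profinite_imp_pro_group) auto
  show ?thesis
    unfolding Let_def using TU_Ubar_eq G.TU_Unm_iff[OF TU_Unm_subset] unfolding G.Ker_def by blast
qed

end
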